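(* Let $p \equiv 7 \pmod 8$ be a prime such that the multiplicative order of $2$ modulo $p$ is $\frac{p-1}{2}$. Then there is no generalized bent function of type $[n,q] = [t_p, 2p]$. If moreover $2^{p-1} \not\equiv 1 \pmod{p^2}$, then for every integer $e \ge 1$ there is no generalized bent function of type $[n,q] = [t_p, 2p^e]$.
   Context: For an integer $q \ge 2$ let $\mathbb{Z}_q = \mathbb{Z}/q\mathbb{Z}$ and $\zeta_q = \exp(2\pi i/q)$. A function $f : \mathbb{Z}_q^n \to \mathbb{Z}_q$ is a generalized bent function (GBF) of type $[n,q]$ if $F(\lambda)\overline{F(\lambda)} = q^n$ for every $\lambda \in \mathbb{Z}_q^n$, where $F(\lambda) = \sum_{x \in \mathbb{Z}_q^n} \zeta_q^{f(x)} \zeta_q^{-x\cdot\lambda}$ and $x\cdot\lambda$ is the standard dot product. For a prime $p \equiv 7 \pmod 8$, the prime $2$ splits in $\mathbb{Q}(\sqrt{-p})$; $t_p$ denotes the smallest positive integer such that $\mathfrak{p}^{t_p}$ is principal, where $\mathfrak{p}$ is a prime ideal of the ring of integers of $\mathbb{Q}(\sqrt{-p})$ lying above $2$ (i.e. the order of $\mathfrak{p}$ in the class group; it does not depend on the choice of $\mathfrak{p}$). *)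

theory Defs
  imports "HOL-Analysis.Analysis" "HOL-Number_Theory.Number_Theory"
begin

text \<open>Elements of Z_q^n are represented as functions nat => nat that take values
  in {0..<q} on indices {0..<n} and are 0 outside (a canonical finite carrier).\<close>

definition Zqn :: "nat \<Rightarrow> nat \<Rightarrow> (nat \<Rightarrow> nat) set" where
  "Zqn n q = {x. (\<forall>i<n. x i < q) \<and> (\<forall>i\<ge>n. x i = 0)}"

definition zeta :: "nat \<Rightarrow> complex" where
  "zeta q = exp (2 * of_real pi * \<i> / of_nat q)"

definition dotp :: "nat \<Rightarrow> (nat \<Rightarrow> nat) \<Rightarrow> (nat \<Rightarrow> nat) \<Rightarrow> int" where
  "dotp n x l = (\<Sum>i<n. int (x i) * int (l i))"

definition walsh :: "nat \<Rightarrow> nat \<Rightarrow> ((nat \<Rightarrow> nat) \<Rightarrow> nat) \<Rightarrow> (nat \<Rightarrow> nat) \<Rightarrow> complex" where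
  "walsh n q f l = (\<Sum>x\<in>Zqn n q. zeta q ^ f x * zeta q powi (- dotp n x l))"

definition is_GBF :: "nat \<Rightarrow> nat \<Rightarrow> ((nat \<Rightarrow> nat) \<Rightarrow> nat) \<Rightarrow> bool" where
  "is_GBF n q f \<longleftrightarrow> (\<forall>x\<in>Zqn n q. f x < q) \<and>
     (\<forall>l\<in>Zqn n q. walsh n q f l * cnj (walsh n q f l) = of_nat q ^ n)"

text \<open>For p = 3 (mod 4) the ring of integers of Q(sqrt(-p)) is Z[(1+sqrt(-p))/2],
  realised as a subring of the complex numbers.\<close>
definition omega :: "nat \<Rightarrow> complex" where
  "omega p = (1 + \<i> * of_real (sqrt (real p))) / 2"

definition OK :: "nat \<Rightarrow> complex set" where
  "OK p = {of_int a + of_int b * omega p | a b. True}"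

definition is_ideal :: "complex set \<Rightarrow> complex set \<Rightarrow> bool" where
  "is_ideal R I \<longleftrightarrow> I \<subseteq> R \<and> 0 \<in> I \<and> (\<forall>x\<in>I. \<forall>y\<in>I. x + y \<in> I) \<and>
     (\<forall>r\<in>R. \<forall>x\<in>I. r * x \<in> I)"

definition is_prime_ideal :: "complex set \<Rightarrow> complex set \<Rightarrow> bool" where
  "is_prime_ideal R P \<longleftrightarrow> is_ideal R P \<and> P \<noteq> R \<and>
     (\<forall>x\<in>R. \<forall>y\<in>R. x * y \<in> P \<longrightarrow> x \<in> P \<or> y \<in> P)"

definition ideal_gen :: "complex set \<Rightarrow> complex set \<Rightarrow> complex set" where
  "ideal_gen R S = \<Inter>{J. is_ideal R J \<and> S \<subseteq> J}"

definition ideal_mult :: "complex set \<Rightarrow> complex set \<Rightarrow> complex set \<Rightarrow> complex set" where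
  "ideal_mult R I J = ideal_gen R {x * y | x y. x \<in> I \<and> y \<in> J}"

fun ideal_pow :: "complex set \<Rightarrow> complex set \<Rightarrow> nat \<Rightarrow> complex set" where
  "ideal_pow R I 0 = R"
| "ideal_pow R I (Suc n) = ideal_mult R I (ideal_pow R I n)"

definition is_principal :: "complex set \<Rightarrow> complex set \<Rightarrow> bool" where
  "is_principal R I \<longleftrightarrow> (\<exists>a\<in>R. I = {a * r | r. r \<in> R})"

definition class_order :: "complex set \<Rightarrow> complex set \<Rightarrow> nat" where
  "class_order R P = (LEAST t. t > 0 \<and> is_principal R (ideal_pow R P t))"

end

theory Submission
  imports Defs "Jordan_Normal_Form.Char_Poly" "HOL-Computational_Algebra.Nth_Powers"
begin

text \<open>
  Let \<open>N = p ^ e\<close>, let \<open>R\<close> be the ring generated by an \<open>N\<close>-th root of unity, and let \<open>t\<close> be the class order, the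
  least \<open>t > 0\<close> for which \<open>x\<^sup>2 + p y\<^sup>2 = 2 ^ (t + 2)\<close> has a solution in odd integers; \<open>t\<close> is odd because a
  solution for \<open>2 s\<close> yields one for \<open>s\<close>. The order hypothesis says that the units modulo \<open>N\<close> are \<open>\<plusminus> 2 ^ i\<close>, so
  \<open>2 R\<close> is the intersection of a prime \<open>M\<close>, stable under the Frobenius automorphism at 2, and its conjugate.

  Two elements of \<open>R\<close> with squared modulus \<open>2 ^ d N ^ t\<close> that avoid \<open>cnj M\<close> differ by a factor of modulus 1
  in \<open>R\<close>, since \<open>p\<close> is totally ramified. Comparing such an element with its Frobenius image produces an element
  of \<open>\<rat>(sqrt (- p))\<close> with the same norm, whence \<open>t \<le> d\<close>. In particular an element with squared modulus
  \<open>2 ^ t N ^ t\<close> is not divisible by 2, and two of them congruent modulo 2 agree up to sign.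

  For a generalized bent function this gives \<open>F (l + N u) = \<plusminus> F l\<close>. Summing over \<open>u\<close> in \<open>{0, 1} ^ n\<close>, the
  transform \<open>G\<close> of the restriction to even arguments satisfies \<open>2 ^ n * \<bar>G l\<bar>\<^sup>2 = k\<^sup>2 * N ^ n\<close> for an integer
  \<open>k\<close>; as \<open>n = t\<close> is odd, every \<open>\<bar>G l\<bar>\<^sup>2\<close> is an even integer, whereas Parseval gives the odd sum \<open>N ^ (2 n)\<close>.
\<close>


section \<open>Representations of powers of two by the norm form\<close>

text \<open>The existence of \<open>t\<close> does not rest on the finiteness of the class group:
  Thue's lemma yields elements of norm \<open>m * 2 ^ s\<close> with bounded odd \<open>m\<close>
  and unbounded \<open>s\<close>, and the quotient of two of them with the same \<open>m\<close>
  that agree modulo \<open>4 * m\<close> has norm a power of 2. The quadratic field enters as the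
  fixed field of the Frobenius automorphism at 2, whose powers form a subgroup of index two in the
  Galois group, not containing complex conjugation. Unique factorization may fail in
  \<open>R\<close>, so the quotient of two elements of equal squared modulus has to be shown
  integral directly. Its denominator involves the two primes above 2, treated by
  \<open>M_inter_cnj\<close>, and the single prime above \<open>p\<close>, treated by
  \<open>p_power_dvd_of_norm\<close>. Factors of modulus 1 are controlled by Kronecker's argument
  modulo 2: their Frobenius image is plus or minus their square, and the odd order of the Frobenius
  removes that sign.\<close>

text \<open>\<open>x + y * sqrt (- p)\<close> is twice an algebraic integer of norm
  \<open>2 ^ t\<close>; odd \<open>x\<close> and \<open>y\<close> keep this integer from being
  divisible by 2.\<close>

definition odd_rep :: "nat \<Rightarrow> nat \<Rightarrow> bool" where
  "odd_rep p t \<longleftrightarrow> (\<exists>x y::int. odd x \<and> odd y \<and> x\<^sup>2 + int p * y\<^sup>2 = 2 ^ (t + 2))"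

text \<open>Hensel lifting at 2: \<open>- p\<close> is 1 modulo 8, hence a square modulo every power
  of 2.\<close>

lemma ex_sqrt_neg_mod_two_power:
  assumes "p mod 8 = (7::nat)"
  shows "\<exists>r::int. odd r \<and> 2 ^ k dvd r\<^sup>2 + int p"
proof -
  have *: "\<exists>r::int. odd r \<and> 2 ^ (j + 3) dvd r\<^sup>2 + int p" for j
  proof (induction j)
    case 0
    have "int p mod 8 = 7" using assms by presburger
    then have "(8::int) dvd 1 + int p" by presburger
    then show ?case by (intro exI[of _ 1]) simp
  next
    case (Suc j)
    then obtain r u where r: "odd r" and u: "r\<^sup>2 + int p = 2 ^ (j + 3) * u" by (auto elim!: dvdE)
    show ?case
    proof (cases "even u")
      case True
      then obtain v where "u = 2 * v" by blast
      then have "r\<^sup>2 + int p = 2 ^ (Suc j + 3) * v" using u by (simp add: power_add)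
      then show ?thesis using r by (intro exI[of _ r]) simp
    next
      case False
      \<comment> \<open>The shift of \<open>r\<close> changes the value by an odd multiple of
        \<open>2 ^ (j + 3)\<close>, which repairs the parity of \<open>u\<close>.\<close>
      have "(r + 2 ^ (j + 2))\<^sup>2 + int p = (r\<^sup>2 + int p) + 2 ^ (j + 3) * r + 2 ^ (j + 3) * 2 ^ (j + 1)"
        by (simp add: power2_eq_square algebra_simps power_add)
      also have "\<dots> = 2 ^ (j + 3) * (u + r + 2 ^ (j + 1))" unfolding u by (simp add: algebra_simps)
      finally have "(r + 2 ^ (j + 2))\<^sup>2 + int p = 2 ^ (j + 3) * (u + r + 2 ^ (j + 1))" .
      moreover obtain v where "u + r + 2 ^ (j + 1) = 2 * v"
        using False r by (metis even_add evenE even_power even_numeral zero_less_Suc add.commute plus_1_eq_Suc)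
      ultimately have "(r + 2 ^ (j + 2))\<^sup>2 + int p = 2 ^ (Suc j + 3) * v" by (simp add: power_add)
      then show ?thesis using r by (intro exI[of _ "r + 2 ^ (j + 2)"]) simp
    qed
  qed
  obtain r :: int where "odd r" "2 ^ (k + 3) dvd r\<^sup>2 + int p" using * by blast
  then show ?thesis using power_le_dvd[of 2 "k + 3" "r\<^sup>2 + int p" k] by auto
qed

text \<open>Thue's lemma: the box has \<open>(2 ^ j + 1) ^ 2\<close> points, more than there are
  residues, and two points with equal residue have a short difference.\<close>

lemma thue_two_power:
  fixes r :: int
  shows "\<exists>x y. (x \<noteq> 0 \<or> y \<noteq> 0) \<and> \<bar>x\<bar> \<le> 2 ^ j \<and> \<bar>y\<bar> \<le> 2 ^ j \<and> 2 ^ (2 * j) dvd x - r * y"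
proof -
  define S where "S = {0..2 ^ j :: int} \<times> {0..2 ^ j :: int}"
  define g where "g = (\<lambda>(x, y). (x - r * y) mod 2 ^ (2 * j))"
  have "card (g ` S) \<le> card {0..<(2::int) ^ (2 * j)}"
    by (rule card_mono) (auto simp: g_def)
  also have "\<dots> = 2 ^ (2 * j)" by (simp add: nat_power_eq)
  also have "\<dots> < (2 ^ j + 1) ^ 2" by (simp add: power2_eq_square mult_2 power_add)
  also have "\<dots> = card S"
    by (simp add: S_def card_cartesian_product power2_eq_square nat_add_distrib nat_power_eq)
  finally have "\<not> inj_on g S" by (rule pigeonhole)
  then obtain a b c d where ab: "(a, b) \<in> S" "(c, d) \<in> S" "(a, b) \<noteq> (c, d)" "g (a, b) = g (c, d)"
    by (auto simp: inj_on_def)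
  then have "2 ^ (2 * j) dvd (a - r * b) - (c - r * d)"
    by (simp add: g_def mod_eq_dvd_iff)
  moreover have "(a - r * b) - (c - r * d) = (a - c) - r * (b - d)" by (simp add: algebra_simps)
  ultimately show ?thesis using ab
    by (intro exI[of _ "a - c"] exI[of _ "b - d"]) (auto simp: S_def)
qed

lemma sum_two_squares_eq_0_iff_int:
  fixes x y :: int assumes "0 < p"
  shows "x\<^sup>2 + int p * y\<^sup>2 = 0 \<longleftrightarrow> x = 0 \<and> y = 0"
  using assms by (simp add: add_nonneg_eq_0_iff)

lemma form_parity:
  fixes x y :: int assumes "odd p" "even (x\<^sup>2 + int p * y\<^sup>2)"
  shows "even x \<longleftrightarrow> even y"
  using assms by simp

text \<open>A short vector of the lattice given by \<open>x = r * y\<close> modulo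
  \<open>2 ^ (2 * j)\<close> has a form value divisible by \<open>2 ^ (2 * j)\<close> and at most
  \<open>(p + 1) * 2 ^ (2 * j)\<close>, so the cofactor is bounded independently of
  \<open>k\<close>. Removing the common power of 2 makes both coordinates odd.\<close>

lemma ex_bounded_odd_multiple:
  assumes p: "p mod 8 = (7::nat)"
  shows "\<exists>s\<ge>k. \<exists>x y m::int. odd x \<and> odd y \<and> odd m \<and> 0 < m \<and> m \<le> int p + 1 \<and>
           x\<^sup>2 + int p * y\<^sup>2 = m * 2 ^ (s + 2)"
proof -
  have p0: "0 < p" "odd p" using p by presburger+
  \<comment> \<open>Large enough to absorb the loss of \<open>i \<le> p + 1\<close> factors 2 and
    the offset 2 in the exponent.\<close>
  define j where "j = k + p + 3"
  obtain r :: int where r: "2 ^ (2 * j) dvd r\<^sup>2 + int p" using ex_sqrt_neg_mod_two_power[OF p] by blast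
  obtain x0 y0 where xy: "x0 \<noteq> 0 \<or> y0 \<noteq> 0" "\<bar>x0\<bar> \<le> 2 ^ j" "\<bar>y0\<bar> \<le> 2 ^ j" "2 ^ (2 * j) dvd x0 - r * y0"
    using thue_two_power by blast
  have bnd: "x0\<^sup>2 + int p * y0\<^sup>2 \<le> (int p + 1) * 2 ^ (2 * j)"
  proof -
    have "x0\<^sup>2 \<le> (2 ^ j)\<^sup>2" "y0\<^sup>2 \<le> (2 ^ j)\<^sup>2" using xy by (simp_all add: abs_le_square_iff[symmetric])
    then have "x0\<^sup>2 + int p * y0\<^sup>2 \<le> (2 ^ j)\<^sup>2 + int p * (2 ^ j)\<^sup>2" by (intro add_mono mult_left_mono) auto
    then show ?thesis by (simp add: algebra_simps power_mult[symmetric] mult.commute)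
  qed
  define P where "P = (\<lambda>i. 2 ^ i dvd x0 \<and> (2::int) ^ i dvd y0)"
  have bd: "i \<le> j" if "P i" for i
  proof -
    have "\<exists>z. z \<noteq> 0 \<and> \<bar>z\<bar> \<le> 2 ^ j \<and> (2::int) ^ i dvd z" using xy that by (auto simp: P_def)
    then obtain z :: int where "z \<noteq> 0" "\<bar>z\<bar> \<le> 2 ^ j" "2 ^ i dvd z" by blast
    then have "(2::int) ^ i \<le> 2 ^ j" using dvd_imp_le_int[of z "2 ^ i"] by linarith
    then show ?thesis by simp
  qed
  define i where "i = (GREATEST i. P i)"
  have Pi: "P i" unfolding i_def by (rule GreatestI_nat[of P 0 j]) (use bd in \<open>auto simp: P_def\<close>)
  have nPi: "\<not> P (Suc i)" using Greatest_le_nat[of P "Suc i" j] bd by (fastforce simp: i_def)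
  obtain x y where x: "x0 = 2 ^ i * x" and y: "y0 = 2 ^ i * y" using Pi by (auto simp: P_def elim!: dvdE)
  have ij: "i \<le> j" using bd Pi by blast
  have eq0: "x0\<^sup>2 + int p * y0\<^sup>2 = 2 ^ (2 * i) * (x\<^sup>2 + int p * y\<^sup>2)"
    by (simp add: x y algebra_simps power_mult_distrib power_mult[symmetric] mult.commute)
  have "2 ^ i * (x - r * y) = x0 - r * y0" by (simp add: x y algebra_simps)
  then have "(2 ^ i :: int) * 2 ^ (2 * j - i) dvd 2 ^ i * (x - r * y)" using xy(4) ij by (simp add: power_add[symmetric])
  then have d1: "2 ^ (2 * j - i) dvd x - r * y" by simp
  have d2: "2 ^ (2 * j - i) dvd r\<^sup>2 + int p" using r power_le_dvd[of 2 "2 * j"] by fastforce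
  have "x\<^sup>2 + int p * y\<^sup>2 = (x - r * y) * (x + r * y) + (r\<^sup>2 + int p) * y\<^sup>2"
    by (simp add: power2_eq_square algebra_simps)
  then have d3: "2 ^ (2 * j - i) dvd x\<^sup>2 + int p * y\<^sup>2" using d1 d2 by simp
  have pos: "0 < x\<^sup>2 + int p * y\<^sup>2"
    using sum_two_squares_eq_0_iff_int[OF p0(1), of x y] xy(1) x y p0
    by (smt (verit) mult_eq_0_iff of_nat_0_le_iff mult_nonneg_nonneg zero_le_power2)
  \<comment> \<open>The linear congruence loses one factor \<open>2 ^ i\<close>, the form value two;
    the size bound then limits \<open>2 ^ i\<close> to \<open>p + 1\<close>.\<close>
  have ip: "i \<le> p + 1"
  proof (rule ccontr)
    assume neg: "\<not> ?thesis"
    have "(2::int) ^ (2 * j + i) = 2 ^ (2 * i) * 2 ^ (2 * j - i)" using ij by (simp add: power_add[symmetric])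
    also have "\<dots> \<le> x0\<^sup>2 + int p * y0\<^sup>2" unfolding eq0 using d3 pos by (intro mult_left_mono zdvd_imp_le) auto
    also have "\<dots> \<le> (int p + 1) * 2 ^ (2 * j)" by (rule bnd)
    finally have "(2::int) ^ i \<le> int p + 1" by (simp add: power_add)
    moreover have "int p + 1 < 2 ^ (p + 1)" using of_nat_less_two_power[of "p + 1", where 'a=int] by simp
    moreover have "(2::int) ^ (p + 1) \<le> 2 ^ i" using neg by (intro power_increasing) auto
    ultimately show False by linarith
  qed
  have "even (x\<^sup>2 + int p * y\<^sup>2)" using d3 ij ip by (rule_tac dvd_trans[OF _ d3]) (auto simp: j_def)
  then have "even x \<longleftrightarrow> even y" by (rule form_parity[OF p0(2)])
  moreover have "\<not> (even x \<and> even y)" using nPi by (auto simp: P_def x y mult.commute[of 2])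
  ultimately have "odd x" "odd y" by blast+
  define n where "n = x\<^sup>2 + int p * y\<^sup>2"
  have "n \<noteq> 0" using pos by (simp add: n_def)
  then obtain m where "n = 2 ^ multiplicity 2 n * m" "odd m"
    using multiplicity_decompose'[of n 2] by auto
  then obtain s where sm: "n = 2 ^ s * m" "odd m" by blast

  have s: "2 * j - i \<le> s"
  proof (rule ccontr)
    assume "\<not> ?thesis"
    then have "(2::int) ^ s * 2 dvd 2 ^ (2 * j - i)" by (metis le_imp_power_dvd not_less_eq_eq power_Suc2)
    then have "(2::int) ^ s * 2 dvd 2 ^ s * m" using d3 sm n_def by (metis dvd_trans)
    then show False using sm by simp
  qed
  have m: "0 < m" using pos sm by (simp add: n_def zero_less_mult_iff)
  have "m * 2 ^ (2 * j) \<le> m * (2 ^ (2 * i) * 2 ^ (2 * j - i))" using m ij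
    by (intro mult_left_mono) (auto simp: power_add[symmetric])
  also have "\<dots> \<le> m * (2 ^ (2 * i) * 2 ^ s)" using m s by (intro mult_left_mono) auto
  also have "\<dots> = x0\<^sup>2 + int p * y0\<^sup>2" using sm(1) by (simp add: eq0 n_def)
  finally have "m * 2 ^ (2 * j) \<le> (int p + 1) * 2 ^ (2 * j)" using bnd by linarith
  then have mp: "m \<le> int p + 1" by simp
  have "k \<le> s - 2" "s = (s - 2) + 2" using s ij ip by (auto simp: j_def)
  then show ?thesis using \<open>odd x\<close> \<open>odd y\<close> sm m mp
    by (intro exI[of _ "s - 2"] conjI exI[of _ x] exI[of _ y] exI[of _ m]) (auto simp: n_def mult.commute)
qed

text \<open>\<open>A + B * sqrt (- p)\<close> is \<open>x' + y' * sqrt (- p)\<close> times the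
  conjugate of \<open>x + y * sqrt (- p)\<close>. Congruence modulo \<open>m\<close> lets
  \<open>m\<close> be cancelled from it; congruence modulo 4 selects the same prime above 2 for both
  elements, so that \<open>2 ^ (s + 1)\<close> cancels as well.\<close>

lemma odd_rep_quotient:
  fixes x y x' y' m :: int
  assumes "odd p" and odd: "odd x" "odd y" "odd y'" "odd m" and "s < s'"
    and e: "x\<^sup>2 + int p * y\<^sup>2 = m * 2 ^ (s + 2)" and e': "x'\<^sup>2 + int p * y'\<^sup>2 = m * 2 ^ (s' + 2)"
    and c: "4 * m dvd x' - x" "4 * m dvd y' - y"
  shows "odd_rep p (s' - s)"
proof -
  define B where "B = x * y' - x' * y"
  define A where "A = x * x' + int p * y * y'"
  define C where "C = x * y' + x' * y"
  have m0: "m \<noteq> 0" using odd by auto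
  have mc: "m dvd x' - x" "m dvd y' - y" using c by (auto elim: dvd_mult_right)
  have "B = x * (y' - y) - y * (x' - x)" by (simp add: B_def algebra_simps)
  then have "m dvd B" using mc by simp
  then obtain b where b: "B = m * b" by blast
  have "A = m * 2 ^ (s + 2) + x * (x' - x) + int p * y * (y' - y)"
    unfolding e[symmetric] by (simp add: A_def power2_eq_square algebra_simps)
  then have "m dvd A" using mc by simp
  then obtain a where a: "A = m * a" by blast
  have "A\<^sup>2 + int p * B\<^sup>2 = (x\<^sup>2 + int p * y\<^sup>2) * (x'\<^sup>2 + int p * y'\<^sup>2)"
    by (simp add: A_def B_def power2_eq_square algebra_simps)
  then have "m\<^sup>2 * (a\<^sup>2 + int p * b\<^sup>2) = m\<^sup>2 * (2 ^ (s + 2) * 2 ^ (s' + 2))"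
    unfolding e e' a b by (simp add: power2_eq_square algebra_simps)
  then have ab: "a\<^sup>2 + int p * b\<^sup>2 = 2 ^ (s + 2) * 2 ^ (s' + 2)" using m0 by simp
  have "4 dvd x' - x" "4 dvd y' - y" using c by (auto elim: dvd_mult_left)
  then have "4 dvd x * (y' - y) + y * (x' - x)" by simp
  moreover have "C = 2 * (x * y) + (x * (y' - y) + y * (x' - x))" by (simp add: C_def algebra_simps)
  ultimately obtain k where "C = 2 * (x * y) + 4 * k" by (auto elim!: dvdE)
  then obtain c where c: "C = 2 * c" "odd c" using odd by (intro that[of "x * y + 2 * k"]) auto
  define w where "w = y'\<^sup>2 - 2 ^ (s' - s) * y\<^sup>2"
  have w: "odd w" using odd \<open>s < s'\<close> by (simp add: w_def)
  have ss: "(2::int) ^ (s' + 2) = 2 ^ (s + 2) * 2 ^ (s' - s)" using \<open>s < s'\<close> by (simp flip: power_add)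
  \<comment> \<open>This product contains 2 exactly \<open>s + 2\<close> times, and \<open>C\<close>
    is twice an odd number, so the factor \<open>2 ^ (s + 1)\<close> falls to
    \<open>B\<close>.\<close>
  have "B * C = (x\<^sup>2 + int p * y\<^sup>2) * y'\<^sup>2 - (x'\<^sup>2 + int p * y'\<^sup>2) * y\<^sup>2"
    by (simp add: B_def C_def power2_eq_square algebra_simps)
  then have "m * 2 * (b * c) = m * 2 * (2 ^ (s + 1) * w)"
    unfolding e e' ss b c w_def by (simp add: algebra_simps)
  then have bc: "b * c = 2 ^ (s + 1) * w" using m0 by simp
  moreover have "coprime (2 ^ (s + 1)) c" using c by simp
  ultimately have "2 ^ (s + 1) dvd b" by (metis coprime_dvd_mult_left_iff dvd_triv_left)
  then obtain b' where b': "b = 2 ^ (s + 1) * b'" by blast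
  have "b' * c = w" using bc by (simp add: b')
  then have ob: "odd b'" using w by auto
  have s2: "(2::int) ^ (s + 2) * 2 ^ (s' + 2) = (2 ^ (s + 1))\<^sup>2 * 2 ^ (s' - s + 2)"
    using \<open>s < s'\<close> by (simp flip: power_add power_mult)
  have "a\<^sup>2 = (2 ^ (s + 1))\<^sup>2 * (2 ^ (s' - s + 2) - int p * b'\<^sup>2)"
    using ab unfolding s2 b' by (simp add: power_mult_distrib algebra_simps)
  then have "(2 ^ (s + 1))\<^sup>2 dvd a\<^sup>2" by simp
  then have "2 ^ (s + 1) dvd a" by (subst (asm) pow_divides_pow_iff) auto
  then obtain a' where a': "a = 2 ^ (s + 1) * a'" by blast
  have "(2 ^ (s + 1))\<^sup>2 * (a'\<^sup>2 + int p * b'\<^sup>2) = (2 ^ (s + 1))\<^sup>2 * 2 ^ (s' - s + 2)"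
    using ab unfolding s2 b' a' by (simp add: power_mult_distrib algebra_simps)
  then have fin: "a'\<^sup>2 + int p * b'\<^sup>2 = 2 ^ (s' - s + 2)" by simp
  then have "even (a'\<^sup>2 + int p * b'\<^sup>2)" by simp
  then have "odd a'" using form_parity[OF \<open>odd p\<close>] ob by blast
  then show ?thesis using fin ob unfolding odd_rep_def by blast
qed

text \<open>Pigeonhole: infinitely many exponents \<open>s\<close> share one value of
  \<open>m\<close> and the residues of the coordinates modulo \<open>4 * m\<close>, and two such
  representations can be divided.\<close>

lemma ex_odd_rep:
  assumes p: "p mod 8 = (7::nat)"
  shows "\<exists>d>0. odd_rep p d"
proof -
  have po: "odd p" using p by presburger
  define Q where "Q = (\<lambda>s (x::int, y::int, m::int). odd x \<and> odd y \<and> odd m \<and> 0 < m \<and> m \<le> int p + 1 \<and>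
           x\<^sup>2 + int p * y\<^sup>2 = m * 2 ^ (s + 2))"
  define S where "S = {s. \<exists>v. Q s v}"
  have "\<exists>s\<ge>k. s \<in> S" for k
    using ex_bounded_odd_multiple[OF p, of k] by (auto simp: S_def Q_def)
  then have "infinite S" by (meson infinite_nat_iff_unbounded_le)
  have "\<forall>s\<in>S. \<exists>v. Q s v" by (simp add: S_def)
  then obtain h where h: "\<And>s. s \<in> S \<Longrightarrow> Q s (h s)" by metis
  define g where "g = (\<lambda>s. case h s of (x, y, m) \<Rightarrow> (m, x mod (4 * m), y mod (4 * m)))"
  have "g ` S \<subseteq> {0..int p + 1} \<times> {0..4 * (int p + 1)} \<times> {0..4 * (int p + 1)}"
  proof
    fix v assume "v \<in> g ` S"
    then obtain s where s: "s \<in> S" "v = g s" by blast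
    obtain x y m where xym: "h s = (x, y, m)" by (cases "h s")
    have m: "0 < m" "m \<le> int p + 1" using h[OF s(1)] by (auto simp: Q_def xym)
    then have "x mod (4 * m) < 4 * m" "y mod (4 * m) < 4 * m" by simp_all
    moreover have "4 * m \<le> 4 * (int p + 1)" using m by simp
    ultimately have "x mod (4 * m) \<le> 4 * (int p + 1) \<and> y mod (4 * m) \<le> 4 * (int p + 1)"
      by (meson less_imp_le order_trans)
    then show "v \<in> {0..int p + 1} \<times> {0..4 * (int p + 1)} \<times> {0..4 * (int p + 1)}"
      using m by (simp add: s(2) g_def xym)
  qed
  then have "finite (g ` S)" by (rule finite_subset) simp
  then obtain s0 where s0: "infinite {s \<in> S. g s = g s0}"
    using pigeonhole_infinite[OF \<open>infinite S\<close>] by blast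
  obtain s where s: "s \<in> S" "g s = g s0" using s0 by (metis (mono_tags, lifting) infinite_imp_nonempty ex_in_conv mem_Collect_eq)
  obtain s' where s': "s < s'" "s' \<in> S" "g s' = g s0" using s0 by (auto simp: infinite_nat_iff_unbounded)
  obtain x y m where v: "h s = (x, y, m)" by (cases "h s")
  obtain x' y' m' where v': "h s' = (x', y', m')" by (cases "h s'")
  have eq: "m' = m" "x' mod (4 * m) = x mod (4 * m)" "y' mod (4 * m) = y mod (4 * m)"
  proof -
    have "g s' = g s" using s(2) s'(3) by simp
    then show "m' = m" "x' mod (4 * m) = x mod (4 * m)" "y' mod (4 * m) = y mod (4 * m)"
      using v v' by (auto simp: g_def)
  qed
  have "odd_rep p (s' - s)"
  proof (rule odd_rep_quotient[OF po _ _ _ _ s'(1)])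
    show "4 * m dvd x' - x" "4 * m dvd y' - y" using eq by (simp_all add: mod_eq_dvd_iff)
  qed (use h[OF s(1)] h[OF s'(2)] v v' eq in \<open>auto simp: Q_def\<close>)
  then show ?thesis using s'(1) by (intro exI[of _ "s' - s"]) simp
qed

lemma coprime_mult_eq_prime_times_square:
  fixes a b y :: nat
  assumes "coprime a b" "a * b = p * y\<^sup>2" "p dvd a" "0 < p"
  shows "\<exists>c d. a = p * c\<^sup>2 \<and> b = d\<^sup>2"
proof -
  obtain a' where a': "a = p * a'" using assms by blast
  then have "a' * b = y\<^sup>2" using assms by simp
  moreover have "coprime a' b" using assms a' by simp
  ultimately have "is_nth_power 2 a'" "is_nth_power 2 b"
    using is_nth_power_mult_coprime_nat_iff[of a' b 2] by auto
  then show ?thesis using a' by (auto simp: is_nth_power_def)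
qed

text \<open>The equation factors as
  \<open>(2 ^ (s + 1) - x) * (2 ^ (s + 1) + x) = p * y\<^sup>2\<close> with coprime odd factors. One
  is a square, the other \<open>p\<close> times a square, and their sum is
  \<open>2 ^ (s + 2)\<close>.\<close>

lemma odd_rep_halve:
  assumes "prime p" "odd p" "odd_rep p (2 * s)"
  shows "odd_rep p s"
proof -
  obtain x0 y0 :: int where "odd x0" "odd y0" and xy: "x0\<^sup>2 + int p * y0\<^sup>2 = 2 ^ (2 * s + 2)"
    using assms by (auto simp: odd_rep_def)
  define x y where "x = nat \<bar>x0\<bar>" and "y = nat \<bar>y0\<bar>"
  have o: "odd x" "odd y" using \<open>odd x0\<close> \<open>odd y0\<close> by (simp_all add: x_def y_def even_nat_iff)
  have "int (x\<^sup>2 + p * y\<^sup>2) = int ((2 ^ (s + 1))\<^sup>2)"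
    using xy by (simp add: x_def y_def power_mult[symmetric] mult.commute)
  then have eq: "x\<^sup>2 + p * y\<^sup>2 = (2 ^ (s + 1))\<^sup>2" by (simp only: of_nat_eq_iff)
  moreover have "0 < p * y\<^sup>2" using o assms by (auto intro!: Nat.gr0I)
  ultimately have "x\<^sup>2 < (2 ^ (s + 1))\<^sup>2" by linarith
  then have lt: "x < 2 ^ (s + 1)" by (rule power2_less_imp_less) simp
  define u v where "u = 2 ^ (s + 1) - x" and "v = 2 ^ (s + 1) + x"
  have uv: "u * v = p * y\<^sup>2"
  proof -
    have "int u = 2 ^ (s + 1) - int x" "int v = 2 ^ (s + 1) + int x"
      using lt by (simp_all add: u_def v_def of_nat_diff)
    then have "int (u * v) = (2 ^ (s + 1) - int x) * (2 ^ (s + 1) + int x)" by (simp only: of_nat_mult)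
    also have "\<dots> = (2 ^ (s + 1))\<^sup>2 - (int x)\<^sup>2"
      by (simp add: power2_eq_square algebra_simps)
    also have "\<dots> = int ((2 ^ (s + 1))\<^sup>2) - int (x\<^sup>2)" by simp
    also have "\<dots> = int (p * y\<^sup>2)" using eq by linarith
    finally have "int (u * v) = int (p * y\<^sup>2)" .
    then show ?thesis by (simp only: of_nat_eq_iff)
  qed
  have sum: "u + v = 2 ^ (s + 2)" using lt by (simp add: u_def v_def)
  have ou: "odd u" "odd v" using o lt by (simp_all add: u_def v_def)
  have "coprime u v"
  proof (rule coprimeI)
    fix d assume d: "d dvd u" "d dvd v"
    then have "d dvd 2 ^ (s + 2)" using sum by (metis dvd_add)
    moreover have "coprime d (2 ^ (s + 2))" using d ou by (metis coprime_power_right_iff coprime_right_2_iff_odd dvd_trans)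
    ultimately show "is_unit d" by (metis coprime_absorb_left)
  qed
  have "p dvd u \<or> p dvd v" using uv assms(1) by (metis dvd_triv_left prime_dvd_mult_iff)
  then obtain c d where "u + v = d\<^sup>2 + p * c\<^sup>2" "odd (d\<^sup>2)" "odd (p * c\<^sup>2)"
  proof
    assume "p dvd u"
    then show ?thesis using coprime_mult_eq_prime_times_square[OF \<open>coprime u v\<close> uv] prime_gt_0_nat[OF assms(1)] ou that by (metis add.commute)
  next
    assume "p dvd v"
    then show ?thesis using coprime_mult_eq_prime_times_square[of v u p y] \<open>coprime u v\<close> uv prime_gt_0_nat[OF assms(1)] ou that
      by (metis coprime_commute mult.commute)
  qed
  then have "odd (int d)" "odd (int c)" "int (d\<^sup>2 + p * c\<^sup>2) = int (2 ^ (s + 2))" using sum by simp_all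
  then show ?thesis unfolding odd_rep_def by (metis of_nat_add of_nat_mult of_nat_numeral of_nat_power)
qed

text \<open>Halving an even solution lowers the exponent by two. It stays odd, so the descent cannot
  run into a trivial solution with \<open>y = 0\<close>: an even solution at \<open>d = 1\<close>
  would make 2 a square.\<close>

lemma odd_rep_of_odd_exponent:
  fixes x y :: int
  assumes "odd p" "2 < p" "odd d" "x\<^sup>2 + int p * y\<^sup>2 = 2 ^ (d + 2)"
  shows "\<exists>d'. 0 < d' \<and> d' \<le> d \<and> odd_rep p d'"
  using assms(3,4)
proof (induction d arbitrary: x y rule: less_induct)
  case (less d)
  have "even (x\<^sup>2 + int p * y\<^sup>2)" using less.prems by simp
  then have par: "even x \<longleftrightarrow> even y" by (rule form_parity[OF assms(1)])
  show ?case
  proof (cases "even x")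
    case False
    then show ?thesis using less.prems par by (intro exI[of _ d]) (auto simp: odd_rep_def odd_pos)
  next
    case True
    then obtain a b where ab: "x = 2 * a" "y = 2 * b" using par by (auto elim!: evenE)
    have ab2: "a\<^sup>2 + int p * b\<^sup>2 = 2 ^ d" using less.prems(2) by (simp add: ab power_mult_distrib)
    show ?thesis
    proof (cases "d = 1")
      case True
      have "b = 0"
      proof (rule ccontr)
        assume "b \<noteq> 0"
        then have "int p * 1 \<le> int p * b\<^sup>2" by (intro mult_left_mono) (auto simp: int_one_le_iff_zero_less)
        moreover have "a\<^sup>2 + int p * b\<^sup>2 = 2" using ab2 True by simp
        ultimately show False using assms(2) zero_le_power2[of a] by linarith
      qed
      then have "a\<^sup>2 = 2" using ab2 True by simp
      then have "even a" by (metis even_power even_numeral zero_less_numeral)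
      then obtain c where "a = 2 * c" by blast
      then have "4 * c\<^sup>2 = 2" using \<open>a\<^sup>2 = 2\<close> by (simp add: power_mult_distrib)
      then show ?thesis by presburger
    next
      case False
      then have d: "d = (d - 2) + 2" "odd (d - 2)" using less.prems(1) by (auto elim!: oddE)
      then have "\<exists>d'. 0 < d' \<and> d' \<le> d - 2 \<and> odd_rep p d'" using ab2 by (intro less.IH[of "d - 2" a b]) auto
      then show ?thesis by (meson diff_le_self le_trans)
    qed
  qed
qed

text \<open>Each step divides \<open>x + y * sqrt (- p)\<close> by \<open>sqrt (- p)\<close>, which
  exchanges the roles of the coordinates.\<close>

lemma remove_prime_from_form_value:
  fixes x y :: int
  assumes "prime p" "x\<^sup>2 + int p * y\<^sup>2 = m * int p ^ k"
  shows "\<exists>x y. x\<^sup>2 + int p * y\<^sup>2 = m"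
  using assms(2)
proof (induction k arbitrary: x y)
  case (Suc k)
  have "int p dvd x\<^sup>2 + int p * y\<^sup>2" using Suc.prems by simp
  then have "int p dvd x\<^sup>2" by (simp add: dvd_add_left_iff)
  then have "int p dvd x" using assms(1) by (metis prime_dvd_power prime_nat_int_transfer)
  then obtain z where z: "x = int p * z" by blast
  have "int p * (y\<^sup>2 + int p * z\<^sup>2) = int p * (m * int p ^ k)"
    using Suc.prems by (simp add: z power2_eq_square algebra_simps)
  then have "y\<^sup>2 + int p * z\<^sup>2 = m * int p ^ k" using assms(1) by (simp add: prime_gt_0_nat)
  then show ?case by (rule Suc.IH)
qed auto

section \<open>The order of a prime above 2 in the class group\<close>

lemma ideal_gen_superset: "S \<subseteq> ideal_gen R S"
  by (auto simp: ideal_gen_def)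

lemma ideal_gen_least: "is_ideal R J \<Longrightarrow> S \<subseteq> J \<Longrightarrow> ideal_gen R S \<subseteq> J"
  by (auto simp: ideal_gen_def)

lemma is_ideal_ideal_gen:
  assumes "is_ideal R R" "S \<subseteq> R"
  shows "is_ideal R (ideal_gen R S)"
  using assms by (auto simp: is_ideal_def ideal_gen_def)

lemma is_ideal_ideal_pow:
  assumes "is_ideal R R" "is_ideal R P"
  shows "is_ideal R (ideal_pow R P k)"
proof (induction k)
  case (Suc k)
  have "{x * y |x y. x \<in> P \<and> y \<in> ideal_pow R P k} \<subseteq> R"
    using assms Suc by (auto simp: is_ideal_def subset_iff)
  then show ?case using is_ideal_ideal_gen[OF assms(1)] by (simp add: ideal_mult_def)
qed (simp add: assms)

lemma ideal_pow_Suc_I: "x \<in> P \<Longrightarrow> y \<in> ideal_pow R P k \<Longrightarrow> x * y \<in> ideal_pow R P (Suc k)"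
  by (auto simp: ideal_mult_def intro!: subsetD[OF ideal_gen_superset])

lemma power_mem_ideal_pow:
  assumes "1 \<in> R" "x \<in> P"
  shows "x ^ k \<in> ideal_pow R P k"
proof (induction k)
  case (Suc k)
  then show ?case using ideal_pow_Suc_I[OF assms(2) Suc] by simp
qed (simp add: assms)

section \<open>The ring of integers of the imaginary quadratic field\<close>

locale prime_7_mod_8 =
  fixes p :: nat
  assumes prime_p: "prime p" and p_mod_8: "p mod 8 = 7"
begin

lemma p_odd: "odd p" using p_mod_8 by presburger

lemma p_gt_2: "2 < p" using p_mod_8 by (cases "p < 7") auto

text \<open>The norm of \<open>w\<close>. It is even because \<open>p\<close> is 7 modulo 8, and
  this is what makes 2 split.\<close>

definition c :: int where "c = (int p + 1) div 4"

lemma four_c: "4 * c = int p + 1" and even_c: "even c"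
  using p_mod_8 unfolding c_def by presburger+

abbreviation w :: complex where "w \<equiv> omega p"

lemma cnj_omega: "cnj w = 1 - w"
  by (simp add: omega_def complex_eq_iff)

lemma omega_square: "w * w = w - of_int c"
proof -
  define s where "s = \<i> * complex_of_real (sqrt (real p))"
  have "s * s = - of_real (sqrt (real p) * sqrt (real p))" by (simp add: s_def complex_eq_iff)
  then have s: "s * s = - of_nat p" by simp
  have w: "w = (1 + s) / 2" by (simp add: omega_def s_def)
  have "4 * (w * w) = 1 + 2 * s + s * s" unfolding w by (simp add: field_simps)
  also have "\<dots> = 4 * w - (of_int (int p) + 1)" unfolding s unfolding w by (simp add: field_simps)
  also have "(of_int (int p) + 1 :: complex) = of_int (4 * c)" unfolding four_c by simp
  finally have "4 * (w * w) = 4 * (w - of_int c)" by (simp add: right_diff_distrib)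
  then show ?thesis by (simp only: mult_cancel_left) simp
qed

lemma OK_I: "of_int a + of_int b * w \<in> OK p"
  by (auto simp: OK_def)

lemma OK_E:
  assumes "z \<in> OK p"
  obtains a b where "z = of_int a + of_int b * w"
  using assms by (auto simp: OK_def)

lemma OK_of_int: "of_int a \<in> OK p"
  using OK_I[of a 0] by simp

lemma OK_numerals: "0 \<in> OK p" "1 \<in> OK p" "2 \<in> OK p" "2 ^ k \<in> OK p" "w \<in> OK p"
  using OK_of_int[of 0] OK_of_int[of 1] OK_of_int[of 2] OK_of_int[of "2 ^ k"] OK_I[of 0 1] by simp_all

lemma OK_add: "x \<in> OK p \<Longrightarrow> y \<in> OK p \<Longrightarrow> x + y \<in> OK p"
proof (elim OK_E)
  fix a b a' b' assume "x = of_int a + of_int b * w" "y = of_int a' + of_int b' * w"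
  then have "x + y = of_int (a + a') + of_int (b + b') * w" by (simp add: algebra_simps)
  then show ?thesis using OK_I by metis
qed

lemma OK_mult: "x \<in> OK p \<Longrightarrow> y \<in> OK p \<Longrightarrow> x * y \<in> OK p"
proof (elim OK_E)
  fix a b a' b' assume "x = of_int a + of_int b * w" "y = of_int a' + of_int b' * w"
  then have "x * y = of_int a * of_int a' + (of_int a * of_int b' + of_int b * of_int a') * w + of_int b * of_int b' * (w * w)"
    by (simp add: algebra_simps)
  also have "\<dots> = of_int (a * a' - b * b' * c) + of_int (a * b' + b * a' + b * b') * w"
    unfolding omega_square by (simp add: algebra_simps)
  finally show ?thesis using OK_I by metis
qed

lemma OK_cnj: "x \<in> OK p \<Longrightarrow> cnj x \<in> OK p"
proof (elim OK_E)
  fix a b assume "x = of_int a + of_int b * w"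
  then have "cnj x = of_int (a + b) + of_int (- b) * w" by (simp add: cnj_omega algebra_simps)
  then show ?thesis using OK_I by metis
qed

lemma OK_power: "x \<in> OK p \<Longrightarrow> x ^ k \<in> OK p"
  by (induction k) (auto intro: OK_mult OK_numerals)

lemma is_ideal_OK: "is_ideal (OK p) (OK p)"
  by (auto simp: is_ideal_def intro: OK_add OK_mult OK_numerals)

lemma OK_coords_unique:
  assumes "of_int a + of_int b * w = of_int a' + of_int b' * w"
  shows "a = a'" "b = b'"
proof -
  have "Im (of_int a + of_int b * w) = Im (of_int a' + of_int b' * w)" using assms by simp
  then show b: "b = b'" using p_gt_2 by (simp add: omega_def)
  show "a = a'" using assms unfolding b by simp
qed

lemma OK_divide_int:
  assumes "of_int m / 2 ^ t \<in> OK p"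
  shows "2 ^ t dvd m"
proof -
  obtain a b where "of_int m / 2 ^ t = of_int a + of_int b * w" using assms by (rule OK_E)
  then have "of_int m = 2 ^ t * (of_int a + of_int b * w)" by (simp add: field_simps)
  then have "of_int m + of_int 0 * w = of_int (2 ^ t * a) + of_int (2 ^ t * b) * w" by (simp add: algebra_simps)
  then show ?thesis using OK_coords_unique by (metis dvd_triv_left)
qed

lemma norm_OK: "(of_int a + of_int b * w) * cnj (of_int a + of_int b * w) = of_int (a\<^sup>2 + a * b + c * b\<^sup>2)"
proof -
  have "(of_int a + of_int b * w) * cnj (of_int a + of_int b * w) =
     of_int a * of_int a + of_int a * of_int b + of_int b * of_int b * (w - w * w)"
    by (simp add: cnj_omega algebra_simps)
  then show ?thesis unfolding omega_square by (simp add: power2_eq_square algebra_simps)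
qed

text \<open>Twice \<open>z\<close> is \<open>(2 * a + b) + b * sqrt (- p)\<close>. An even
  \<open>b\<close> would make \<open>a\<close> even, because the norm is even, and then 2 would
  divide \<open>z\<close>.\<close>

lemma odd_rep_of_norm:
  assumes "z \<in> OK p" "z / 2 \<notin> OK p" "z * cnj z = 2 ^ j" "0 < j"
  shows "odd_rep p j"
proof -
  obtain a b where z: "z = of_int a + of_int b * w" using assms(1) by (rule OK_E)
  have "of_int (a\<^sup>2 + a * b + c * b\<^sup>2) = (of_int (2 ^ j) :: complex)"
    using assms(3) unfolding z norm_OK by simp
  then have n: "a\<^sup>2 + a * b + c * b\<^sup>2 = 2 ^ j" by (simp only: of_int_eq_iff)
  have "odd b"
  proof
    assume "even b"
    moreover have "even (a\<^sup>2 + a * b + c * b\<^sup>2)" unfolding n using assms(4) by simp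
    ultimately have "even a" by simp
    then obtain a' b' where "a = 2 * a'" "b = 2 * b'" using \<open>even b\<close> by (auto elim!: evenE)
    then have "z / 2 = of_int a' + of_int b' * w" by (simp add: z)
    then show False using assms(2) OK_I by metis
  qed
  have "(2 * a + b)\<^sup>2 + int p * b\<^sup>2 = 4 * a\<^sup>2 + 4 * a * b + (int p + 1) * b\<^sup>2"
    by (simp add: power2_eq_square algebra_simps)
  also have "\<dots> = 4 * (a\<^sup>2 + a * b + c * b\<^sup>2)" unfolding four_c[symmetric] by (simp add: algebra_simps)
  also have "\<dots> = 2 ^ (j + 2)" unfolding n by simp
  finally have "(2 * a + b)\<^sup>2 + int p * b\<^sup>2 = 2 ^ (j + 2)" .
  then show ?thesis using \<open>odd b\<close> unfolding odd_rep_def by (intro exI[of _ "2 * a + b"] exI[of _ b]) simp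
qed

text \<open>Primitivity is recorded as an odd trace: this is the form in which it lifts membership
  of \<open>g\<close> from one power of a prime above 2 to the next.\<close>

lemma norm_of_odd_rep:
  assumes "odd_rep p d"
  obtains g x where "g \<in> OK p" "g * cnj g = 2 ^ d" "g + cnj g = of_int x" "odd x"
proof -
  obtain x y :: int where xy: "odd x" "odd y" "x\<^sup>2 + int p * y\<^sup>2 = 2 ^ (d + 2)"
    using assms by (auto simp: odd_rep_def)
  then have "even (x - y)" by simp
  then obtain a where a: "x - y = 2 * a" by blast
  define g where "g = of_int a + of_int y * w"
  have x: "x = 2 * a + y" using a by simp
  have "g + cnj g = of_int x" by (simp add: g_def cnj_omega x algebra_simps)
  moreover have "g * cnj g = 2 ^ d"
  proof -
    have "4 * (a\<^sup>2 + a * y + c * y\<^sup>2) = 4 * a\<^sup>2 + 4 * a * y + (4 * c) * y\<^sup>2" by (simp add: algebra_simps)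
    also have "\<dots> = x\<^sup>2 + int p * y\<^sup>2" unfolding four_c x by (simp add: power2_eq_square algebra_simps)
    also have "\<dots> = 4 * 2 ^ d" by (simp add: xy)
    finally have "a\<^sup>2 + a * y + c * y\<^sup>2 = 2 ^ d" by simp
    then show ?thesis unfolding g_def norm_OK by simp
  qed
  ultimately show ?thesis using that[of g x] xy OK_I by (auto simp: g_def)
qed

section \<open>A prime ideal above 2 and its powers\<close>

context
  fixes P assumes prime_ideal: "is_prime_ideal (OK p) P" and two_mem: "2 \<in> P"
begin

lemma is_ideal_P: "is_ideal (OK p) P"
  using prime_ideal by (simp add: is_prime_ideal_def)

lemma P_subset: "x \<in> P \<Longrightarrow> x \<in> OK p" and P_add: "x \<in> P \<Longrightarrow> y \<in> P \<Longrightarrow> x + y \<in> P"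
  and P_mult: "r \<in> OK p \<Longrightarrow> x \<in> P \<Longrightarrow> r * x \<in> P"
  using is_ideal_P by (auto simp: is_ideal_def)

lemma one_notin_P: "1 \<notin> P"
proof
  assume "1 \<in> P"
  then have "OK p \<subseteq> P" using P_mult[of _ 1] by auto
  then show False using prime_ideal P_subset by (auto simp: is_prime_ideal_def)
qed

lemma P_diff: "x \<in> P \<Longrightarrow> y \<in> P \<Longrightarrow> x - y \<in> P"
  using P_add[of x "- y"] P_mult[of "-1" y] OK_of_int[of "-1"] by simp

lemma P_primeD: "x \<in> OK p \<Longrightarrow> y \<in> OK p \<Longrightarrow> x * y \<in> P \<Longrightarrow> x \<in> P \<or> y \<in> P"
  using prime_ideal by (simp add: is_prime_ideal_def)

lemma of_int_mem_P: "of_int m \<in> P \<longleftrightarrow> even m"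
proof
  assume "even m"
  then obtain k where "m = 2 * k" by blast
  then show "of_int m \<in> P" using P_mult[OF OK_of_int two_mem, of k] by (simp add: mult.commute)
next
  assume m: "of_int m \<in> P"
  show "even m"
  proof (rule ccontr)
    assume "odd m"
    then obtain k where "m = 2 * k + 1" by (rule oddE)
    then have "1 = of_int m - of_int k * (2 :: complex)" by simp
    then show False using one_notin_P P_diff[OF m P_mult[OF OK_of_int two_mem]] by metis
  qed
qed

text \<open>One of \<open>w\<close> and \<open>cnj w\<close> lies in \<open>P\<close>, since their
  product \<open>c\<close> is even. The last clause gives additive generators of \<open>P\<close>,
  which makes products of \<open>P\<close> with its conjugate explicit.\<close>

lemma ex_uniformizer:
  obtains g where "g \<in> P" "g + cnj g = 1" "g * cnj g = of_int c"
    "\<And>x. x \<in> P \<Longrightarrow> \<exists>a b. x = of_int (2 * a) + of_int b * g"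
proof -
  have "w * cnj w = of_int c" unfolding cnj_omega using omega_square by (simp add: algebra_simps)
  then have "w * cnj w \<in> P" using of_int_mem_P even_c by simp
  then have "w \<in> P \<or> cnj w \<in> P" using P_primeD OK_cnj OK_numerals by blast
  then obtain g where g: "g \<in> P" "g = w \<or> g = cnj w" by blast
  have ex: "\<exists>a b. x = of_int a + of_int b * g" if xO: "x \<in> OK p" for x
  proof -
    obtain a b where x: "x = of_int a + of_int b * w" using xO by (rule OK_E)
    show ?thesis
    proof (cases "g = w")
      case False
      then have w: "w = 1 - g" using g cnj_omega by simp
      have "x = of_int (a + b) + of_int (- b) * g" unfolding x by (subst w) (simp add: algebra_simps)
      then show ?thesis by blast
    qed (use x in blast)
  qed
  show ?thesis
  proof (rule that[OF g(1)])
    show "g + cnj g = 1" using g(2) cnj_omega by auto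
    show "g * cnj g = of_int c" using g(2) \<open>w * cnj w = of_int c\<close> by (auto simp: mult.commute)
    fix x assume x: "x \<in> P"
    then obtain a b where ab: "x = of_int a + of_int b * g" using ex P_subset by blast
    then have "of_int a = x - of_int b * g" by simp
    then have "of_int a \<in> P" using P_diff[OF x P_mult[OF OK_of_int g(1)]] by metis
    then have "even a" by (simp add: of_int_mem_P)
    then show "\<exists>a b. x = of_int (2 * a) + of_int b * g" using ab by (metis evenE)
  qed
qed

text \<open>In terms of the generators 2 and \<open>g\<close>, the only product that is not visibly
  even is \<open>g * cnj g = c\<close>.\<close>

lemma P_mult_cnj:
  assumes "x \<in> P" "y \<in> P"
  shows "x * cnj y / 2 \<in> OK p"
proof -
  obtain g where g: "g \<in> P" "g * cnj g = of_int c" "\<And>x. x \<in> P \<Longrightarrow> \<exists>a b. x = of_int (2 * a) + of_int b * g"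
    using ex_uniformizer by metis
  obtain a b a' b' where xy: "x = of_int (2 * a) + of_int b * g" "y = of_int (2 * a') + of_int b' * g"
    using g(3) assms by meson
  obtain c' where c': "c = 2 * c'" using even_c by blast
  have "x * cnj y = 2 * (of_int a * cnj y) + of_int b * (of_int (2 * a') * g + of_int b' * (g * cnj g))"
    by (simp add: xy algebra_simps)
  also have "\<dots> = 2 * (of_int a * cnj y + of_int b * (of_int a' * g + of_int b' * of_int c'))"
    unfolding g(2) c' by (simp add: algebra_simps)
  finally have "x * cnj y / 2 = of_int a * cnj y + of_int b * (of_int a' * g + of_int b' * of_int c')" by simp
  also have "\<dots> \<in> OK p" using P_subset[OF assms(2)] P_subset[OF g(1)] by (intro OK_add OK_mult OK_of_int OK_cnj)
  finally show ?thesis .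
qed

lemma is_ideal_P_pow: "is_ideal (OK p) (ideal_pow (OK p) P k)"
  by (rule is_ideal_ideal_pow[OF is_ideal_OK is_ideal_P])

lemma P_pow_subset: "x \<in> ideal_pow (OK p) P k \<Longrightarrow> x \<in> OK p"
  and P_pow_add: "x \<in> ideal_pow (OK p) P k \<Longrightarrow> y \<in> ideal_pow (OK p) P k \<Longrightarrow> x + y \<in> ideal_pow (OK p) P k"
  and P_pow_mult: "r \<in> OK p \<Longrightarrow> x \<in> ideal_pow (OK p) P k \<Longrightarrow> r * x \<in> ideal_pow (OK p) P k"
  using is_ideal_P_pow[of k] by (auto simp: is_ideal_def)

text \<open>A colon ideal, to be used with \<open>ideal_gen_least\<close>: divisibility of products
  need only be checked on generators.\<close>

lemma is_ideal_quotient: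
  assumes "S \<subseteq> OK p"
  shows "is_ideal (OK p) {z \<in> OK p. \<forall>s\<in>S. z * s / 2 ^ k \<in> OK p}"
proof -
  have "(x + y) * s / 2 ^ k \<in> OK p" if "x * s / 2 ^ k \<in> OK p" "y * s / 2 ^ k \<in> OK p" for x y s
    using OK_add[OF that] by (simp add: algebra_simps add_divide_distrib)
  moreover have "(r * x) * s / 2 ^ k \<in> OK p" if "r \<in> OK p" "x * s / 2 ^ k \<in> OK p" for r x s
    using OK_mult[OF that] by (simp add: algebra_simps)
  ultimately show ?thesis by (auto simp: is_ideal_def OK_numerals OK_add OK_mult)
qed

lemma P_pow_mult_cnj:
  assumes "x \<in> ideal_pow (OK p) P k" "y \<in> ideal_pow (OK p) P k"
  shows "x * cnj y / 2 ^ k \<in> OK p"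
  using assms
proof (induction k arbitrary: x y)
  case 0
  then show ?case by (auto intro: OK_mult OK_cnj)
next
  case (Suc k)
  define G where "G = {x * y |x y. x \<in> P \<and> y \<in> ideal_pow (OK p) P k}"
  have pw: "ideal_pow (OK p) P (Suc k) = ideal_gen (OK p) G" by (simp add: G_def ideal_mult_def)
  have GO: "G \<subseteq> OK p" using OK_mult P_subset P_pow_subset by (auto simp: G_def)
  have GG: "u * cnj v / 2 ^ Suc k \<in> OK p" if uv: "u \<in> G" "v \<in> G" for u v
  proof -
    obtain a b a' b' where ab: "u = a * b" "v = a' * b'" "a \<in> P" "a' \<in> P"
      "b \<in> ideal_pow (OK p) P k" "b' \<in> ideal_pow (OK p) P k" using uv unfolding G_def by blast
    have "u * cnj v / 2 ^ Suc k = (a * cnj a' / 2) * (b * cnj b' / 2 ^ k)" by (simp add: ab algebra_simps)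
    then show ?thesis using OK_mult[OF P_mult_cnj[OF ab(3,4)] Suc.IH[OF ab(5,6)]] by simp
  qed
  define H where "H = ideal_pow (OK p) P (Suc k)"
  \<comment> \<open>The claim has two arguments and is known on generators. This pass extends it in
    one argument; after conjugation, the next extends it in the other.\<close>
  have 1: "H \<subseteq> {z \<in> OK p. \<forall>s\<in>cnj ` G. z * s / 2 ^ Suc k \<in> OK p}"
    unfolding H_def pw by (rule ideal_gen_least[OF is_ideal_quotient]) (use GO GG OK_cnj in auto)
  have 2: "H \<subseteq> {z \<in> OK p. \<forall>s\<in>cnj ` H. z * s / 2 ^ Suc k \<in> OK p}"
    unfolding H_def pw
  proof (rule ideal_gen_least[OF is_ideal_quotient])
    show "cnj ` ideal_gen (OK p) G \<subseteq> OK p" unfolding pw[symmetric] using OK_cnj P_pow_subset[of _ "Suc k"] by blast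
    have "g * cnj h / 2 ^ Suc k \<in> OK p" if "g \<in> G" "h \<in> H" for g h
    proof -
      have "h * cnj g / 2 ^ Suc k \<in> OK p" using 1 that by auto
      from OK_cnj[OF this] show ?thesis by (simp add: mult.commute)
    qed
    then show "G \<subseteq> {z \<in> OK p. \<forall>s\<in>cnj ` ideal_gen (OK p) G. z * s / 2 ^ Suc k \<in> OK p}"
      using GO unfolding H_def pw by auto
  qed
  then show ?case using Suc.prems unfolding H_def by auto
qed

text \<open>One of the two conjugates of norm \<open>2 ^ d\<close> lies in \<open>P\<close>, and
  inductively in all powers up to \<open>d\<close>. It generates the last one because
  \<open>cnj g / 2 ^ d\<close> is its inverse and \<open>P_pow_mult_cnj\<close> makes the quotients
  integral.\<close>

lemma P_pow_principal_of_odd_rep: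
  assumes "odd_rep p d" "0 < d"
  shows "is_principal (OK p) (ideal_pow (OK p) P d)"
proof -
  obtain g0 x where g0: "g0 \<in> OK p" "g0 * cnj g0 = 2 ^ d" "g0 + cnj g0 = of_int x" "odd x"
    using norm_of_odd_rep[OF assms(1)] .
  have "of_int (2 ^ d) \<in> P" using assms(2) by (subst of_int_mem_P) simp
  then have "g0 * cnj g0 \<in> P" by (simp add: g0(2))
  then have "g0 \<in> P \<or> cnj g0 \<in> P" using P_primeD OK_cnj g0(1) by blast
  then obtain g where g: "g \<in> P" "g * cnj g = 2 ^ d" "g + cnj g = of_int x"
  proof
    assume "cnj g0 \<in> P"
    then show ?thesis using that[of "cnj g0"] g0 by (simp add: mult.commute add.commute)
  qed (use that g0 in blast)
  have two_pow: "2 ^ k \<in> ideal_pow (OK p) P k" for k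
    by (rule power_mem_ideal_pow) (auto simp: OK_numerals two_mem)
  have "g \<in> ideal_pow (OK p) P k" if "k \<le> d" for k
    using that
  proof (induction k)
    case 0
    then show ?case using P_subset g by simp
  next
    case (Suc k)
    let ?I = "ideal_pow (OK p) P (Suc k)"
    have gk: "g \<in> ideal_pow (OK p) P k" using Suc by simp
    have 1: "g * g \<in> ?I" "2 * g \<in> ?I" by (rule ideal_pow_Suc_I[OF _ gk]; use g two_mem in simp)+
    have "(2::complex) ^ d = 2 ^ (d - Suc k) * 2 ^ Suc k" using Suc.prems by (simp flip: power_add del: power_Suc)
    then have "2 ^ d \<in> ?I" using P_pow_mult[OF OK_numerals(4) two_pow] by metis
    \<comment> \<open>This is \<open>g\<close> times its odd trace; since \<open>2 * g\<close> lies
      in the next power too, so does \<open>g\<close>.\<close>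
    then have "g * g + g * cnj g \<in> ?I" unfolding g(2) by (rule P_pow_add[OF 1(1)])
    then have 2: "of_int x * g \<in> ?I" unfolding g(3)[symmetric] by (simp add: algebra_simps)
    obtain y where y: "x = 2 * y + 1" using g0(4) by (rule oddE)
    have "g = of_int x * g + of_int (- y) * (2 * g)" by (simp add: y algebra_simps)
    then show ?case using P_pow_add[OF 2 P_pow_mult[OF OK_of_int 1(2)]] by metis
  qed
  then have gd: "g \<in> ideal_pow (OK p) P d" by simp
  have g_nz: "g \<noteq> 0" using g(2) by auto
  have "ideal_pow (OK p) P d = {g * r |r. r \<in> OK p}"
  proof (intro equalityI subsetI)
    fix z assume z: "z \<in> ideal_pow (OK p) P d"
    have "z * cnj g / 2 ^ d \<in> OK p" by (rule P_pow_mult_cnj[OF z gd])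
    moreover have "z = g * (z * cnj g / 2 ^ d)" unfolding g(2)[symmetric] using g_nz by simp
    ultimately show "z \<in> {g * r |r. r \<in> OK p}" by blast
  next
    fix z assume "z \<in> {g * r |r. r \<in> OK p}"
    then show "z \<in> ideal_pow (OK p) P d" using P_pow_mult[OF _ gd] by (auto simp: mult.commute)
  qed
  then show ?thesis using P_subset[OF g(1)] unfolding is_principal_def by blast
qed

text \<open>A generator \<open>a\<close> divides \<open>2 ^ t\<close>, so its norm is some
  \<open>2 ^ j\<close>. Here \<open>t \<le> j\<close> because the ideal times its conjugate is
  divisible by \<open>2 ^ t\<close>, and \<open>j \<le> t\<close> because otherwise 2 would divide
  \<open>a\<close>.\<close>

lemma odd_rep_of_P_pow_principal:
  assumes "is_principal (OK p) (ideal_pow (OK p) P t)" "0 < t"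
  shows "odd_rep p t"
proof -
  obtain a where a: "a \<in> OK p" "ideal_pow (OK p) P t = {a * r |r. r \<in> OK p}"
    using assms by (auto simp: is_principal_def)
  have "a = a * 1" by simp
  then have aP: "a \<in> ideal_pow (OK p) P t" unfolding a(2) using OK_numerals by blast
  have "2 ^ t \<in> ideal_pow (OK p) P t" by (rule power_mem_ideal_pow) (auto simp: OK_numerals two_mem)
  then obtain r where r: "2 ^ t = a * r" "r \<in> OK p" unfolding a(2) by blast
  \<comment> \<open>If 2 divided \<open>a\<close>, it would divide \<open>g ^ t\<close> and its
    conjugate, so \<open>P\<close> would contain \<open>cnj g\<close> and with it
    \<open>1 = g + cnj g\<close>.\<close>
  have a2: "a / 2 \<notin> OK p"
  proof
    assume a2: "a / 2 \<in> OK p"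
    obtain g where g: "g \<in> P" "g + cnj g = 1" by (rule ex_uniformizer)
    have "g ^ t \<in> ideal_pow (OK p) P t" by (rule power_mem_ideal_pow) (auto simp: OK_numerals g)
    then obtain s where s: "g ^ t = a * s" "s \<in> OK p" unfolding a(2) by blast
    have "cnj (g ^ t) = cnj (a / 2 * s) * 2" by (simp add: s)
    then have "(cnj g) ^ t \<in> P" using P_mult[OF OK_cnj[OF OK_mult[OF a2 s(2)]] two_mem] by simp
    moreover have "x \<in> P" if "x ^ n \<in> P" "x \<in> OK p" for x n
      using that by (induction n) (use one_notin_P P_primeD OK_power in \<open>auto\<close>)
    ultimately have "cnj g \<in> P" using OK_cnj P_subset g by blast
    then show False using P_add[OF g(1)] g(2) one_notin_P by metis
  qed
  obtain i k where ik: "a = of_int i + of_int k * w" using a(1) by (rule OK_E)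
  obtain i' k' where ik': "r = of_int i' + of_int k' * w" using r(2) by (rule OK_E)
  define n where "n = i\<^sup>2 + i * k + c * k\<^sup>2"
  define n' where "n' = i'\<^sup>2 + i' * k' + c * k'\<^sup>2"
  have n: "a * cnj a = of_int n" unfolding ik n_def by (rule norm_OK)
  have n': "r * cnj r = of_int n'" unfolding ik' n'_def by (rule norm_OK)
  have "of_int (n * n') = (a * r) * cnj (a * r)" by (simp add: n[symmetric] n'[symmetric])
  also have "\<dots> = of_int (2 ^ (2 * t))" unfolding r(1)[symmetric] by (simp add: mult_2 power_add)
  finally have nn: "n * n' = 2 ^ (2 * t)" by (simp only: of_int_eq_iff)
  have "0 \<le> Re (a * cnj a)" by (simp add: complex_mult_cnj)
  then have "0 \<le> n" unfolding n by simp
  then have "nat n dvd 2 ^ (2 * t)" using nn by (metis dvd_triv_left nat_dvd_iff nat_power_eq nat_2 nat_numeral zero_le_numeral int_dvd_int_iff int_nat_eq of_nat_numeral of_nat_power)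
  then obtain j where j: "nat n = 2 ^ j" using divides_primepow_nat[OF two_is_prime_nat] by blast
  then have nj: "n = 2 ^ j" using \<open>0 \<le> n\<close> by (metis int_nat_eq of_nat_numeral of_nat_power)
  have "a * cnj a / 2 ^ t \<in> OK p" by (rule P_pow_mult_cnj[OF aP aP])
  then have "2 ^ t dvd n" using OK_divide_int unfolding n by blast
  then have "(2::int) ^ t \<le> 2 ^ j" unfolding nj by (rule zdvd_imp_le) simp
  then have tj: "t \<le> j" by simp
  have "j \<le> t"
  proof (rule ccontr)
    assume "\<not> j \<le> t"
    then have "(2::complex) ^ j = 2 * 2 ^ t * 2 ^ (j - Suc t)" by (simp flip: power_add power_Suc)
    moreover have "a * cnj a = 2 ^ j" using n nj by simp
    moreover have "a \<noteq> 0" using r by auto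
    ultimately have "cnj a / 2 = r * 2 ^ (j - Suc t)" using r(1) by (simp add: field_simps)
    then have "cnj a / 2 \<in> OK p" using r(2) OK_mult OK_numerals by metis
    from OK_cnj[OF this] show False using a2 by simp
  qed
  then have "a * cnj a = 2 ^ t" using n nj tj by simp
  then show ?thesis using odd_rep_of_norm a(1) a2 assms(2) by blast
qed

text \<open>By the two preceding lemmas the class order is the least positive \<open>t\<close> with
  \<open>odd_rep p t\<close>, a description free of ideals.\<close>

lemma class_order_properties:
  shows class_order_odd: "odd (class_order (OK p) P)"
    and class_order_le: "\<And>d. odd_rep p d \<Longrightarrow> 0 < d \<Longrightarrow> class_order (OK p) P \<le> d"
proof -
  define Q where "Q = (\<lambda>t. 0 < t \<and> is_principal (OK p) (ideal_pow (OK p) P t))"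
  have co: "class_order (OK p) P = (LEAST t. Q t)" by (simp add: class_order_def Q_def)
  have Q: "Q t \<longleftrightarrow> 0 < t \<and> odd_rep p t" for t
    using P_pow_principal_of_odd_rep odd_rep_of_P_pow_principal by (auto simp: Q_def)
  show le: "class_order (OK p) P \<le> d" if "odd_rep p d" "0 < d" for d
    unfolding co by (rule Least_le) (use that Q in blast)
  obtain d where "Q d" using ex_odd_rep[OF p_mod_8] Q by blast
  then have t: "Q (class_order (OK p) P)" unfolding co by (rule LeastI)
  show "odd (class_order (OK p) P)"
  proof
    assume "even (class_order (OK p) P)"
    then obtain s where s: "class_order (OK p) P = 2 * s" by blast
    then have "odd_rep p s" using odd_rep_halve[OF prime_p p_odd] t Q by metis
    moreover have "0 < s" using t s Q by (metis mult_0_right gr0I less_irrefl)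
    ultimately show False using le[of s] s by simp
  qed
qed

end

end

section \<open>Cyclotomic integers of prime power level\<close>

text \<open>\<open>X\<close> is an eigenvalue of an integer matrix, hence a root of its monic
  characteristic polynomial.\<close>

lemma algebraic_int_of_integral_action:
  fixes X :: complex and v :: "nat \<Rightarrow> complex" and a :: "nat \<Rightarrow> nat \<Rightarrow> int"
  assumes "\<And>i. i < n \<Longrightarrow> X * v i = (\<Sum>j<n. of_int (a i j) * v j)" and "k < n" "v k \<noteq> 0"
  shows "algebraic_int X"
proof -
  define A where "A = mat n n (\<lambda>(i, j). a i j)"
  define B where "B = map_mat (of_int :: int \<Rightarrow> complex) A"
  have A: "A \<in> carrier_mat n n" by (simp add: A_def)
  have B: "B \<in> carrier_mat n n" by (simp add: B_def A_def)
  define u where "u = vec n v"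
  have "eigenvector B u X"
    unfolding eigenvector_def
  proof (intro conjI)
    show "u \<in> carrier_vec (dim_row B)" using B by (simp add: u_def)
    have "vec_index u k \<noteq> vec_index (0\<^sub>v n) k" using assms by (simp add: u_def)
    then show "u \<noteq> 0\<^sub>v (dim_row B)" using B by auto
    show "B *\<^sub>v u = X \<cdot>\<^sub>v u"
      by (rule eq_vecI) (auto simp: B_def A_def u_def scalar_prod_def assms(1) lessThan_atLeast0)
  qed
  then have "poly (char_poly B) X = 0"
    using eigenvalue_root_char_poly[OF B] by (auto simp: eigenvalue_def)
  moreover have "char_poly B = map_poly of_int (char_poly A)"
    unfolding B_def by (rule of_int_hom.char_poly_hom[OF A])
  moreover have "lead_coeff (char_poly A) = 1" using degree_monic_char_poly[OF A] by simp
  ultimately show ?thesis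
    by (auto simp: algebraic_int_altdef_ipoly)
qed

lemma rational_multiple_algebraic_int:
  fixes X :: complex
  assumes "algebraic_int X" "of_int m * X = of_int k" "m \<noteq> 0"
  shows "X \<in> \<int>" "m dvd k"
proof -
  have "X = of_int k / of_int m" using assms by (simp add: field_simps)
  then have "X \<in> \<rat>" by simp
  then show "X \<in> \<int>" using assms(1) rational_algebraic_int_is_int by blast
  then obtain i where "X = of_int i" by (auto elim: Ints_cases)
  then have "of_int (m * i) = (of_int k :: complex)" using assms by simp
  then have "m * i = k" by (simp only: of_int_eq_iff)
  then show "m dvd k" by auto
qed

text \<open>Ring elements are represented by integer polynomials, so that a Galois automorphism
  becomes a change of the evaluation point.\<close>

definition ev :: "complex \<Rightarrow> int poly \<Rightarrow> complex" where
  "ev x f = poly (of_int_poly f) x"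

lemma ev_add: "ev x (f + g) = ev x f + ev x g"
  and ev_mult: "ev x (f * g) = ev x f * ev x g"
  and ev_diff: "ev x (f - g) = ev x f - ev x g"
  and ev_0: "ev x 0 = 0"
  and ev_1: "ev x 1 = 1"
  and ev_pCons: "ev x (pCons a f) = of_int a + x * ev x f"
  by (simp_all add: ev_def of_int_poly_hom.hom_mult of_int_poly_hom.hom_add of_int_poly_hom.hom_minus of_int_hom.map_poly_pCons_hom)

lemma ev_power: "ev x (f ^ n) = ev x f ^ n"
  by (induction n) (simp_all add: ev_mult ev_1)

lemma ev_pcompose: "ev x (f \<circ>\<^sub>p g) = ev (ev x g) f"
  by (induction f) (simp_all add: pcompose_pCons ev_add ev_mult ev_pCons ev_0)

lemma ev_sum: "ev x (\<Sum>i\<in>A. f i) = (\<Sum>i\<in>A. ev x (f i))"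
  by (induction A rule: infinite_finite_induct) (simp_all add: ev_add ev_0)

lemma ev_altdef: "ev x f = (\<Sum>i\<le>degree f. of_int (poly.coeff f i) * x ^ i)"
  by (simp add: ev_def poly_altdef)

lemma ev_X: "ev x [:0, 1:] = x"
  by (simp add: ev_pCons ev_0)

lemma cnj_ev: "cnj (ev x f) = ev (cnj x) f"
  by (induction f) (simp_all add: ev_pCons ev_0)

lemma zeta_power_eq_1_iff: "0 < n \<Longrightarrow> zeta n ^ i = 1 \<longleftrightarrow> n dvd i"
proof -
  assume "0 < n"
  have "zeta n ^ i = exp (2 * complex_of_real pi * \<i> * complex_of_nat i / complex_of_nat n)"
    by (simp add: zeta_def exp_of_nat_mult[symmetric] algebra_simps)
  then show ?thesis using complex_root_unity_eq_1[of n i] \<open>0 < n\<close> by simp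
qed

lemma power_eq_power_iff_root_unity:
  fixes y :: complex
  assumes "0 < n" "\<And>i. y ^ i = 1 \<longleftrightarrow> n dvd i"
  shows "y ^ i = y ^ j \<longleftrightarrow> i mod n = j mod n"
proof (induction i j rule: linorder_wlog)
  case (le i j)
  have "y ^ n = 1" using assms by simp
  then have "y \<noteq> 0" using assms(1) by (metis zero_power zero_neq_one)
  then have "y ^ i = y ^ j \<longleftrightarrow> y ^ (j - i) = 1" using le by (metis le_add_diff_inverse mult.right_neutral mult_cancel_left power_add power_not_zero)
  also have "\<dots> \<longleftrightarrow> n dvd j - i" by (rule assms(2))
  also have "\<dots> \<longleftrightarrow> i mod n = j mod n" using le by (metis mod_eq_dvd_iff_nat)
  finally show ?case .
qed auto

lemma sum_powers_root_unity:
  fixes y :: complex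
  assumes "y ^ n = 1"
  shows "(\<Sum>k<n. y ^ k) = (if y = 1 then of_nat n else 0)"
  using assms power_diff_1_eq[of y n] by auto

lemma prod_linear_roots_unity:
  fixes y :: complex
  assumes "0 < n" "\<And>i. y ^ i = 1 \<longleftrightarrow> n dvd i"
  shows "(\<Prod>k<n. [:- (y ^ k), 1:]) = [:0, 1:] ^ n - 1"
proof (rule poly_eqI_degree_lead_coeff[where n = n and A = "(\<lambda>k. y ^ k) ` {..<n}"])
  have inj: "inj_on (\<lambda>k. y ^ k) {..<n}"
    using power_eq_power_iff_root_unity[OF assms] by (auto simp: inj_on_def)
  have d: "degree (\<Prod>k<n. [:- (y ^ k), 1:]) = n" by (subst degree_prod_eq_sum_degree) auto
  have "lead_coeff (\<Prod>k<n. [:- (y ^ k), 1:]) = 1" by (simp add: lead_coeff_prod)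
  moreover have "poly.coeff ([:0, 1:] ^ n - 1 :: complex poly) n = 1"
    using assms(1) by (simp add: coeff_linear_power)
  ultimately show "poly.coeff (\<Prod>k<n. [:- (y ^ k), 1:]) n = poly.coeff ([:0, 1:] ^ n - 1) n"
    using d by simp
  show "n \<le> card ((\<lambda>k. y ^ k) ` {..<n})" using card_image[OF inj] by simp
  show "degree (\<Prod>k<n. [:- (y ^ k), 1:]) \<le> n" using d by simp
  show "degree ([:0, 1:] ^ n - 1 :: complex poly) \<le> n"
    by (rule degree_diff_le) (auto simp: degree_power_eq)
  fix x assume "x \<in> (\<lambda>k. y ^ k) ` {..<n}"
  then obtain k where k: "k < n" "x = y ^ k" by auto
  have "x ^ n = 1" using assms(2)[of "k * n"] by (simp add: k power_mult)
  moreover have "poly (\<Prod>k<n. [:- (y ^ k), 1:]) x = 0" using k by (auto simp: poly_prod)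
  ultimately show "poly (\<Prod>k<n. [:- (y ^ k), 1:]) x = poly ([:0, 1:] ^ n - 1) x" by simp
qed

locale prime_power_cyclotomic =
  fixes p e :: nat
  assumes prime_p: "prime p" and e_pos: "0 < e"
begin

definition N :: nat where "N = p ^ e"
definition m :: nat where "m = p ^ (e - 1)"
definition z :: complex where "z = zeta N"
definition R :: "complex set" where "R = range (ev z)"

lemma p_gt_1: "1 < p" using prime_p prime_gt_1_nat by blast
lemma N_pos: "0 < N" using p_gt_1 by (simp add: N_def)
lemma m_pos: "0 < m" using p_gt_1 by (simp add: m_def)
lemma N_eq: "N = p * m" using e_pos unfolding N_def m_def by (metis power_eq_if not_gr_zero)
lemma N_gt_1: "1 < N" unfolding N_def using p_gt_1 e_pos by (rule one_less_power)

lemma coprime_N_iff: "coprime k N \<longleftrightarrow> \<not> p dvd k"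
  unfolding N_def using e_pos prime_p
  by (metis coprime_commute coprime_power_left_iff not_gr_zero prime_imp_coprime_nat coprime_absorb_left not_prime_unit)

lemma z_power_eq_1_iff: "z ^ i = 1 \<longleftrightarrow> N dvd i"
  unfolding z_def using N_pos by (rule zeta_power_eq_1_iff)

lemma z_power_N: "z ^ N = 1" by (simp add: z_power_eq_1_iff)

lemma z_nonzero: "z \<noteq> 0" by (simp add: z_def zeta_def)

lemma z_power_eq_iff: "z ^ i = z ^ j \<longleftrightarrow> i mod N = j mod N"
  by (rule power_eq_power_iff_root_unity[OF N_pos z_power_eq_1_iff])

lemma z_mult_cnj: "z * cnj z = 1"
  by (simp add: z_def zeta_def exp_cnj exp_add[symmetric])

lemma cnj_z: "cnj z = z ^ (N - 1)"
proof -
  have "z * z ^ (N - 1) = z * cnj z" using z_power_N N_pos z_mult_cnj by (metis power_eq_if less_numeral_extra(3))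
  then show ?thesis using z_nonzero by simp
qed

lemma R_I: "ev z f \<in> R" by (simp add: R_def)

lemma R_E: assumes "X \<in> R" obtains f where "X = ev z f"
  using assms by (auto simp: R_def)

lemma R_of_int: "of_int a \<in> R"
  using R_I[of "[:a:]"] by (simp add: ev_pCons ev_0)

lemma R_0: "0 \<in> R" and R_1: "1 \<in> R" and R_numeral: "numeral k \<in> R" and R_of_nat: "of_nat n \<in> R"
  using R_of_int[of 0] R_of_int[of 1] R_of_int[of "numeral k"] R_of_int[of "int n"] by simp_all

lemma R_z: "z \<in> R" using R_I[of "[:0, 1:]"] by (simp add: ev_X)

lemma R_add: "x \<in> R \<Longrightarrow> y \<in> R \<Longrightarrow> x + y \<in> R"
  by (elim R_E) (metis ev_add R_I)
lemma R_mult: "x \<in> R \<Longrightarrow> y \<in> R \<Longrightarrow> x * y \<in> R"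
  by (elim R_E) (metis ev_mult R_I)
lemma R_diff: "x \<in> R \<Longrightarrow> y \<in> R \<Longrightarrow> x - y \<in> R"
  by (elim R_E) (metis ev_diff R_I)
lemma R_uminus: "x \<in> R \<Longrightarrow> - x \<in> R"
  using R_diff[OF R_0] by simp
lemma R_power: "x \<in> R \<Longrightarrow> x ^ n \<in> R"
  by (induction n) (auto intro: R_1 R_mult)
lemma R_sum: "(\<And>i. i \<in> A \<Longrightarrow> f i \<in> R) \<Longrightarrow> (\<Sum>i\<in>A. f i) \<in> R"
  by (induction A rule: infinite_finite_induct) (auto intro: R_0 R_add)
lemma R_prod: "(\<And>i. i \<in> A \<Longrightarrow> f i \<in> R) \<Longrightarrow> (\<Prod>i\<in>A. f i) \<in> R"
  by (induction A rule: infinite_finite_induct) (auto intro: R_1 R_mult)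
lemma R_ev: "x \<in> R \<Longrightarrow> ev x f \<in> R"
  by (induction f) (auto simp: ev_pCons ev_0 intro: R_0 R_add R_mult R_of_int)
lemma R_cnj: "x \<in> R \<Longrightarrow> cnj x \<in> R"
  by (elim R_E) (auto simp: cnj_ev cnj_z intro!: R_ev R_power R_z)

lemmas R_closed = R_of_int R_0 R_1 R_numeral R_of_nat R_z R_add R_mult R_diff R_uminus R_power R_sum R_prod R_cnj

text \<open>These \<open>N\<close> powers span \<open>R\<close> without being independent; spanning
  is enough for the matrix argument behind integrality.\<close>

lemma R_coordinates:
  assumes "X \<in> R"
  shows "\<exists>a::nat \<Rightarrow> int. X = (\<Sum>j<N. of_int (a j) * z ^ j)"
proof -
  define H where "H = {X. \<exists>a::nat \<Rightarrow> int. X = (\<Sum>j<N. of_int (a j) * z ^ j)}"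
  have 1: "of_int c * z ^ k \<in> H" for c k
  proof -
    have "of_int c * z ^ k = of_int c * z ^ (k mod N)" by (subst z_power_eq_iff[THEN iffD2, of k "k mod N"]) auto
    also have "\<dots> = (\<Sum>j<N. of_int (if j = k mod N then c else 0) * z ^ j)"
      using N_pos by (simp add: if_distrib[of of_int] if_distrib[of "\<lambda>x. x * _"] cong: if_cong)
    finally show ?thesis unfolding H_def by (intro CollectI exI[of _ "\<lambda>j. if j = k mod N then c else 0"])
  qed
  have 2: "X + Y \<in> H" if XY: "X \<in> H" "Y \<in> H" for X Y
  proof -
    obtain a b :: "nat \<Rightarrow> int" where "X = (\<Sum>j<N. of_int (a j) * z ^ j)" "Y = (\<Sum>j<N. of_int (b j) * z ^ j)"
      using XY by (auto simp: H_def)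
    then have "X + Y = (\<Sum>j<N. of_int (a j + b j) * z ^ j)" by (simp add: sum.distrib algebra_simps)
    then show ?thesis unfolding H_def by (intro CollectI exI[of _ "\<lambda>j. a j + b j"])
  qed
  have 3: "sum f A \<in> H" if "\<And>i. i \<in> A \<Longrightarrow> f i \<in> H" for f and A :: "nat set"
    using that by (induction A rule: infinite_finite_induct) (use 1[of 0 0] 2 in auto)
  obtain f where "X = ev z f" using assms by (rule R_E)
  then have "X \<in> H" by (auto simp: ev_altdef intro: 3 1)
  then show ?thesis by (simp add: H_def)
qed

lemma algebraic_int_R:
  assumes "X \<in> R" shows "algebraic_int X"
proof -
  have "\<forall>i. \<exists>a::nat \<Rightarrow> int. X * z ^ i = (\<Sum>j<N. of_int (a j) * z ^ j)"
    using assms by (auto intro!: R_coordinates R_closed)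
  then obtain a :: "nat \<Rightarrow> nat \<Rightarrow> int" where "\<And>i. X * z ^ i = (\<Sum>j<N. of_int (a i j) * z ^ j)" by metis
  then show ?thesis
    using algebraic_int_of_integral_action[of N X "\<lambda>i. z ^ i" a 0] N_pos by simp
qed

lemma int_dvd_of_R_dvd:
  assumes "X \<in> R" "of_int k * X = of_int l" "k \<noteq> 0"
  shows "k dvd l"
  using rational_multiple_algebraic_int(2)[OF algebraic_int_R] assms by blast

end

section \<open>The cyclotomic polynomial and the prime above p\<close>

context prime_power_cyclotomic
begin

definition U :: "nat set" where "U = {k. k < N \<and> coprime k N}"

lemma finite_U: "finite U" by (simp add: U_def)

lemma lessThan_N_decomp: "{..<N} = U \<union> (\<lambda>k. p * k) ` {..<m}" "U \<inter> (\<lambda>k. p * k) ` {..<m} = {}"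
proof -
  have U: "U = {k. k < N \<and> \<not> p dvd k}" by (simp add: U_def coprime_N_iff)
  show "{..<N} = U \<union> (\<lambda>k. p * k) ` {..<m}" "U \<inter> (\<lambda>k. p * k) ` {..<m} = {}"
    using p_gt_1 unfolding U N_eq by (auto elim!: dvdE)
qed

lemma inj_on_mult_p: "inj_on (\<lambda>k. p * k) A"
  using p_gt_1 by (auto simp: inj_on_def)

lemma sum_lessThan_N: "(\<Sum>k<N. f k) = (\<Sum>k\<in>U. f k) + (\<Sum>k<m. f (p * k) :: 'b::comm_monoid_add)"
  unfolding lessThan_N_decomp(1)
  by (subst sum.union_disjoint) (simp_all add: finite_U lessThan_N_decomp(2) sum.reindex[OF inj_on_mult_p])

lemma prod_lessThan_N: "(\<Prod>k<N. f k) = (\<Prod>k\<in>U. f k) * (\<Prod>k<m. f (p * k) :: 'b::comm_monoid_mult)"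
  unfolding lessThan_N_decomp(1)
  by (subst prod.union_disjoint) (simp_all add: finite_U lessThan_N_decomp(2) prod.reindex[OF inj_on_mult_p])

text \<open>The \<open>N\<close>-th cyclotomic polynomial, as the quotient of
  \<open>X ^ N - 1\<close> by \<open>X ^ m - 1\<close>.\<close>

definition Phi :: "int poly" where "Phi = (\<Sum>j<p. ([:0, 1:] ^ m) ^ j)"

lemma Phi_factorization: "of_int_poly Phi = (\<Prod>k\<in>U. [:- (z ^ k), 1:])"
proof -
  have zp: "(z ^ p) ^ i = 1 \<longleftrightarrow> m dvd i" for i
    using z_power_eq_1_iff[of "p * i"] p_gt_1 by (simp add: N_eq power_mult)
  define X where "X = ([:0, 1:] :: complex poly) ^ m"
  have "poly.coeff (X - 1) m = 1" using m_pos by (simp add: X_def coeff_linear_power)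
  then have X1: "X - 1 \<noteq> 0" by auto
  have "of_int_poly [:0, 1:] = ([:0, 1:] :: complex poly)" by (simp add: of_int_hom.map_poly_pCons_hom)
  then have Phi: "of_int_poly Phi = (\<Sum>j<p. X ^ j)"
    unfolding Phi_def X_def by (simp only: of_int_poly_hom.hom_sum of_int_poly_hom.hom_power)
  have "(X - 1) * (\<Prod>k\<in>U. [:- (z ^ k), 1:]) = (\<Prod>k\<in>U. [:- (z ^ k), 1:]) * (\<Prod>k<m. [:- ((z ^ p) ^ k), 1:])"
    unfolding prod_linear_roots_unity[OF m_pos zp] X_def by (rule mult.commute)
  also have "\<dots> = (\<Prod>k<N. [:- (z ^ k), 1:])" unfolding prod_lessThan_N by (simp add: power_mult)
  also have "\<dots> = [:0, 1:] ^ N - 1" by (rule prod_linear_roots_unity[OF N_pos z_power_eq_1_iff])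
  also have "\<dots> = X ^ p - 1" by (simp add: X_def N_eq power_mult[symmetric] mult.commute)
  also have "\<dots> = (X - 1) * (\<Sum>j<p. X ^ j)" by (rule power_diff_1_eq)
  finally show ?thesis unfolding Phi using X1 by (simp only: mult_cancel_left) simp
qed

lemma ev_Phi: "ev x Phi = (\<Prod>k\<in>U. x - z ^ k)"
  unfolding ev_def Phi_factorization by (simp add: poly_prod)

lemma degree_Phi: "degree Phi = card U"
proof -
  have "degree Phi = degree (\<Prod>k\<in>U. [:- (z ^ k), 1:])" unfolding Phi_factorization[symmetric] by simp
  also have "\<dots> = card U" by (subst degree_prod_eq_sum_degree) (auto simp: finite_U)
  finally show ?thesis .
qed

lemma monic_Phi: "lead_coeff Phi = 1"
proof -
  have "of_int (lead_coeff Phi) = lead_coeff (\<Prod>k\<in>U. [:- (z ^ k), 1:])"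
    unfolding Phi_factorization[symmetric] by simp
  also have "\<dots> = 1" by (simp add: lead_coeff_prod)
  finally show ?thesis by simp
qed

lemma prod_one_minus_z_power: "(\<Prod>k\<in>U. 1 - z ^ k) = of_nat p"
  unfolding ev_Phi[symmetric] Phi_def by (simp add: ev_sum ev_power ev_X)

lemma U_inverse:
  assumes "coprime k N"
  obtains l where "l \<in> U" "[k * l = 1] (mod N)"
proof -
  obtain l where l: "[k * l = 1] (mod N)" using cong_solve_coprime_nat[OF assms] by auto
  then have "[k * (l mod N) = 1] (mod N)" by (simp add: cong_def mod_mult_right_eq)
  moreover from this have "coprime (l mod N) N" by (metis cong_imp_coprime cong_sym coprime_1_left coprime_mult_left_iff)
  ultimately show ?thesis using that[of "l mod N"] N_pos by (simp add: U_def)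
qed

definition lam :: complex where "lam = 1 - z"

lemma R_lam: "lam \<in> R" by (simp add: lam_def R_closed)

lemma lam_nonzero: "lam \<noteq> 0"
  using z_power_eq_1_iff[of 1] N_gt_1 by (auto simp: lam_def)

text \<open>Both quotients are geometric sums: \<open>1 - z ^ k\<close> by \<open>1 - z\<close>, and
  \<open>1 - (z ^ k) ^ l = 1 - z\<close> by \<open>1 - z ^ k\<close>, where \<open>l\<close> inverts
  \<open>k\<close> modulo \<open>N\<close>.\<close>

lemma one_minus_z_power_associated:
  assumes "coprime k N"
  obtains u v where "u \<in> R" "v \<in> R" "u * v = 1" "1 - z ^ k = lam * u"
proof -
  obtain l where l: "l \<in> U" "[k * l = 1] (mod N)" by (rule U_inverse[OF assms])
  define u where "u = (\<Sum>i<k. z ^ i)"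
  define v where "v = (\<Sum>i<l. (z ^ k) ^ i)"
  have u: "1 - z ^ k = lam * u" by (simp add: u_def lam_def one_diff_power_eq)
  have "(z ^ k) ^ l = z ^ 1" unfolding power_mult[symmetric] z_power_eq_iff using l(2) by (simp add: cong_def)
  then have "lam = lam * u * v" using one_diff_power_eq[of "z ^ k" l] u by (simp add: v_def lam_def)
  then have "u * v = 1" using lam_nonzero by simp
  then show ?thesis using that[of u v] u by (auto simp: u_def v_def intro!: R_sum R_power R_z)
qed

text \<open>Total ramification: the value of \<open>Phi\<close> at 1 writes \<open>p\<close> as the
  product of the conjugates of \<open>lam\<close>, each associated to \<open>lam\<close>.\<close>

lemma p_associated_lam_power:
  obtains u v where "u \<in> R" "v \<in> R" "u * v = 1" "of_nat p = lam ^ card U * u"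
proof -
  have "\<forall>k\<in>U. \<exists>u v. u \<in> R \<and> v \<in> R \<and> u * v = 1 \<and> 1 - z ^ k = lam * u"
    using one_minus_z_power_associated unfolding U_def by (metis (mono_tags, lifting) mem_Collect_eq)
  then obtain u v where uv: "\<And>k. k \<in> U \<Longrightarrow> u k \<in> R \<and> v k \<in> R \<and> u k * v k = 1 \<and> 1 - z ^ k = lam * u k"
    by metis
  have "(of_nat p :: complex) = (\<Prod>k\<in>U. lam * u k)"
    unfolding prod_one_minus_z_power[symmetric] using uv by (intro prod.cong) auto
  also have "\<dots> = lam ^ card U * (\<Prod>k\<in>U. u k)" by (simp add: prod.distrib)
  finally have "of_nat p = lam ^ card U * (\<Prod>k\<in>U. u k)" .
  moreover have "(\<Prod>k\<in>U. u k) * (\<Prod>k\<in>U. v k) = 1"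
    unfolding prod.distrib[symmetric] using uv by simp
  ultimately show ?thesis using that uv by (auto intro!: R_prod)
qed

lemma card_U_pos: "0 < card U"
proof -
  have "1 \<in> U" using N_gt_1 by (simp add: U_def)
  then show ?thesis using finite_U by (auto simp: card_gt_0_iff)
qed

lemma int_multiple_of_lam:
  assumes "of_int k = lam * X" "X \<in> R"
  shows "int p dvd k"
proof -
  obtain u v where uv: "u \<in> R" "v \<in> R" "u * v = 1" "of_nat p = lam ^ card U * u"
    by (rule p_associated_lam_power)
  have "of_int (k ^ card U) = lam ^ card U * X ^ card U" by (simp add: assms power_mult_distrib)
  also have "\<dots> = lam ^ card U * (u * v) * X ^ card U" by (simp add: uv)
  also have "\<dots> = of_int (int p) * (v * X ^ card U)" using uv(4) by simp
  finally have "of_int (int p) * (v * X ^ card U) = of_int (k ^ card U)" by simp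
  moreover have "v * X ^ card U \<in> R" using uv assms by (simp add: R_closed)
  ultimately have "int p dvd k ^ card U" using int_dvd_of_R_dvd p_gt_1 by (metis not_one_less_zero of_nat_0_eq_iff)
  then show ?thesis using prime_p by (metis prime_dvd_power prime_nat_int_transfer)
qed

text \<open>Eisenstein's argument in \<open>lam\<close>-adic form: lower coefficients are divisible
  by \<open>p\<close>, hence by \<open>lam ^ card U\<close>, and higher terms carry
  \<open>lam ^ Suc i\<close>; so \<open>lam\<close> divides the \<open>i\<close>-th coefficient, and
  then so does \<open>p\<close>.\<close>

lemma p_dvd_coeff_of_root_lam:
  assumes "ev lam g = 0" "degree g < card U"
  shows "int p dvd poly.coeff g i"
proof (induction i rule: less_induct)
  case (less i)
  show ?case
  proof (cases "i \<le> degree g")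
    case False
    then show ?thesis by (simp add: coeff_eq_0)
  next
    case True
    obtain u v where uv: "u \<in> R" "v \<in> R" "u * v = 1" "of_nat p = lam ^ card U * u"
      by (rule p_associated_lam_power)
    have ex: "\<exists>r\<in>R. of_int (poly.coeff g j) * lam ^ j = lam ^ Suc i * r" if "j \<noteq> i" for j
    proof (cases "j < i")
      case True
      then obtain k where k: "poly.coeff g j = int p * k" using less by blast
      have "card U = Suc i + (card U - Suc i)" using assms(2) \<open>i \<le> degree g\<close> by simp
      then have "lam ^ card U = lam ^ Suc i * lam ^ (card U - Suc i)" by (metis power_add)
      then have "of_int (poly.coeff g j) * lam ^ j = lam ^ Suc i * (lam ^ (card U - Suc i) * u * of_int k * lam ^ j)"
        using uv(4) by (simp add: k)
      moreover have "lam ^ (card U - Suc i) * u * of_int k * lam ^ j \<in> R" using uv(1) by (intro R_closed R_lam)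
      ultimately show ?thesis by blast
    next
      case False
      then have "j = Suc i + (j - Suc i)" using that by simp
      then have "lam ^ j = lam ^ Suc i * lam ^ (j - Suc i)" by (metis power_add)
      then have "of_int (poly.coeff g j) * lam ^ j = lam ^ Suc i * (of_int (poly.coeff g j) * lam ^ (j - Suc i))" by simp
      moreover have "of_int (poly.coeff g j) * lam ^ (j - Suc i) \<in> R" by (intro R_closed R_lam)
      ultimately show ?thesis by blast
    qed
    then obtain r where r: "\<And>j. j \<noteq> i \<Longrightarrow> r j \<in> R \<and> of_int (poly.coeff g j) * lam ^ j = lam ^ Suc i * r j" by metis
    have "0 = of_int (poly.coeff g i) * lam ^ i + (\<Sum>j\<in>{..degree g} - {i}. of_int (poly.coeff g j) * lam ^ j)"
      using assms(1) True unfolding ev_altdef by (subst (asm) sum.remove[of _ i]) auto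
    also have "(\<Sum>j\<in>{..degree g} - {i}. of_int (poly.coeff g j) * lam ^ j) = (\<Sum>j\<in>{..degree g} - {i}. lam ^ Suc i * r j)"
      using r by (intro sum.cong) auto
    also have "\<dots> = lam ^ i * (lam * (\<Sum>j\<in>{..degree g} - {i}. r j))" by (simp add: sum_distrib_left algebra_simps)
    finally have "lam ^ i * of_int (poly.coeff g i) = lam ^ i * (lam * - (\<Sum>j\<in>{..degree g} - {i}. r j))"
      by (simp add: algebra_simps eq_neg_iff_add_eq_0)
    then have "of_int (poly.coeff g i) = lam * - (\<Sum>j\<in>{..degree g} - {i}. r j)"
      using lam_nonzero by (simp only: mult_cancel_left power_eq_0_iff) simp
    then show ?thesis by (rule int_multiple_of_lam) (use r in \<open>auto intro!: R_uminus R_sum\<close>)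
  qed
qed

text \<open>A relation could be divided by \<open>p\<close> without end, but
  \<open>p ^ nat \<bar>a\<bar>\<close> is too large to divide a nonzero coefficient
  \<open>a\<close>.\<close>

lemma eq_0_of_root_lam:
  assumes "ev lam g = 0" "degree g < card U"
  shows "g = 0"
proof (rule ccontr)
  assume "g \<noteq> 0"
  have *: "\<exists>h. g = Polynomial.smult (int p ^ k) h \<and> ev lam h = 0" for k
  proof (induction k)
    case 0
    then show ?case using assms by (intro exI[of _ g]) simp
  next
    case (Suc k)
    then obtain h where h: "g = Polynomial.smult (int p ^ k) h" "ev lam h = 0" by blast
    have "degree h < card U" using h(1) assms(2) p_gt_1 by simp
    then have "[:int p:] dvd h" using p_dvd_coeff_of_root_lam[OF h(2)] by (simp add: const_poly_dvd_iff)
    then obtain h' where h': "h = [:int p:] * h'" by blast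
    have "of_int (int p) * ev lam h' = 0" using h(2) unfolding h' ev_mult by (simp add: ev_pCons ev_0)
    then have "ev lam h' = 0" using p_gt_1 by simp
    then show ?case using h(1) h' by (intro exI[of _ h']) (simp add: mult.commute)
  qed
  obtain i where i: "poly.coeff g i \<noteq> 0" using \<open>g \<noteq> 0\<close> by (metis leading_coeff_0_iff)
  define a where "a = poly.coeff g i"
  obtain h where "g = Polynomial.smult (int p ^ nat \<bar>a\<bar>) h" using * by blast
  then have "a = int p ^ nat \<bar>a\<bar> * poly.coeff h i" unfolding a_def by (metis coeff_smult)
  then have "int p ^ nat \<bar>a\<bar> dvd a" by (metis dvd_triv_left)
  then have "int p ^ nat \<bar>a\<bar> \<le> \<bar>a\<bar>" using i dvd_imp_le_int[of a "int p ^ nat \<bar>a\<bar>"] by (simp add: a_def)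
  moreover have "nat \<bar>a\<bar> < p ^ nat \<bar>a\<bar>" using p_gt_1 by (simp add: power_gt_expt)
  ultimately show False by (metis int_nat_eq abs_ge_zero linorder_not_less of_nat_less_iff of_nat_power)
qed

lemma eq_0_of_root_z:
  assumes "ev z f = 0" "degree f < card U"
  shows "f = 0"
proof -
  have "ev lam [:1, -1:] = z" by (simp add: ev_pCons ev_0 lam_def)
  then have "ev lam (f \<circ>\<^sub>p [:1, -1:]) = 0" using assms by (simp add: ev_pcompose)
  moreover have "degree (f \<circ>\<^sub>p [:1, -1:]) < card U" using assms by simp
  ultimately have "f \<circ>\<^sub>p [:1, -1:] = 0" by (rule eq_0_of_root_lam)
  then show ?thesis using pcompose_eq_0[of f "[:1, -1:]"] by simp
qed

lemma Phi_dvd_of_root: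
  assumes "ev z f = 0" shows "Phi dvd f"
proof -
  have nz: "Phi \<noteq> 0" using monic_Phi by auto
  \<comment> \<open>\<open>Phi\<close> is monic, so pseudo-division is division with remainder over
    the integers.\<close>
  obtain q r where qr: "pseudo_divmod f Phi = (q, r)" by fastforce
  have f: "f = Phi * q + r" and r: "r = 0 \<or> degree r < degree Phi"
    using pseudo_divmod[OF nz qr] monic_Phi by auto
  have "1 \<in> U" using N_gt_1 by (simp add: U_def)
  then have "ev z Phi = 0" unfolding ev_Phi using finite_U by (auto intro!: prod_zero bexI[of _ 1])
  then have "ev z r = 0" using assms unfolding f by (simp add: ev_add ev_mult)
  then have "r = 0" using eq_0_of_root_z r degree_Phi card_U_pos by fastforce
  then show ?thesis using f by simp
qed

text \<open>This makes the Galois action independent of the representing polynomial.\<close>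

lemma conjugate_root:
  assumes "ev z f = ev z g" "coprime k N"
  shows "ev (z ^ k) f = ev (z ^ k) g"
proof -
  have "ev z (f - g) = 0" using assms by (simp add: ev_diff)
  then obtain h where h: "f - g = Phi * h" using Phi_dvd_of_root by blast
  have "k mod N \<in> U" using assms(2) N_pos by (simp add: U_def)
  moreover have "z ^ k = z ^ (k mod N)" by (simp add: z_power_eq_iff)
  ultimately have "ev (z ^ k) Phi = 0" unfolding ev_Phi using finite_U by (auto intro!: prod_zero bexI[of _ "k mod N"])
  then have "ev (z ^ k) (f - g) = 0" unfolding h by (simp add: ev_mult)
  then show ?thesis by (simp add: ev_diff)
qed

end

section \<open>Galois automorphisms, traces and norms\<close>

context prime_power_cyclotomic
begin

text \<open>The Galois automorphism with \<open>z \<mapsto> z ^ k\<close>; it is only meaningful on \<open>R\<close> and for \<open>k\<close> coprime to \<open>N\<close>.\<close>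

definition sg :: "nat \<Rightarrow> complex \<Rightarrow> complex" where
  "sg k X = ev (z ^ k) (SOME f. X = ev z f)"

lemma sg_ev: "coprime k N \<Longrightarrow> sg k (ev z f) = ev (z ^ k) f"
  unfolding sg_def by (rule conjugate_root, rule someI2[of _ f]) auto

lemma R_sg: "X \<in> R \<Longrightarrow> sg k X \<in> R"
  unfolding sg_def by (intro R_ev R_closed)

lemma sg_cong: "[k = l] (mod N) \<Longrightarrow> sg k X = sg l X"
  unfolding sg_def cong_def by (metis z_power_eq_iff)

context
  fixes k assumes k: "coprime k N"
begin

lemma sg_add: "X \<in> R \<Longrightarrow> Y \<in> R \<Longrightarrow> sg k (X + Y) = sg k X + sg k Y"
  by (elim R_E) (simp add: sg_ev[OF k] ev_add flip: ev_add)

lemma sg_mult: "X \<in> R \<Longrightarrow> Y \<in> R \<Longrightarrow> sg k (X * Y) = sg k X * sg k Y"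
  by (elim R_E) (simp add: sg_ev[OF k] ev_mult flip: ev_mult)

lemma sg_diff: "X \<in> R \<Longrightarrow> Y \<in> R \<Longrightarrow> sg k (X - Y) = sg k X - sg k Y"
  by (elim R_E) (simp add: sg_ev[OF k] ev_diff flip: ev_diff)

lemma sg_of_int: "sg k (of_int a) = of_int a"
  using sg_ev[OF k, of "[:a:]"] by (simp add: ev_pCons ev_0)

lemma sg_0: "sg k 0 = 0" and sg_1: "sg k 1 = 1"
  using sg_of_int[of 0] sg_of_int[of 1] by simp_all

lemma sg_power: "X \<in> R \<Longrightarrow> sg k (X ^ n) = sg k X ^ n"
  by (induction n) (simp_all add: sg_1 sg_mult R_closed)

lemma sg_sum: "(\<And>i. i \<in> A \<Longrightarrow> f i \<in> R) \<Longrightarrow> sg k (\<Sum>i\<in>A. f i) = (\<Sum>i\<in>A. sg k (f i))"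
  by (induction A rule: infinite_finite_induct) (simp_all add: sg_0 sg_add R_closed)

lemma sg_prod: "(\<And>i. i \<in> A \<Longrightarrow> f i \<in> R) \<Longrightarrow> sg k (\<Prod>i\<in>A. f i) = (\<Prod>i\<in>A. sg k (f i))"
  by (induction A rule: infinite_finite_induct) (simp_all add: sg_1 sg_mult R_closed)

lemma sg_z: "sg k z = z ^ k"
  using sg_ev[OF k, of "[:0, 1:]"] by (simp add: ev_X)

lemma sg_sg: "coprime l N \<Longrightarrow> X \<in> R \<Longrightarrow> sg k (sg l X) = sg (l * k) X"
proof (elim R_E)
  fix f assume l: "coprime l N" and X: "X = ev z f"
  have "sg l X = ev (z ^ l) f" using sg_ev[OF l] X by simp
  also have "\<dots> = ev z (f \<circ>\<^sub>p [:0, 1:] ^ l)" by (simp add: ev_pcompose ev_power ev_X)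
  finally have s: "sg l X = ev z (f \<circ>\<^sub>p [:0, 1:] ^ l)" .
  have "sg k (sg l X) = ev ((z ^ k) ^ l) f" unfolding s sg_ev[OF k] by (simp add: ev_pcompose ev_power ev_X)
  also have "(z ^ k) ^ l = z ^ (l * k)" by (simp add: power_mult[symmetric] mult.commute)
  finally show ?thesis using X sg_ev[of "l * k" f] k l by simp
qed

end

lemma sg_one: "X \<in> R \<Longrightarrow> sg 1 X = X"
  by (elim R_E) (simp add: sg_ev)

lemma coprime_N_minus_1: "coprime (N - 1) N"
  using N_gt_1 by (metis coprime_diff_one_left_nat gr_implies_not0 not_one_less_zero neq0_conv)

lemma cnj_eq_sg: "X \<in> R \<Longrightarrow> cnj X = sg (N - 1) X"
  by (elim R_E) (simp only: sg_ev[OF coprime_N_minus_1] cnj_ev cnj_z)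

lemma sg_cnj: "coprime k N \<Longrightarrow> X \<in> R \<Longrightarrow> sg k (cnj X) = cnj (sg k X)"
  by (simp only: cnj_eq_sg R_sg sg_sg coprime_N_minus_1 mult.commute)

lemma bij_betw_U_mult:
  assumes "coprime l N"
  shows "bij_betw (\<lambda>k. k * l mod N) U U"
proof -
  have "inj_on (\<lambda>k. k * l mod N) U"
  proof (rule inj_onI)
    fix x y assume "x \<in> U" "y \<in> U" "x * l mod N = y * l mod N"
    then show "x = y" using assms
      by (metis (mono_tags, lifting) U_def cong_def cong_mult_rcancel_nat mem_Collect_eq mod_less coprime_commute)
  qed
  moreover have "(\<lambda>k. k * l mod N) ` U \<subseteq> U"
    using assms N_pos by (auto simp: U_def)
  ultimately show ?thesis using finite_U by (simp add: bij_betw_def endo_inj_surj)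
qed

text \<open>A Ramanujan sum: the sum over all residues minus the sum over the multiples of
  \<open>p\<close>, both geometric.\<close>

lemma sum_U_z_power_int: "(\<Sum>k\<in>U. z ^ (k * i)) \<in> \<int>"
proof -
  have "(\<Sum>k<N. (z ^ i) ^ k) = (\<Sum>k\<in>U. (z ^ i) ^ k) + (\<Sum>k<m. ((z ^ i) ^ p) ^ k)"
    unfolding sum_lessThan_N by (simp add: power_mult)
  moreover have "(z ^ i) ^ N = 1" using z_power_eq_1_iff[of "i * N"] by (simp add: power_mult)
  moreover have "((z ^ i) ^ p) ^ m = 1" using z_power_eq_1_iff[of "i * N"] by (simp add: power_mult N_eq)
  ultimately have "(\<Sum>k\<in>U. (z ^ i) ^ k) = (if z ^ i = 1 then of_nat N else 0) - (if (z ^ i) ^ p = 1 then of_nat m else 0)"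
    using sum_powers_root_unity[of "z ^ i" N] sum_powers_root_unity[of "(z ^ i) ^ p" m] by (simp add: algebra_simps)
  moreover have "(\<Sum>k\<in>U. z ^ (k * i)) = (\<Sum>k\<in>U. (z ^ i) ^ k)" by (simp add: power_mult[symmetric] mult.commute)
  ultimately show ?thesis by simp
qed

lemma trace_int:
  assumes "X \<in> R"
  shows "(\<Sum>k\<in>U. sg k X) \<in> \<int>"
proof -
  obtain f where f: "X = ev z f" using assms by (rule R_E)
  have "(\<Sum>k\<in>U. sg k X) = (\<Sum>k\<in>U. ev (z ^ k) f)" by (rule sum.cong) (auto simp: f sg_ev U_def)
  also have "\<dots> = (\<Sum>k\<in>U. \<Sum>i\<le>degree f. of_int (poly.coeff f i) * z ^ (k * i))"
    by (simp add: ev_altdef power_mult)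
  also have "\<dots> = (\<Sum>i\<le>degree f. of_int (poly.coeff f i) * (\<Sum>k\<in>U. z ^ (k * i)))"
    by (subst sum.swap) (simp add: sum_distrib_left)
  also have "\<dots> \<in> \<int>" by (rule Ints_sum, rule Ints_mult[OF Ints_of_int sum_U_z_power_int])
  finally show ?thesis .
qed

text \<open>The trace of an invariant element is \<open>card U * X\<close>, so \<open>X\<close> is
  rational as well as integral.\<close>

lemma int_of_invariant:
  assumes "X \<in> R" "\<And>k. k \<in> U \<Longrightarrow> sg k X = X"
  shows "X \<in> \<int>"
proof -
  obtain t where "(\<Sum>k\<in>U. sg k X) = of_int t" using trace_int[OF assms(1)] by (auto elim: Ints_cases)
  then have "of_int (int (card U)) * X = of_int t" using assms(2) by simp
  then show ?thesis by (rule rational_multiple_algebraic_int(1)[OF algebraic_int_R[OF assms(1)]]) (use card_U_pos in simp)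
qed

lemma norm_int:
  assumes "X \<in> R"
  shows "(\<Prod>k\<in>U. sg k X) \<in> \<int>"
proof (rule int_of_invariant)
  show "(\<Prod>k\<in>U. sg k X) \<in> R" using assms by (auto intro!: R_closed R_sg)
  fix l assume "l \<in> U"
  then have l: "coprime l N" by (simp add: U_def)
  have "sg l (\<Prod>k\<in>U. sg k X) = (\<Prod>k\<in>U. sg l (sg k X))" using assms by (intro sg_prod l R_sg)
  also have "\<dots> = (\<Prod>k\<in>U. sg (k * l mod N) X)"
  proof (rule prod.cong)
    fix k assume "k \<in> U"
    then have "sg l (sg k X) = sg (k * l) X" using l assms by (intro sg_sg) (auto simp: U_def)
    also have "\<dots> = sg (k * l mod N) X" by (rule sg_cong) (simp add: cong_def)
    finally show "sg l (sg k X) = sg (k * l mod N) X" .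
  qed simp
  also have "\<dots> = (\<Prod>k\<in>U. sg k X)" by (rule prod.reindex_bij_betw[OF bij_betw_U_mult[OF l]])
  finally show "sg l (\<Prod>k\<in>U. sg k X) = (\<Prod>k\<in>U. sg k X)" .
qed

lemma sg_nonzero:
  assumes "X \<in> R" "X \<noteq> 0" "coprime k N"
  shows "sg k X \<noteq> 0"
proof
  assume 0: "sg k X = 0"
  obtain l where l: "l \<in> U" "[k * l = 1] (mod N)" by (rule U_inverse[OF assms(3)])
  then have cl: "coprime l N" by (simp add: U_def)
  have "sg l (sg k X) = sg (k * l) X" by (rule sg_sg[OF cl assms(3,1)])
  also have "\<dots> = X" using sg_cong[OF l(2)] sg_one[OF assms(1)] by simp
  finally show False using 0 sg_0[OF cl] assms(2) by simp
qed

lemma prod_norm_conjugates_ge_1: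
  assumes "X \<in> R" "X \<noteq> 0"
  shows "1 \<le> (\<Prod>k\<in>U. cmod (sg k X))"
proof -
  obtain n where n: "(\<Prod>k\<in>U. sg k X) = of_int n" using norm_int[OF assms(1)] by (auto elim: Ints_cases)
  have "(\<Prod>k\<in>U. sg k X) \<noteq> 0" using sg_nonzero[OF assms] finite_U by (auto simp: U_def)
  then have "n \<noteq> 0" using n by auto
  then have "1 \<le> \<bar>real_of_int n\<bar>" by linarith
  also have "\<dots> = cmod (\<Prod>k\<in>U. sg k X)" unfolding n by simp
  also have "\<dots> = (\<Prod>k\<in>U. cmod (sg k X))" by (rule prod_norm[symmetric])
  finally show ?thesis .
qed

text \<open>Kronecker's argument: the conjugates of \<open>(E - 1) / 2\<close> have modulus at most 1, and their product is an integer.\<close>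

lemma unimodular_cong_1_mod_2:
  assumes "E \<in> R" "E * cnj E = 1" "Z \<in> R" "E - 1 = 2 * Z"
  shows "E = 1 \<or> E = -1"
proof (rule ccontr)
  assume neg: "\<not> ?thesis"
  have Z: "Z \<noteq> 0" using neg assms by auto
  have sE: "cmod (sg k E) = 1" and sZ: "sg k E = 1 + 2 * sg k Z" if k: "coprime k N" for k
  proof -
    have "sg k E * cnj (sg k E) = sg k (E * cnj E)"
      unfolding sg_mult[OF k assms(1) R_cnj[OF assms(1)]] sg_cnj[OF k assms(1)] ..
    also have "\<dots> = 1" using assms sg_1 k by simp
    finally have "complex_of_real ((cmod (sg k E))\<^sup>2) = 1" by (simp only: complex_norm_square)
    then show "cmod (sg k E) = 1" by (metis norm_ge_zero norm_one norm_of_real abs_of_nonneg of_real_eq_1_iff power2_eq_1_iff one_power2 power2_eq_iff_nonneg zero_le_one)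
    have "E = 1 + of_int 2 * Z" using assms(4) by (simp add: algebra_simps)
    then have "sg k E = sg k 1 + sg k (of_int 2 * Z)" using sg_add[OF k R_1, of "of_int 2 * Z"] assms by (simp add: R_closed)
    also have "\<dots> = 1 + of_int 2 * sg k Z" unfolding sg_1[OF k] sg_mult[OF k R_of_int assms(3)] sg_of_int[OF k] ..
    finally show "sg k E = 1 + 2 * sg k Z" by simp
  qed
  have le: "cmod (sg k Z) \<le> 1" if k: "coprime k N" for k
  proof -
    have "2 * cmod (sg k Z) = cmod (sg k E - 1)" using sZ[OF k] by (simp add: norm_mult)
    also have "\<dots> \<le> cmod (sg k E) + cmod 1" by (rule norm_triangle_ineq4)
    finally show ?thesis using sE[OF k] by simp
  qed
  \<comment> \<open>Equality would put \<open>E\<close> at distance 2 from 1 on the unit circle,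
    that is, at -1.\<close>
  have lt: "cmod (sg 1 Z) < 1"
  proof -
    have Z1: "sg 1 Z = Z" and E1: "cmod E = 1" using sg_one assms sE[of 1] by auto
    have "cmod Z \<noteq> 1"
    proof
      assume "cmod Z = 1"
      have r: "(Re E)\<^sup>2 + (Im E)\<^sup>2 = 1" using E1 by (simp add: cmod_def)
      have "Re E - 1 = 2 * Re Z" "Im E = 2 * Im Z" using assms(4) by (auto simp: complex_eq_iff)
      moreover have "(Re Z)\<^sup>2 + (Im Z)\<^sup>2 = 1" using \<open>cmod Z = 1\<close> by (simp add: cmod_def)
      ultimately have "(Re E - 1)\<^sup>2 + (Im E)\<^sup>2 = 4" by (simp add: power_mult_distrib)
      then have "Re E = -1" using r by (simp add: power2_eq_square algebra_simps)
      then have "E = -1" using r by (simp add: complex_eq_iff)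
      then show False using neg by simp
    qed
    then show ?thesis using le[of 1] Z1 by simp
  qed
  have "1 \<in> U" using N_gt_1 by (simp add: U_def)
  have "(\<Prod>k\<in>U. cmod (sg k Z)) = cmod (sg 1 Z) * (\<Prod>k\<in>U - {1}. cmod (sg k Z))"
    by (rule prod.remove[OF finite_U \<open>1 \<in> U\<close>])
  also have "\<dots> \<le> cmod (sg 1 Z) * 1"
    using le by (intro mult_left_mono prod_le_1) (auto simp: U_def)
  finally show False using prod_norm_conjugates_ge_1[OF assms(3) Z] lt by simp
qed

end

section \<open>Divisibility by the prime above p\<close>

context prime_power_cyclotomic
begin

definition units :: "complex set" where "units = {u \<in> R. \<exists>v\<in>R. u * v = 1}"

lemma units_I: "u \<in> R \<Longrightarrow> v \<in> R \<Longrightarrow> u * v = 1 \<Longrightarrow> u \<in> units \<and> v \<in> units"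
  by (auto simp: units_def mult.commute)

lemma units_R: "u \<in> units \<Longrightarrow> u \<in> R"
  by (simp add: units_def)

lemma units_E: assumes "u \<in> units" obtains v where "v \<in> units" "u * v = 1"
  using assms by (auto simp: units_def mult.commute)

lemma units_mult:
  assumes "a \<in> units" "b \<in> units" shows "a * b \<in> units"
proof -
  obtain a' b' where "a' \<in> R" "b' \<in> R" "a * a' = 1" "b * b' = 1" "a \<in> R" "b \<in> R" using assms by (auto simp: units_def)
  moreover have "(a * b) * (a' * b') = (a * a') * (b * b')" by simp
  ultimately show ?thesis unfolding units_def using R_mult by auto
qed

lemma units_cnj: "a \<in> units \<Longrightarrow> cnj a \<in> units"
  unfolding units_def using R_cnj by auto (metis complex_cnj_mult complex_cnj_one R_cnj)

lemma units_power: "a \<in> units \<Longrightarrow> a ^ n \<in> units"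
proof (induction n)
  case 0
  then show ?case using R_1 by (auto simp: units_def)
qed (simp add: units_mult)

lemma lam_not_unit: "lam \<notin> units"
proof
  assume "lam \<in> units"
  then obtain v where "v \<in> R" "lam * v = 1" by (auto simp: units_def)
  then have "int p dvd 1" by (intro int_multiple_of_lam[of 1 v]) auto
  then show False using p_gt_1 by auto
qed

text \<open>\<open>z\<close> is 1 modulo \<open>lam\<close>, so every residue class contains an
  integer; with \<open>int_multiple_of_lam\<close> the residue ring is the field with
  \<open>p\<close> elements.\<close>

lemma residue_lam:
  assumes "X \<in> R"
  shows "\<exists>a. \<exists>r\<in>R. X = of_int a + lam * r"
proof -
  have "\<exists>a. \<exists>r\<in>R. ev z f = of_int a + lam * r" for f
  proof (induction f)
    case 0
    show ?case by (intro exI[of _ 0] bexI[of _ 0]) (auto simp: ev_0 R_0)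
  next
    case (pCons b f)
    then obtain a r where ar: "r \<in> R" "ev z f = of_int a + lam * r" by blast
    have "ev z (pCons b f) = of_int b + (1 - lam) * (of_int a + lam * r)" by (simp add: ev_pCons ar lam_def)
    also have "\<dots> = of_int (a + b) + lam * (r - of_int a - lam * r)" by (simp add: algebra_simps)
    finally have "ev z (pCons b f) = of_int (a + b) + lam * (r - of_int a - lam * r)" .
    moreover have "r - of_int a - lam * r \<in> R" using ar by (intro R_closed R_lam)
    ultimately show ?case by blast
  qed
  then show ?thesis using assms by (metis R_E)
qed

lemma lam_dvd_p: "\<exists>r\<in>R. of_int (int p) = lam * r"
proof -
  obtain u v where uv: "u \<in> R" "of_nat p = lam ^ card U * u" by (rule p_associated_lam_power)
  have "lam ^ card U = lam * lam ^ (card U - 1)" using card_U_pos by (metis Suc_diff_1 power_Suc)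
  then have "of_int (int p) = lam * (lam ^ (card U - 1) * u)" using uv by simp
  moreover have "lam ^ (card U - 1) * u \<in> R" using uv(1) by (intro R_closed R_lam)
  ultimately show ?thesis by blast
qed

lemma lam_prime:
  assumes "X \<in> R" "Y \<in> R" "r \<in> R" "X * Y = lam * r"
  shows "(\<exists>s\<in>R. X = lam * s) \<or> (\<exists>s\<in>R. Y = lam * s)"
proof -
  obtain a s where a: "s \<in> R" "X = of_int a + lam * s" using residue_lam[OF assms(1)] by blast
  obtain b t where b: "t \<in> R" "Y = of_int b + lam * t" using residue_lam[OF assms(2)] by blast
  have "of_int (a * b) = X * Y - lam * (s * Y + of_int a * t)" by (simp add: a b algebra_simps)
  also have "\<dots> = lam * (r - (s * Y + of_int a * t))" by (simp add: assms algebra_simps)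
  finally have "int p dvd a * b"
    by (rule int_multiple_of_lam) (intro R_closed a(1) b(1) assms)
  then have "int p dvd a \<or> int p dvd b" using prime_p prime_dvd_mult_iff[of "int p"] by auto
  moreover have "\<exists>s\<in>R. of_int a + lam * s' = lam * s" if "int p dvd a" "s' \<in> R" for a s'
  proof -
    obtain k where k: "a = int p * k" using \<open>int p dvd a\<close> by blast
    obtain r where r: "r \<in> R" "of_int (int p) = lam * r" using lam_dvd_p by blast
    have "of_int a + lam * s' = of_int (int p) * of_int k + lam * s'" by (simp add: k)
    also have "\<dots> = lam * (r * of_int k + s')" unfolding r(2) by (simp add: algebra_simps)
    finally show ?thesis using r that R_closed by blast
  qed
  ultimately show ?thesis using a b by blast
qed

lemma lam_power_dvd_cancel:
  assumes "X \<in> R" "\<not> (\<exists>r\<in>R. X = lam * r)" "Y \<in> R" "r \<in> R" "X * Y = lam ^ s * r"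
  shows "\<exists>Y'\<in>R. Y = lam ^ s * Y'"
  using assms(3-)
proof (induction s arbitrary: Y r)
  case 0
  then show ?case by (intro bexI[of _ Y]) auto
next
  case (Suc s)
  have "X * Y = lam * (lam ^ s * r)" using Suc.prems by simp
  then obtain Y1 where Y1: "Y1 \<in> R" "Y = lam * Y1"
    using lam_prime[of X Y "lam ^ s * r"] assms Suc.prems R_closed R_lam by metis
  have "lam * (X * Y1) = lam * (lam ^ s * r)" using Suc.prems Y1 by simp
  then have "X * Y1 = lam ^ s * r" using lam_nonzero by (simp only: mult_cancel_left) simp
  then obtain Y' where "Y' \<in> R" "Y1 = lam ^ s * Y'" using Suc.IH Y1 Suc.prems by blast
  then show ?case using Y1 by (intro bexI[of _ Y']) auto
qed

text \<open>Primality of \<open>lam\<close> stands in for unique factorization: either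
  \<open>lam\<close> can be removed from \<open>X\<close>, or all of \<open>lam ^ s\<close> divides
  the cofactor \<open>Y\<close> and \<open>X\<close> is a unit.\<close>

lemma dvd_lam_power:
  assumes "X \<in> R" "Y \<in> R" "u \<in> units" "X * Y = lam ^ s * u"
  shows "\<exists>j. \<exists>v\<in>units. X = lam ^ j * v"
  using assms(1,4)
proof (induction s arbitrary: X)
  case 0
  obtain v where v: "v \<in> units" "u * v = 1" using assms(3) by (rule units_E)
  then have "X * (Y * v) = 1" using 0 by (simp add: mult.assoc[symmetric])
  then have "X \<in> units" using units_I[of X "Y * v"] 0 v assms units_R R_mult by blast
  then show ?case by (intro exI[of _ 0]) auto
next
  case (Suc s)
  show ?case
  proof (cases "\<exists>r\<in>R. X = lam * r")
    case True
    then obtain r where r: "r \<in> R" "X = lam * r" by blast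
    then have "lam * (r * Y) = lam * (lam ^ s * u)" using Suc.prems by simp
    then have "r * Y = lam ^ s * u" using lam_nonzero by (simp only: mult_cancel_left) simp
    then obtain j v where "v \<in> units" "r = lam ^ j * v" using Suc.IH r by blast
    then show ?thesis using r by (intro exI[of _ "Suc j"] bexI[of _ v]) auto
  next
    case False
    then obtain Y' where Y': "Y' \<in> R" "Y = lam ^ Suc s * Y'"
      using lam_power_dvd_cancel[of X Y u "Suc s"] Suc.prems assms units_R by blast
    then have "lam ^ Suc s * (X * Y') = lam ^ Suc s * u" using Suc.prems by (simp add: algebra_simps)
    then have XY: "X * Y' = u" using lam_nonzero by (simp only: mult_cancel_left power_eq_0_iff) simp
    obtain v where v: "v \<in> units" "u * v = 1" using assms(3) by (rule units_E)
    then have "X * (Y' * v) = 1" using XY by (simp add: mult.assoc[symmetric])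
    then have "X \<in> units" using units_I[of X "Y' * v"] Suc.prems v Y' units_R R_mult by blast
    then show ?thesis by (intro exI[of _ 0]) auto
  qed
qed

lemma lam_power_unit_unique:
  assumes "lam ^ i * u = lam ^ j * v" "u \<in> units" "v \<in> units"
  shows "i = j"
  using assms
proof (induction i j arbitrary: u v rule: linorder_wlog)
  case (le i j)
  show ?case
  proof (rule ccontr)
    assume "i \<noteq> j"
    then have "lam ^ j = lam ^ i * (lam * lam ^ (j - Suc i))" using le(1) by (simp flip: power_add power_Suc)
    then have "lam ^ i * u = lam ^ i * (lam * (lam ^ (j - Suc i) * v))" using le(2) by (simp only: mult.assoc)
    then have u: "u = lam * (lam ^ (j - Suc i) * v)"
      using lam_nonzero by (simp only: mult_cancel_left power_eq_0_iff) simp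
    obtain u' where u': "u' \<in> units" "u * u' = 1" using le(3) by (rule units_E)
    have "lam * (lam ^ (j - Suc i) * v * u') = 1" using u u'(2) by (simp add: mult.assoc[symmetric])
    moreover have "lam ^ (j - Suc i) * v * u' \<in> R" using le u' units_R by (intro R_closed R_lam) auto
    ultimately have "lam \<in> units" using units_I R_lam by blast
    then show False using lam_not_unit by simp
  qed
next
  case (sym i j)
  then show ?case by metis
qed

lemma cnj_lam: "\<exists>u\<in>units. cnj lam = lam * u"
proof -
  obtain u v where "u \<in> R" "v \<in> R" "u * v = 1" "1 - z ^ (N - 1) = lam * u"
    by (rule one_minus_z_power_associated[OF coprime_N_minus_1])
  then show ?thesis using units_I by (auto simp: lam_def cnj_z)
qed

text \<open>This is where total ramification of \<open>p\<close> enters.\<close>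

lemma p_power_dvd_of_norm:
  assumes "X \<in> R" "X * cnj X = of_nat p ^ (2 * s)"
  shows "\<exists>V\<in>R. X = of_nat p ^ s * V"
proof -
  obtain u v where uv: "u \<in> R" "v \<in> R" "u * v = 1" and pu: "of_nat p = lam ^ card U * u"
    by (rule p_associated_lam_power)
  have u: "u \<in> units" "v \<in> units" using units_I uv by auto
  have "X * cnj X = lam ^ (card U * (2 * s)) * u ^ (2 * s)"
    unfolding assms(2) pu by (simp add: power_mult_distrib power_mult)
  moreover have "cnj X \<in> R" using assms R_cnj by blast
  ultimately obtain j w where w: "w \<in> units" "X = lam ^ j * w"
    using dvd_lam_power assms units_power[OF u(1)] by blast
  obtain x where x: "x \<in> units" "cnj lam = lam * x" using cnj_lam by blast
  have "X * cnj X = lam ^ (2 * j) * (w * cnj w * x ^ j)"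
    unfolding w mult_2 power_add by (simp add: x power_mult_distrib algebra_simps)
  then have "lam ^ (2 * j) * (w * cnj w * x ^ j) = lam ^ (card U * (2 * s)) * u ^ (2 * s)"
    using \<open>X * cnj X = lam ^ (card U * (2 * s)) * u ^ (2 * s)\<close> by simp
  \<comment> \<open>\<open>X\<close> and \<open>cnj X\<close> contribute the same exponent because
    \<open>cnj lam\<close> is associated to \<open>lam\<close>.\<close>
  then have "2 * j = card U * (2 * s)"
    by (rule lam_power_unit_unique) (intro units_mult units_power units_cnj w x u)+
  then have j: "j = card U * s" by simp
  have "of_nat p ^ s * (v ^ s * w) = lam ^ (card U * s) * (u * v) ^ s * w"
    unfolding pu by (simp add: power_mult_distrib power_mult)
  also have "\<dots> = X" by (simp add: uv w j)
  finally show ?thesis using uv w units_R R_closed by metis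
qed

end

text \<open>Zorn's lemma gives an ideal maximal among those without 1. It is prime: if it misses
  \<open>x\<close> and \<open>y\<close>, then 1 is congruent to a multiple of each, hence of
  \<open>x * y\<close>.\<close>

lemma ex_prime_ideal_containing:
  assumes R: "is_ideal R R" "1 \<in> R" and J: "is_ideal R J" "1 \<notin> J"
  shows "\<exists>M. is_prime_ideal R M \<and> J \<subseteq> M"
proof -
  define A where "A = {I. is_ideal R I \<and> J \<subseteq> I \<and> 1 \<notin> I}"
  have "\<exists>M\<in>A. \<forall>X\<in>A. M \<subseteq> X \<longrightarrow> X = M"
  proof (rule subset_Zorn_nonempty)
    show "A \<noteq> {}" using J by (auto simp: A_def)
    fix C assume C: "C \<noteq> {}" "subset.chain A C"
    then have CA: "C \<subseteq> A" by (simp add: subset_chain_def)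
    have "is_ideal R (\<Union>C)"
      unfolding is_ideal_def
    proof (intro conjI ballI)
      show "\<Union>C \<subseteq> R" "0 \<in> \<Union>C" using CA C(1) by (fastforce simp: A_def is_ideal_def)+
      show "r * x \<in> \<Union>C" if "r \<in> R" "x \<in> \<Union>C" for r x using that CA by (fastforce simp: A_def is_ideal_def)
      fix x y assume "x \<in> \<Union>C" "y \<in> \<Union>C"
      then obtain I I' where I: "I \<in> C" "x \<in> I" "I' \<in> C" "y \<in> I'" by blast
      then have "I \<subseteq> I' \<or> I' \<subseteq> I" using C(2) by (auto simp: subset_chain_def)
      then obtain K where "K \<in> C" "x \<in> K" "y \<in> K" using I by blast
      moreover from this have "is_ideal R K" using CA by (auto simp: A_def)
      ultimately have "x + y \<in> K" by (simp add: is_ideal_def)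
      then show "x + y \<in> \<Union>C" using \<open>K \<in> C\<close> by blast
    qed
    then show "\<Union>C \<in> A" using CA C(1) by (fastforce simp: A_def)
  qed
  then obtain M where M: "is_ideal R M" "J \<subseteq> M" "1 \<notin> M"
    and max: "\<And>I. is_ideal R I \<Longrightarrow> J \<subseteq> I \<Longrightarrow> 1 \<notin> I \<Longrightarrow> M \<subseteq> I \<Longrightarrow> I = M"
    by (auto simp: A_def)
  have Rd: "x + y \<in> R" "x * y \<in> R" if "x \<in> R" "y \<in> R" for x y using R(1) that by (auto simp: is_ideal_def)
  have Md: "x \<in> R" if "x \<in> M" for x using M(1) that by (auto simp: is_ideal_def)
  have Ma: "x + y \<in> M" if "x \<in> M" "y \<in> M" for x y using M(1) that by (auto simp: is_ideal_def)
  have Mm: "x * y \<in> M" if "x \<in> R" "y \<in> M" for x y using M(1) that by (auto simp: is_ideal_def)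
  have M0: "0 \<in> M" using M(1) by (auto simp: is_ideal_def)
  have R0: "0 \<in> R" using R(1) by (auto simp: is_ideal_def)
  have ex: "\<exists>a\<in>M. \<exists>r\<in>R. 1 = a + r * x" if x: "x \<in> R" "x \<notin> M" for x
  proof (rule ccontr)
    assume no: "\<not> ?thesis"
    define I where "I = {a + r * x | a r. a \<in> M \<and> r \<in> R}"
    have MI: "M \<subseteq> I"
    proof
      fix a assume "a \<in> M"
      then show "a \<in> I" unfolding I_def using R0 by (intro CollectI exI[of _ a] exI[of _ 0]) auto
    qed
    have "is_ideal R I"
      unfolding is_ideal_def
    proof (intro conjI ballI)
      show "I \<subseteq> R" unfolding I_def using Md Rd x by blast
      show "0 \<in> I" using MI M0 by blast
      fix y assume "y \<in> I"
      then obtain a r where y: "y = a + r * x" "a \<in> M" "r \<in> R" by (auto simp: I_def)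
      { fix y' assume "y' \<in> I"
        then obtain a' r' where y': "y' = a' + r' * x" "a' \<in> M" "r' \<in> R" by (auto simp: I_def)
        have "y + y' = (a + a') + (r + r') * x" by (simp add: y y' algebra_simps)
        then show "y + y' \<in> I" unfolding I_def using y y' Ma Rd by blast }
      { fix s assume "s \<in> R"
        have "s * y = s * a + (s * r) * x" by (simp add: y algebra_simps)
        then show "s * y \<in> I" unfolding I_def using y Mm Rd \<open>s \<in> R\<close> by blast }
    qed
    moreover have "1 \<notin> I" using no by (auto simp: I_def)
    ultimately have "I = M" using max M(2) MI by blast
    moreover have "x \<in> I" unfolding I_def using M0 R(2) by (intro CollectI exI[of _ 0] exI[of _ 1]) auto
    ultimately show False using x by simp
  qed
  have "is_prime_ideal R M"
    unfolding is_prime_ideal_def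
  proof (intro conjI ballI impI)
    show "is_ideal R M" by (rule M)
    show "M \<noteq> R" using M R by blast
    fix x y assume xy: "x \<in> R" "y \<in> R" "x * y \<in> M"
    show "x \<in> M \<or> y \<in> M"
    proof (rule ccontr)
      assume "\<not> ?thesis"
      then obtain a r b s where ar: "a \<in> M" "r \<in> R" "1 = a + r * x" and bs: "b \<in> M" "s \<in> R" "1 = b + s * y"
        using ex xy by metis
      have "1 = (a + r * x) * (b + s * y)" using ar(3) bs(3) by simp
      also have "\<dots> = (b + s * y) * a + (r * x) * b + (r * s) * (x * y)" by (simp add: algebra_simps)
      finally have "1 = (b + s * y) * a + (r * x) * b + (r * s) * (x * y)" .
      moreover have "(b + s * y) * a + (r * x) * b + (r * s) * (x * y) \<in> M"
        using ar(1,2) bs(1,2) xy Md[OF bs(1)] by (metis Ma Mm Rd)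
      ultimately show False using M(3) by simp
    qed
  qed
  then show ?thesis using M(2) by blast
qed

section \<open>The case where 2 generates a subgroup of index two\<close>

text \<open>The order modulo \<open>N\<close> governs the primes above 2; the order modulo
  \<open>p\<close> is the length of the Gaussian period that produces a square root of
  \<open>- p\<close>.\<close>

locale two_half_order = prime_power_cyclotomic +
  assumes p_mod_8: "p mod 8 = 7" and ord_two: "2 * ord N 2 = totient N" and ord_p_two: "2 * ord p 2 = p - 1"
begin

lemma p_odd: "odd p" using p_mod_8 by presburger
lemma N_odd: "odd N" using p_odd by (simp add: N_def)
lemma coprime_2_N: "coprime 2 N" using N_odd by simp
lemma coprime_2_power_N: "coprime (2 ^ i) N" using N_odd by simp

text \<open>\<open>p\<close> is 3 modulo 4, so \<open>(p - 1) div 2\<close> is odd. Consequently -1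
  is not a power of 2 modulo \<open>N\<close>.\<close>

lemma odd_ord: "odd (ord N 2)"
proof -
  have "totient N = m * (p - 1)" unfolding N_def m_def using totient_prime_power[OF prime_p e_pos] by (simp add: algebra_simps)
  moreover have "odd m" using p_odd by (simp add: m_def)
  moreover have "p - 1 = 2 * ((p - 1) div 2)" "odd ((p - 1) div 2)" using p_mod_8 by presburger+
  ultimately have "2 * ord N 2 = 2 * (m * ((p - 1) div 2))" using ord_two by (metis mult.left_commute)
  then have "ord N 2 = m * ((p - 1) div 2)" by simp
  then show ?thesis using \<open>odd m\<close> \<open>odd ((p - 1) div 2)\<close> by simp
qed

lemma card_U: "card U = totient N"
proof -
  have "k \<in> U \<longleftrightarrow> k \<in> totatives N" for k
    using N_gt_1 unfolding U_def in_totatives_iff by (cases "k = 0"; cases "k = N") auto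
  then have "U = totatives N" by blast
  then show ?thesis by (simp add: totient_def)
qed

lemma cong_neg_one_square: "[(N - 1) * (N - 1) = 1] (mod N)"
proof -
  have "[int (N - 1) * int (N - 1) = (-1) * (-1)] (mod int N)"
    by (intro cong_mult) (use N_pos in \<open>simp_all add: of_nat_diff cong_iff_dvd_diff\<close>)
  then have "[int ((N - 1) * (N - 1)) = int 1] (mod int N)" by simp
  then show ?thesis by (simp only: cong_int_iff)
qed

text \<open>If \<open>2 ^ i\<close> were the negative of \<open>2 ^ j\<close>, squaring and the odd
  order would give \<open>i = j\<close> modulo the order and then \<open>1 = - 1\<close>. So powers
  of 2 and their negatives are disjoint, and by counting they fill \<open>U\<close>. The factor
  \<open>N - 1\<close> plays the part of -1.\<close>

lemma U_eq_signed_powers_of_2: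
  assumes "k \<in> U"
  shows "\<exists>i. [k = 2 ^ i] (mod N) \<or> [k = (N - 1) * 2 ^ i] (mod N)"
proof -
  define f where "f = ord N 2"
  define A where "A = (\<lambda>i. 2 ^ i mod N) ` {..<f}"
  define B where "B = (\<lambda>k. k * (N - 1) mod N) ` A"
  have AU: "A \<subseteq> U" using N_pos coprime_2_N by (auto simp: A_def U_def)
  have BU: "B \<subseteq> U" using bij_betw_imp_surj_on[OF bij_betw_U_mult[OF coprime_N_minus_1]] AU unfolding B_def by blast
  have "inj_on (\<lambda>i. 2 ^ i mod N) {..<f}" unfolding f_def by (rule inj_power_mod) (use coprime_2_N in \<open>simp add: coprime_commute\<close>)
  then have cA: "card A = f" by (simp add: A_def card_image)
  have "inj_on (\<lambda>k. k * (N - 1) mod N) A"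
    using bij_betw_U_mult[OF coprime_N_minus_1] AU by (meson bij_betw_imp_inj_on inj_on_subset)
  then have cB: "card B = f" using cA by (simp add: B_def card_image)
  have "A \<inter> B = {}"
  proof (rule ccontr)
    assume "A \<inter> B \<noteq> {}"
    then obtain i j where "2 ^ i mod N = (2 ^ j mod N) * (N - 1) mod N" by (auto simp: A_def B_def)
    then have ij: "[2 ^ i = 2 ^ j * (N - 1)] (mod N)" by (simp add: cong_def mod_mult_left_eq)
    then have "[2 ^ i * 2 ^ i = 2 ^ j * (N - 1) * (2 ^ j * (N - 1))] (mod N)" by (rule cong_mult) (rule ij)
    also have "2 ^ j * (N - 1) * (2 ^ j * (N - 1)) = 2 ^ j * 2 ^ j * ((N - 1) * (N - 1))" by simp
    also have "[2 ^ j * 2 ^ j * ((N - 1) * (N - 1)) = 2 ^ j * 2 ^ j * 1] (mod N)"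
      by (rule cong_scalar_left[OF cong_neg_one_square])
    finally have "[2 ^ (2 * i) = 2 ^ (2 * j)] (mod N)" by (simp add: mult_2 power_add)
    then have "[2 * i = 2 * j] (mod f)" unfolding f_def
      using order_divides_expdiff[of N 2 "2 * i" "2 * j"] coprime_2_N by (simp add: coprime_commute)
    then have "[i = j] (mod f)" using odd_ord unfolding f_def
      by (metis cong_mult_lcancel_nat coprime_left_2_iff_odd coprime_commute)
    then have "[2 ^ i = 2 ^ j] (mod N)" unfolding f_def
      using order_divides_expdiff[of N 2 i j] coprime_2_N by (simp add: coprime_commute)
    then have "[2 ^ j * 1 = 2 ^ j * (N - 1)] (mod N)" using ij by (metis cong_sym cong_trans mult.right_neutral)
    then have "[1 = N - 1] (mod N)" using coprime_2_power_N by (metis cong_mult_lcancel_nat coprime_commute)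
    then have "1 mod N = (N - 1) mod N" by (simp add: cong_def)
    then have "N = 2" using N_gt_1 by simp
    then show False using N_odd by simp
  qed
  then have "card (A \<union> B) = 2 * f" using cA cB finite_subset[OF AU finite_U] finite_subset[OF BU finite_U]
    by (simp add: card_Un_disjoint)
  then have "A \<union> B = U" using AU BU finite_U card_U ord_two f_def by (intro card_subset_eq) auto
  then have "k \<in> A \<or> k \<in> B" using assms by blast
  then show ?thesis
  proof
    assume "k \<in> A"
    then show ?thesis by (auto simp: A_def cong_def)
  next
    assume "k \<in> B"
    then obtain i where "k = (2 ^ i mod N) * (N - 1) mod N" by (auto simp: A_def B_def)
    then have "[k = (N - 1) * 2 ^ i] (mod N)" unfolding cong_def by (metis mod_mod_trivial mod_mult_left_eq mult.commute)
    then show ?thesis by blast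
  qed
qed

lemma sg_2_power_ord: "X \<in> R \<Longrightarrow> sg (2 ^ ord N 2) X = X"
  using sg_cong[OF ord[of 2 N], of X] sg_one by simp

text \<open>Squaring is additive modulo 2 and fixes integers modulo 2, so the congruence extends
  from \<open>z\<close> to all polynomials in \<open>z\<close>.\<close>

lemma frobenius:
  assumes "X \<in> R"
  shows "\<exists>r\<in>R. sg 2 X = X\<^sup>2 + 2 * r"
proof -
  have "\<exists>r\<in>R. ev (z ^ 2) f = (ev z f)\<^sup>2 + 2 * r" for f
  proof (induction f)
    case 0
    then show ?case by (intro bexI[of _ 0]) (auto simp: ev_0 R_0)
  next
    case (pCons a f)
    then obtain r where r: "r \<in> R" "ev (z ^ 2) f = (ev z f)\<^sup>2 + 2 * r" by blast
    have "even (a - a * a)" by simp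
    then obtain b where b: "a - a * a = 2 * b" by blast
    then have a: "a = a * a + 2 * b" by simp
    have "ev (z ^ 2) (pCons a f) = of_int a + z ^ 2 * ((ev z f)\<^sup>2 + 2 * r)" by (simp add: ev_pCons r)
    also have "(of_int a :: complex) = of_int (a * a + 2 * b)" using a by metis
    also have "of_int (a * a + 2 * b) + z ^ 2 * ((ev z f)\<^sup>2 + 2 * r) =
        (ev z (pCons a f))\<^sup>2 + 2 * (of_int b + z ^ 2 * r - of_int a * z * ev z f)"
      by (simp add: ev_pCons power2_eq_square algebra_simps)
    finally show ?case by (rule bexI) (intro R_closed r R_I)
  qed
  then show ?thesis using assms sg_ev[OF coprime_2_N] by (metis R_E)
qed

lemma is_ideal_R: "is_ideal R R"
  by (auto simp: is_ideal_def R_closed)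

lemma one_not_even: "X \<in> R \<Longrightarrow> 2 * X \<noteq> 1"
  using int_dvd_of_R_dvd[of X 2 1] by auto

lemma ex_prime_ideal_above_2:
  obtains M where "is_prime_ideal R M" "2 \<in> M"
proof -
  define J where "J = {2 * r | r. r \<in> R}"
  have "is_ideal R J"
    unfolding is_ideal_def
  proof (intro conjI ballI)
    show "J \<subseteq> R" by (auto simp: J_def R_closed)
    show "0 \<in> J" unfolding J_def using R_0 by (intro CollectI exI[of _ 0]) auto
    fix x assume "x \<in> J"
    then obtain r where r: "x = 2 * r" "r \<in> R" by (auto simp: J_def)
    { fix y assume "y \<in> J"
      then obtain s where s: "y = 2 * s" "s \<in> R" by (auto simp: J_def)
      have "x + y = 2 * (r + s)" by (simp add: r s)
      then show "x + y \<in> J" unfolding J_def using r s R_add by blast }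
    { fix s assume "s \<in> R"
      have "s * x = 2 * (s * r)" by (simp add: r)
      then show "s * x \<in> J" unfolding J_def using r \<open>s \<in> R\<close> R_mult by blast }
  qed
  moreover have "1 \<notin> J" using one_not_even unfolding J_def by (auto dest: sym)
  ultimately obtain M where "is_prime_ideal R M" "J \<subseteq> M"
    using ex_prime_ideal_containing[OF is_ideal_R R_1] by blast
  moreover have "2 \<in> J" unfolding J_def using R_1 by (intro CollectI exI[of _ 1]) auto
  ultimately show ?thesis using that by blast
qed

context
  fixes M assumes prime_M: "is_prime_ideal R M" and two_M: "2 \<in> M"
begin

lemma M_R: "x \<in> M \<Longrightarrow> x \<in> R" and M_add: "x \<in> M \<Longrightarrow> y \<in> M \<Longrightarrow> x + y \<in> M"
  and M_mult: "r \<in> R \<Longrightarrow> x \<in> M \<Longrightarrow> r * x \<in> M" and M_0: "0 \<in> M"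
  using prime_M by (auto simp: is_prime_ideal_def is_ideal_def)

lemma M_prime: "x \<in> R \<Longrightarrow> y \<in> R \<Longrightarrow> x * y \<in> M \<Longrightarrow> x \<in> M \<or> y \<in> M"
  using prime_M by (simp add: is_prime_ideal_def)

lemma M_diff: "x \<in> M \<Longrightarrow> y \<in> M \<Longrightarrow> x - y \<in> M"
  using M_add[of x "- y"] M_mult[of "-1" y] R_of_int[of "-1"] by simp

lemma one_notin_M: "1 \<notin> M"
proof
  assume "1 \<in> M"
  then have "R \<subseteq> M" using M_mult[of _ 1] by auto
  then show False using prime_M M_R by (auto simp: is_prime_ideal_def)
qed

lemma M_even: "r \<in> R \<Longrightarrow> 2 * r \<in> M"
  using M_mult[OF _ two_M] by (simp add: mult.commute)

lemma of_int_M: "of_int a \<in> M \<Longrightarrow> even a"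
proof (rule ccontr)
  assume a: "of_int a \<in> M" "odd a"
  then obtain k where "a = 2 * k + 1" by (auto elim: oddE)
  then have "1 = of_int a - 2 * complex_of_int k" by simp
  then show False using one_notin_M M_diff[OF a(1) M_even[OF R_of_int]] by metis
qed

lemma M_sum: "(\<And>i. i \<in> A \<Longrightarrow> f i \<in> M) \<Longrightarrow> (\<Sum>i\<in>A. f i) \<in> M"
  by (induction A rule: infinite_finite_induct) (auto intro: M_0 M_add)

lemma M_sg_2: "X \<in> M \<Longrightarrow> sg 2 X \<in> M"
proof -
  assume X: "X \<in> M"
  obtain r where r: "r \<in> R" "sg 2 X = X\<^sup>2 + 2 * r" using frobenius M_R X by blast
  show ?thesis unfolding r(2) power2_eq_square using X M_R r(1) by (intro M_add M_mult M_even) auto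
qed

lemma M_sg_2_power: "X \<in> M \<Longrightarrow> sg (2 ^ i) X \<in> M"
proof (induction i)
  case 0
  then show ?case using sg_one M_R by simp
next
  case (Suc i)
  have "sg 2 (sg (2 ^ i) X) = sg (2 ^ i * 2) X" using Suc.prems M_R by (intro sg_sg coprime_2_N coprime_2_power_N) auto
  then show ?case using M_sg_2[OF Suc.IH[OF Suc.prems]] by (simp add: mult.commute)
qed

text \<open>Every conjugate of \<open>X\<close> lies in \<open>M\<close>, so the traces
  \<open>t i\<close> are integers in \<open>M\<close>, hence even. Fourier inversion recovers
  \<open>N * X\<close> from them, and \<open>N\<close> is odd.\<close>

lemma M_inter_cnj:
  assumes "X \<in> M" "cnj X \<in> M"
  shows "\<exists>r\<in>R. X = 2 * r"
proof -
  have XR: "X \<in> R" using assms M_R by blast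
  have sgM: "sg k X \<in> M" if k: "k \<in> U" for k
  proof -
    obtain i where "[k = 2 ^ i] (mod N) \<or> [k = (N - 1) * 2 ^ i] (mod N)" using U_eq_signed_powers_of_2[OF k] by blast
    then show ?thesis
    proof
      assume "[k = 2 ^ i] (mod N)"
      then show ?thesis using sg_cong M_sg_2_power assms by metis
    next
      assume k: "[k = (N - 1) * 2 ^ i] (mod N)"
      have "sg k X = sg (2 ^ i) (cnj X)"
        unfolding cnj_eq_sg[OF XR] sg_cong[OF k] by (rule sg_sg[symmetric, OF coprime_2_power_N coprime_N_minus_1 XR])
      then show ?thesis using M_sg_2_power assms by simp
    qed
  qed
  define t where "t = (\<lambda>i. \<Sum>k\<in>U. sg k (X * cnj z ^ i))"
  have "\<exists>b. t i = of_int (2 * b)" for i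
  proof -
    have "X * cnj z ^ i \<in> R" using XR by (intro R_closed)
    then obtain a where a: "t i = of_int a" unfolding t_def using trace_int by (auto elim: Ints_cases)
    have "t i \<in> M" unfolding t_def
    proof (rule M_sum)
      fix k assume k: "k \<in> U"
      then have "sg k (X * cnj z ^ i) = sg k (cnj z ^ i) * sg k X"
        using XR by (subst sg_mult) (auto simp: U_def intro!: R_closed)
      then show "sg k (X * cnj z ^ i) \<in> M" using sgM[OF k] by (simp add: M_mult R_sg R_closed)
    qed
    then have "even a" using of_int_M a by simp
    then show ?thesis using a by (metis evenE)
  qed
  then obtain b where b: "\<And>i. t i = of_int (2 * b i)" by metis
  have "(\<Sum>i<N. t i * z ^ i) = (\<Sum>k\<in>U. sg k X * (\<Sum>i<N. (z * cnj z ^ k) ^ i))"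
  proof -
    have "t i * z ^ i = (\<Sum>k\<in>U. sg k X * (z * cnj z ^ k) ^ i)" for i
    proof -
      have "sg k (X * cnj z ^ i) * z ^ i = sg k X * (z * cnj z ^ k) ^ i" if "k \<in> U" for k
      proof -
        have k: "coprime k N" using that by (simp add: U_def)
        have "sg k (X * cnj z ^ i) = sg k X * sg k (cnj z) ^ i"
          using XR by (simp add: sg_mult[OF k] sg_power[OF k] R_closed)
        also have "sg k (cnj z) = cnj z ^ k" using sg_cnj[OF k R_z] sg_z[OF k] by simp
        finally show ?thesis by (simp add: power_mult_distrib)
      qed
      then show ?thesis unfolding t_def sum_distrib_right by (rule sum.cong[OF refl])
    qed
    then have "(\<Sum>i<N. t i * z ^ i) = (\<Sum>i<N. \<Sum>k\<in>U. sg k X * (z * cnj z ^ k) ^ i)" by simp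
    also have "\<dots> = (\<Sum>k\<in>U. \<Sum>i<N. sg k X * (z * cnj z ^ k) ^ i)" by (rule sum.swap)
    finally show ?thesis by (simp add: sum_distrib_left)
  qed
  also have "\<dots> = (\<Sum>k\<in>U. sg k X * (if k = 1 then of_nat N else 0))"
  proof (rule sum.cong[OF refl])
    fix k assume k: "k \<in> U"
    have "(z * cnj z ^ k) ^ N = (z ^ N) * (cnj (z ^ N)) ^ k" by (simp add: power_mult_distrib power_mult[symmetric] mult.commute)
    then have y: "(z * cnj z ^ k) ^ N = 1" by (simp add: z_power_N)
    have zk: "z ^ k * cnj z ^ k = 1" using z_mult_cnj by (metis power_mult_distrib power_one)
    have "z * cnj z ^ k = 1 \<longleftrightarrow> k = 1"
    proof
      assume "z * cnj z ^ k = 1"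
      then have "z * (z ^ k * cnj z ^ k) = z ^ k" by (simp add: mult.left_commute)
      then have "z ^ 1 = z ^ k" using zk by simp
      then have "1 mod N = k mod N" by (simp only: z_power_eq_iff)
      then show "k = 1" using k N_gt_1 by (simp add: U_def)
    qed (use z_mult_cnj in simp)
    then show "sg k X * (\<Sum>i<N. (z * cnj z ^ k) ^ i) = sg k X * (if k = 1 then of_nat N else 0)"
      using sum_powers_root_unity[OF y] by simp
  qed
  also have "\<dots> = of_nat N * X"
  proof -
    have "1 \<in> U" using N_gt_1 by (simp add: U_def)
    then show ?thesis using sg_one[OF XR] finite_U by (simp add: if_distrib[of "\<lambda>x. _ * x"] sum.delta' cong: if_cong)
  qed
  finally have NX: "of_nat N * X = 2 * (\<Sum>i<N. of_int (b i) * z ^ i)" by (simp add: b sum_distrib_left algebra_simps)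
  obtain h where h: "N = 2 * h + 1" using N_odd by (rule oddE)
  have "X = of_nat N * X - 2 * (of_nat h * X)" by (simp add: h algebra_simps)
  also have "\<dots> = 2 * ((\<Sum>i<N. of_int (b i) * z ^ i) - of_nat h * X)" unfolding NX by (simp add: algebra_simps)
  finally show ?thesis by (rule bexI) (intro R_closed XR)
qed

end

end

section \<open>Elements of prescribed squared modulus\<close>

context two_half_order
begin

context
  fixes M assumes M: "is_prime_ideal R M" "2 \<in> M"
begin

text \<open>Both primes above 2 contain the product but not \<open>r\<close>, so both contain
  \<open>Z\<close>; thus 2 divides \<open>Z\<close> and can be cancelled, \<open>d\<close> times
  over.\<close>

lemma cancel_mod_2_power:
  assumes "r \<in> R" "r \<notin> M" "cnj r \<notin> M" "Z \<in> R" "s \<in> R" "r * Z = 2 ^ d * s"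
  shows "\<exists>Z'\<in>R. Z = 2 ^ d * Z'"
  using assms(4-)
proof (induction d arbitrary: Z s)
  case 0
  then show ?case by (intro bexI[of _ Z]) auto
next
  case (Suc d)
  have eq: "r * Z = 2 * (2 ^ d * s)" using Suc.prems by simp
  have sR: "2 ^ d * s \<in> R" using Suc.prems by (intro R_closed)
  have "r * Z \<in> M" unfolding eq by (rule M_even[OF M sR])
  then have 1: "Z \<in> M" using M_prime[OF M] assms Suc.prems by blast
  have "cnj r * cnj Z = 2 * cnj (2 ^ d * s)" using eq by (metis complex_cnj_mult complex_cnj_numeral)
  then have "cnj r * cnj Z \<in> M" using M_even[OF M R_cnj[OF sR]] by simp
  then have 2: "cnj Z \<in> M" using M_prime[OF M] assms Suc.prems R_cnj by blast
  obtain Z1 where Z1: "Z1 \<in> R" "Z = 2 * Z1" using M_inter_cnj[OF M 1 2] by blast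
  then have "2 * (r * Z1) = 2 * (2 ^ d * s)" using eq by simp
  then have "r * Z1 = 2 ^ d * s" by (simp only: mult_cancel_left) simp
  then obtain Z' where "Z' \<in> R" "Z1 = 2 ^ d * Z'" using Suc.IH Z1 Suc.prems by blast
  then show ?case using Z1 by (intro bexI[of _ Z']) auto
qed

text \<open>The quotient of \<open>X\<close> by \<open>Y\<close> is
  \<open>X * cnj Y / (2 ^ d * p ^ s)\<close>. The power of 2 is removed with an auxiliary factor
  \<open>r\<close>, the power of \<open>p\<close> by total ramification.\<close>

lemma unimodular_quotient:
  assumes X: "X \<in> R" "cnj X \<notin> M" "X * cnj X = 2 ^ d * of_nat p ^ s"
    and Y: "Y \<in> R" "cnj Y \<notin> M" "Y * cnj Y = 2 ^ d * of_nat p ^ s" and "0 < d"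
  shows "\<exists>V\<in>R. V * cnj V = 1 \<and> X = V * Y"
proof -
  have "(2::complex) ^ d = 2 * 2 ^ (d - 1)" using \<open>0 < d\<close> by (metis Suc_diff_1 power_Suc)
  then have "2 ^ d * of_nat p ^ s = 2 * (2 ^ (d - 1) * of_nat p ^ s :: complex)" by simp
  moreover have "2 * (2 ^ (d - 1) * of_nat p ^ s) \<in> M" by (intro M_even[OF M] R_closed)
  ultimately have "2 ^ d * of_nat p ^ s \<in> M" by (simp only:)
  then have XM: "X \<in> M" and YM: "Y \<in> M" using M_prime[OF M] X Y R_cnj by metis+
  \<comment> \<open>Modulo \<open>M\<close> this is \<open>cnj X\<close>, modulo the conjugate prime
    it is \<open>Y\<close>, so it avoids both; and its product with \<open>X * cnj Y\<close> is
    visibly divisible by \<open>2 ^ d\<close>.\<close>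
  define r where "r = cnj X + Y"
  have "r \<notin> M" using M_diff[OF M, of r Y] YM X(2) by (auto simp: r_def)
  moreover have "cnj r \<notin> M" using M_diff[OF M, of "cnj r" X] XM Y(2) by (auto simp: r_def)
  moreover have "r * (X * cnj Y) = (X * cnj X) * cnj Y + (Y * cnj Y) * X" by (simp add: r_def algebra_simps)
  then have "r * (X * cnj Y) = 2 ^ d * (of_nat p ^ s * (cnj Y + X))" unfolding X(3) Y(3) by (simp add: algebra_simps)
  moreover have "r \<in> R" "X * cnj Y \<in> R" "of_nat p ^ s * (cnj Y + X) \<in> R"
    unfolding r_def using X(1) Y(1) by (simp_all add: R_closed)
  ultimately obtain W where W: "W \<in> R" "X * cnj Y = 2 ^ d * W" using cancel_mod_2_power by metis
  have "(2 ^ d * W) * cnj (2 ^ d * W) = (X * cnj X) * (Y * cnj Y)"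
    unfolding W(2)[symmetric] by (simp add: algebra_simps)
  then have "(2 ^ d * 2 ^ d) * (W * cnj W) = (2 ^ d * 2 ^ d) * (of_nat p ^ (2 * s))"
    unfolding X(3) Y(3) mult_2 power_add by (simp add: algebra_simps)
  then have "W * cnj W = of_nat p ^ (2 * s)" by (simp only: mult_cancel_left) simp
  then obtain V where V: "V \<in> R" "W = of_nat p ^ s * V" using p_power_dvd_of_norm W by blast
  have p0: "(of_nat p :: complex) \<noteq> 0" using p_gt_1 by simp
  have "of_nat p ^ (2 * s) * (V * cnj V) = of_nat p ^ (2 * s) * 1"
    using \<open>W * cnj W = of_nat p ^ (2 * s)\<close> unfolding V mult_2 power_add by (simp add: algebra_simps)
  then have V1: "V * cnj V = 1" using p0 by (simp only: mult_cancel_left power_eq_0_iff) simp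
  have "cnj Y * X = cnj Y * (V * Y)"
  proof -
    have "cnj Y * X = 2 ^ d * of_nat p ^ s * V" using W V by (simp add: mult.commute)
    also have "\<dots> = cnj Y * (V * Y)" unfolding Y(3)[symmetric] by simp
    finally show ?thesis .
  qed
  moreover have "cnj Y \<noteq> 0" using Y(2) M_0[OF M] by auto
  ultimately have "X = V * Y" by (simp only: mult_cancel_left) simp
  then show ?thesis using V(1) V1 by blast
qed

end

text \<open>The inverse of \<open>V\<close> is \<open>cnj V\<close>, so \<open>E\<close> is the
  quotient of \<open>sg 2 V\<close> by the square of \<open>V\<close>. It has modulus 1 and, by the
  Frobenius congruence, is 1 modulo 2.\<close>

lemma sg_2_unimodular:
  assumes "V \<in> R" "V * cnj V = 1"
  shows "sg 2 V = V\<^sup>2 \<or> sg 2 V = - (V\<^sup>2)"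
proof -
  obtain r where r: "r \<in> R" "sg 2 V = V\<^sup>2 + 2 * r" using frobenius[OF assms(1)] by blast
  define E where "E = sg 2 V * (cnj V)\<^sup>2"
  have VV: "V\<^sup>2 * (cnj V)\<^sup>2 = 1" using assms(2) by (metis power_mult_distrib power_one)
  have "sg 2 V * cnj (sg 2 V) = sg 2 (V * cnj V)"
    unfolding sg_mult[OF coprime_2_N assms(1) R_cnj[OF assms(1)]] sg_cnj[OF coprime_2_N assms(1)] ..
  also have "\<dots> = 1" using assms(2) sg_1[OF coprime_2_N] by simp
  finally have s1: "sg 2 V * cnj (sg 2 V) = 1" .
  have "E * cnj E = (sg 2 V * cnj (sg 2 V)) * (V\<^sup>2 * (cnj V)\<^sup>2)" by (simp add: E_def)
  then have E1: "E * cnj E = 1" unfolding s1 VV by simp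
  have "E - 1 = (V\<^sup>2 + 2 * r) * (cnj V)\<^sup>2 - V\<^sup>2 * (cnj V)\<^sup>2" unfolding VV by (simp add: E_def r)
  then have "E - 1 = 2 * (r * (cnj V)\<^sup>2)" by (simp add: algebra_simps)
  moreover have "E \<in> R" "r * (cnj V)\<^sup>2 \<in> R" unfolding E_def using assms r by (simp_all add: R_closed R_sg)
  ultimately have E: "E = 1 \<or> E = -1" using unimodular_cong_1_mod_2 E1 by blast
  have "sg 2 V = sg 2 V * (V\<^sup>2 * (cnj V)\<^sup>2)" unfolding VV by simp
  also have "\<dots> = E * V\<^sup>2" by (simp add: E_def)
  finally show ?thesis using E by auto
qed

lemma sg_2_power_eigen:
  assumes "W \<in> R" "sg 2 W = of_int a * W"
  shows "sg (2 ^ i) W = of_int a ^ i * W"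
proof (induction i)
  case 0
  then show ?case using sg_one assms by simp
next
  case (Suc i)
  have "sg (2 ^ Suc i) W = sg 2 (sg (2 ^ i) W)"
    using sg_sg[OF coprime_2_N coprime_2_power_N assms(1), of i] by (simp add: mult.commute)
  also have "\<dots> = sg 2 (of_int (a ^ i) * W)" unfolding Suc by simp
  also have "\<dots> = of_int (a ^ i) * (of_int a * W)"
    unfolding sg_mult[OF coprime_2_N R_of_int assms(1)] sg_of_int[OF coprime_2_N] assms(2) ..
  finally show ?case by simp
qed

text \<open>From \<open>X = V * sg 2 X\<close> the corrected element \<open>W = V * X\<close> is
  mapped to \<open>W\<close> times the quotient of \<open>sg 2 V\<close> by
  \<open>V\<^sup>2\<close>, a sign. Iterating the odd number \<open>ord N 2\<close> of times returns
  \<open>W\<close>, which excludes the minus sign.\<close>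

lemma ex_sg_2_fixed:
  assumes M: "is_prime_ideal R M" "2 \<in> M"
    and X: "X \<in> R" "cnj X \<notin> M" "X * cnj X = 2 ^ d * of_nat p ^ s" and "0 < d"
  shows "\<exists>W\<in>R. W * cnj W = 2 ^ d * of_nat p ^ s \<and> sg 2 W = W"
proof -
  define Y where "Y = sg 2 X"
  have YR: "Y \<in> R" using X R_sg by (simp add: Y_def)
  have cY: "cnj Y = sg 2 (cnj X)" using sg_cnj[OF coprime_2_N X(1)] by (simp add: Y_def)
  obtain r where r: "r \<in> R" "cnj Y = (cnj X)\<^sup>2 + 2 * r" unfolding cY using frobenius[OF R_cnj[OF X(1)]] by blast
  have "cnj Y \<notin> M"
  proof
    assume "cnj Y \<in> M"
    then have "cnj Y - 2 * r \<in> M" using M_diff[OF M _ M_even[OF M r(1)]] by blast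
    then have "cnj X * cnj X \<in> M" by (simp add: r(2) power2_eq_square)
    then show False using M_prime[OF M] X R_cnj by blast
  qed
  moreover have "Y * cnj Y = 2 ^ d * of_nat p ^ s"
  proof -
    have "Y * cnj Y = sg 2 (X * cnj X)" unfolding cY unfolding Y_def by (rule sg_mult[symmetric, OF coprime_2_N X(1) R_cnj[OF X(1)]])
    also have "X * cnj X = of_int (2 ^ d * int p ^ s)" by (simp add: X(3))
    finally show ?thesis unfolding sg_of_int[OF coprime_2_N] by simp
  qed
  ultimately obtain V where V: "V \<in> R" "V * cnj V = 1" "X = V * Y"
    using unimodular_quotient[OF M X YR] \<open>0 < d\<close> by blast
  define W where "W = V * X"
  have WR: "W \<in> R" using V X by (simp add: W_def R_closed)
  have "W * cnj W = (V * cnj V) * (X * cnj X)" by (simp add: W_def)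
  then have WW: "W * cnj W = 2 ^ d * of_nat p ^ s" unfolding V(2) X(3) by simp
  have "sg 2 W = sg 2 V * Y" unfolding W_def Y_def by (rule sg_mult[OF coprime_2_N V(1) X(1)])
  moreover have "V\<^sup>2 * Y = W" using V(3) by (simp add: W_def power2_eq_square)
  ultimately have "sg 2 W = W \<or> sg 2 W = - W" using sg_2_unimodular[OF V(1,2)] by auto
  moreover have "sg 2 W \<noteq> - W"
  proof
    assume "sg 2 W = - W"
    then have "sg (2 ^ ord N 2) W = of_int (-1) ^ ord N 2 * W" by (intro sg_2_power_eigen WR) simp
    then have "W = - W" using sg_2_power_ord[OF WR] odd_ord by simp
    then have "W = 0" by simp
    then show False using WW p_gt_1 by simp
  qed
  ultimately show ?thesis using WR WW by blast
qed

lemma int_of_sg_2_cnj_fixed: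
  assumes "X \<in> R" "sg 2 X = X" "cnj X = X"
  shows "X \<in> \<int>"
proof (rule int_of_invariant[OF assms(1)])
  fix k assume k: "k \<in> U"
  have f: "sg (2 ^ i) X = X" for i using sg_2_power_eigen[OF assms(1), of 1 i] assms(2) by simp
  obtain i where "[k = 2 ^ i] (mod N) \<or> [k = (N - 1) * 2 ^ i] (mod N)" using U_eq_signed_powers_of_2[OF k] by blast
  then show "sg k X = X"
  proof
    assume "[k = 2 ^ i] (mod N)"
    then show ?thesis using sg_cong f by metis
  next
    assume k: "[k = (N - 1) * 2 ^ i] (mod N)"
    have "sg k X = sg (2 ^ i) (cnj X)"
      unfolding cnj_eq_sg[OF assms(1)] sg_cong[OF k] by (rule sg_sg[symmetric, OF coprime_2_power_N coprime_N_minus_1 assms(1)])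
    then show ?thesis using f assms(3) by simp
  qed
qed

text \<open>With the Gaussian period \<open>T\<close> over the powers of 2 modulo \<open>p\<close>, the Gauss sum is \<open>T - cnj T\<close>. The values
  \<open>T + cnj T = - 1\<close> and \<open>T * cnj T = (p + 1) / 4\<close> come from orthogonality and Parseval over the \<open>Tk\<close>, each of
  which is \<open>T\<close> or \<open>cnj T\<close> for \<open>k \<noteq> 0\<close>.\<close>

lemma ex_sqrt_minus_p:
  "\<exists>S\<in>R. S\<^sup>2 = - of_nat p \<and> sg 2 S = S \<and> cnj S = - S"
proof -
  define h where "h = ord p 2"
  have ph: "p = 2 * h + 1" using ord_p_two p_gt_1 by (simp add: h_def)
  define y where "y = z ^ m"
  have yR: "y \<in> R" by (simp add: y_def R_closed)
  have y1: "y ^ i = 1 \<longleftrightarrow> p dvd i" for i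
    unfolding y_def power_mult[symmetric] z_power_eq_1_iff using m_pos by (simp add: N_eq mult.commute)
  have p0: "0 < p" using p_gt_1 by simp
  have yeq: "y ^ i = y ^ j \<longleftrightarrow> i mod p = j mod p" for i j by (rule power_eq_power_iff_root_unity[OF p0 y1])
  have ycnj: "y * cnj y = 1" using z_mult_cnj unfolding y_def by (metis complex_cnj_power power_mult_distrib power_one)
  define Tk where "Tk = (\<lambda>k. \<Sum>i<h. (y ^ (2 ^ i)) ^ k)"
  define T where "T = Tk 1"
  have TR: "T \<in> R" unfolding T_def Tk_def by (intro R_closed yR)
  have sgy: "sg k y = y ^ k" if "coprime k N" for k
    unfolding y_def by (simp add: sg_power[OF that R_z] sg_z[OF that] power_mult[symmetric] mult.commute)
  have sgT: "sg k T = Tk k" if "coprime k N" for k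
  proof -
    have "sg k T = (\<Sum>i<h. sg k (y ^ 2 ^ i))" unfolding T_def Tk_def power_one_right by (rule sg_sum[OF that]) (intro R_closed yR)
    also have "\<dots> = (\<Sum>i<h. (y ^ k) ^ 2 ^ i)" by (simp add: sg_power[OF that yR] sgy[OF that])
    finally show ?thesis by (simp add: Tk_def power_mult[symmetric] mult.commute)
  qed
  have "coprime p 2" using p_odd by simp
  then have inj: "inj_on (\<lambda>i. 2 ^ i mod p) {..<h}" unfolding h_def by (rule inj_power_mod)
  have sT: "sg 2 T = T"
  proof -
    have "sg 2 T = (\<Sum>i<h. y ^ (2 ^ Suc i))" unfolding sgT[OF coprime_2_N] Tk_def by (simp add: power_mult[symmetric] mult.commute)
    moreover have "y ^ 2 ^ 0 + (\<Sum>i<h. y ^ (2 ^ Suc i)) = (\<Sum>i<Suc h. y ^ 2 ^ i)"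
      by (rule sum.lessThan_Suc_shift[symmetric])
    moreover have "(\<Sum>i<Suc h. y ^ 2 ^ i) = T + y ^ 2 ^ h" by (simp add: T_def Tk_def)
    moreover have "y ^ 2 ^ h = y ^ 2 ^ 0" using ord[of 2 p] unfolding yeq cong_def h_def by simp
    ultimately show ?thesis by (metis add.commute add_left_imp_eq)
  qed
  have Tk: "Tk k = T \<or> Tk k = cnj T" if "k \<in> {1..<p}" for k
  proof -
    have "\<not> p dvd k" using that by (auto dest: dvd_imp_le)
    moreover have "k < N" using that unfolding N_eq using m_pos by (auto intro: less_le_trans)
    ultimately have kU: "k \<in> U" by (simp add: U_def coprime_N_iff)
    then have kc: "coprime k N" by (simp add: U_def)
    have f: "sg (2 ^ i) T = T" for i using sg_2_power_eigen[OF TR, of 1 i] sT by simp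
    obtain i where "[k = 2 ^ i] (mod N) \<or> [k = (N - 1) * 2 ^ i] (mod N)" using U_eq_signed_powers_of_2[OF kU] by blast
    then show ?thesis
    proof
      assume "[k = 2 ^ i] (mod N)"
      then have "sg k T = T" using sg_cong f by metis
      then show ?thesis using sgT[OF kc] by simp
    next
      assume k: "[k = (N - 1) * 2 ^ i] (mod N)"
      have "sg k T = sg (2 ^ i) (cnj T)"
        unfolding cnj_eq_sg[OF TR] sg_cong[OF k] by (rule sg_sg[symmetric, OF coprime_2_power_N coprime_N_minus_1 TR])
      also have "\<dots> = cnj T" using sg_cnj[OF coprime_2_power_N TR] f by simp
      finally show ?thesis using sgT[OF kc] by simp
    qed
  qed
  have T0: "Tk 0 = of_nat h" by (simp add: Tk_def)
  have "{..<p} = insert 0 {1..<p}" using p0 by auto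
  then have split: "(\<Sum>k<p. g k) = g 0 + (\<Sum>k\<in>{1..<p}. g k)" for g :: "nat \<Rightarrow> complex" by simp
  have ord_sum: "(\<Sum>k<p. (y ^ i * cnj y ^ j) ^ k) = (if i mod p = j mod p then of_nat p else 0)" for i j
  proof -
    have "(y ^ i * cnj y ^ j) ^ p = (y ^ p) ^ i * cnj (y ^ p) ^ j" by (simp add: power_mult_distrib power_mult[symmetric] mult.commute)
    moreover have "y ^ p = 1" by (simp add: y1)
    ultimately have "(y ^ i * cnj y ^ j) ^ p = 1" by simp
    moreover have "y ^ i * cnj y ^ j = 1 \<longleftrightarrow> y ^ i = y ^ j"
    proof -
      have yj: "y ^ j * cnj y ^ j = 1" using ycnj by (metis power_mult_distrib power_one)
      then have "cnj y ^ j \<noteq> 0" by (metis mult_zero_right zero_neq_one)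
      then show ?thesis using yj by (metis mult_right_cancel)
    qed
    ultimately show ?thesis using sum_powers_root_unity[of "y ^ i * cnj y ^ j" p] yeq by auto
  qed
  have "(\<Sum>k<p. Tk k) = (\<Sum>i<h. \<Sum>k<p. (y ^ (2 ^ i)) ^ k)" unfolding Tk_def by (rule sum.swap)
  also have "\<dots> = 0"
  proof (rule sum.neutral, intro ballI)
    fix i :: nat
    have "\<not> p dvd 2 ^ i" using prime_p p_odd by (metis even_mult_iff primes_dvd_imp_eq prime_dvd_power two_is_prime_nat even_numeral)
    then have "2 ^ i mod p \<noteq> 0 mod p" by (simp add: dvd_eq_mod_eq_0)
    then show "(\<Sum>k<p. (y ^ (2 ^ i)) ^ k) = 0" using ord_sum[of "2 ^ i" 0] by simp
  qed
  finally have s0: "(\<Sum>k\<in>{1..<p}. Tk k) = - of_nat h" unfolding split T0 by (simp add: eq_neg_iff_add_eq_0 add.commute)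
  \<comment> \<open>Adding the conjugate makes the summand the same whether \<open>Tk k\<close> is
    \<open>T\<close> or \<open>cnj T\<close>.\<close>
  have "(\<Sum>k\<in>{1..<p}. T + cnj T) = (\<Sum>k\<in>{1..<p}. Tk k + cnj (Tk k))"
    by (rule sum.cong) (use Tk in fastforce)+
  also have "\<dots> = (\<Sum>k\<in>{1..<p}. Tk k) + cnj (\<Sum>k\<in>{1..<p}. Tk k)" by (simp add: sum.distrib)
  also have "\<dots> = of_nat (p - 1) * (- 1)" unfolding s0 using ph by simp
  finally have "of_nat (p - 1) * (T + cnj T) = of_nat (p - 1) * (- 1)" by simp
  then have sumT: "T + cnj T = -1" using p_gt_1 by (simp only: mult_cancel_left) simp
  have "(\<Sum>k<p. Tk k * cnj (Tk k)) = (\<Sum>k<p. \<Sum>i<h. \<Sum>j<h. (y ^ (2 ^ i) * cnj y ^ (2 ^ j)) ^ k)"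
    by (simp add: Tk_def sum_product power_mult_distrib)
  also have "\<dots> = (\<Sum>i<h. \<Sum>k<p. \<Sum>j<h. (y ^ (2 ^ i) * cnj y ^ (2 ^ j)) ^ k)" by (rule sum.swap)
  also have "\<dots> = (\<Sum>i<h. \<Sum>j<h. \<Sum>k<p. (y ^ (2 ^ i) * cnj y ^ (2 ^ j)) ^ k)"
    by (rule sum.cong[OF refl]) (rule sum.swap)
  \<comment> \<open>The powers \<open>2 ^ i\<close> with \<open>i < h\<close> are distinct modulo
    \<open>p\<close>, so only the diagonal survives.\<close>
  also have "\<dots> = (\<Sum>i<h. \<Sum>j<h. if i = j then of_nat p else 0)"
    unfolding ord_sum by (intro sum.cong refl) (use inj in \<open>auto simp: inj_on_def\<close>)
  also have "\<dots> = of_nat (h * p)" by simp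
  finally have "of_nat h * of_nat h + (\<Sum>k\<in>{1..<p}. Tk k * cnj (Tk k)) = of_nat (h * p)" unfolding split T0 by simp
  moreover have "(\<Sum>k\<in>{1..<p}. Tk k * cnj (Tk k)) = (\<Sum>k\<in>{1..<p}. T * cnj T)"
    by (rule sum.cong) (use Tk in fastforce)+
  ultimately have "of_nat h * of_nat h + of_nat (2 * h) * (T * cnj T) = of_nat (h * p)" using ph by simp
  then have "of_nat h * (2 * (T * cnj T)) = of_nat h * (of_nat h + 1)" unfolding ph by (simp add: algebra_simps)
  moreover have "h \<noteq> 0" using ph p_odd p_mod_8 by (cases "h = 0") auto
  ultimately have "2 * (T * cnj T) = of_nat h + 1" by simp
  then have "4 * (T * cnj T) = 2 * (of_nat h + 1)" by (metis mult.assoc mult_2_right numeral_Bit0 mult_2)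
  then have "4 * (T * cnj T) = of_nat p + 1" unfolding ph by simp
  moreover have "(T - cnj T)\<^sup>2 = (T + cnj T)\<^sup>2 - 4 * (T * cnj T)" by (simp add: power2_eq_square algebra_simps)
  ultimately have "(T - cnj T)\<^sup>2 = - of_nat p" by (simp add: sumT)
  moreover have "sg 2 (T - cnj T) = T - cnj T"
    unfolding sg_diff[OF coprime_2_N TR R_cnj[OF TR]] sg_cnj[OF coprime_2_N TR] sT ..
  moreover have "cnj (T - cnj T) = - (T - cnj T)" by simp
  moreover have "T - cnj T \<in> R" using TR by (simp add: R_closed)
  ultimately show ?thesis by blast
qed

text \<open>\<open>W + cnj W\<close> and \<open>(W - cnj W) * S\<close> are fixed by Frobenius and
  conjugation, hence integers. The square of the second is divisible by \<open>p\<close>, and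
  dividing it by \<open>p\<close> yields \<open>a\<close>.\<close>

lemma form_value_of_sg_2_fixed:
  assumes "W \<in> R" "sg 2 W = W" "W * cnj W = of_int n"
  shows "\<exists>a b. b\<^sup>2 + int p * a\<^sup>2 = 4 * n"
proof -
  obtain S where S: "S \<in> R" "S\<^sup>2 = - of_nat p" "sg 2 S = S" "cnj S = - S" using ex_sqrt_minus_p by blast
  have sc: "sg 2 (cnj W) = cnj W" using sg_cnj[OF coprime_2_N assms(1)] assms(2) by simp
  have "W + cnj W \<in> \<int>"
    by (rule int_of_sg_2_cnj_fixed)
      (use assms sc in \<open>simp_all add: R_closed sg_add[OF coprime_2_N] add.commute\<close>)
  then obtain b where b: "W + cnj W = of_int b" by (auto elim: Ints_cases)
  have "(W - cnj W) * S \<in> \<int>"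
    by (rule int_of_sg_2_cnj_fixed)
      (use assms sc S in \<open>simp_all add: R_closed sg_mult[OF coprime_2_N] sg_diff[OF coprime_2_N] algebra_simps\<close>)
  then obtain a' where a': "(W - cnj W) * S = of_int a'" by (auto elim: Ints_cases)
  have "of_int (a'\<^sup>2) = (W - cnj W)\<^sup>2 * S\<^sup>2" using a' by (metis of_int_power power_mult_distrib)
  also have "(W - cnj W)\<^sup>2 = (W + cnj W)\<^sup>2 - 4 * (W * cnj W)" by (simp add: power2_eq_square algebra_simps)
  also have "((W + cnj W)\<^sup>2 - 4 * (W * cnj W)) * S\<^sup>2 = of_int (int p * (4 * n - b\<^sup>2))"
    unfolding b assms(3) S(2) by (simp add: algebra_simps)
  finally have eq: "a'\<^sup>2 = int p * (4 * n - b\<^sup>2)" by (simp only: of_int_eq_iff)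
  then have "int p dvd a'\<^sup>2" by simp
  then have "int p dvd a'" using prime_p by (metis prime_dvd_power prime_nat_int_transfer)
  then obtain a where "a' = int p * a" by blast
  then have "int p * (int p * a\<^sup>2) = int p * (4 * n - b\<^sup>2)" using eq by (simp add: power2_eq_square algebra_simps)
  then have "int p * a\<^sup>2 = 4 * n - b\<^sup>2" using p_gt_1 by (simp only: mult_cancel_left) simp
  then show ?thesis by (intro exI[of _ a] exI[of _ b]) simp
qed

text \<open>The strict bound for \<open>X\<close> divisible by 2 serves the minimal exponent: there
  it shows that 2 does not divide \<open>X\<close>.\<close>

lemma odd_rep_of_norm_value:
  assumes "X \<in> R" "X * cnj X = 2 ^ d * of_nat p ^ s" "odd d"
  shows "\<exists>d'>0. odd_rep p d' \<and> d' \<le> d \<and> ((\<exists>r\<in>R. X = 2 * r) \<longrightarrow> d' < d)"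
  using assms
proof (induction d arbitrary: X rule: less_induct)
  case (less d)
  have d0: "0 < d" using less.prems(3) by (auto intro: Nat.gr0I)
  show ?case
  proof (cases "\<exists>r\<in>R. X = 2 * r")
    case True
    then obtain r where r: "r \<in> R" "X = 2 * r" by blast
    have e: "4 * (r * cnj r) = 2 ^ d * of_nat p ^ s" using less.prems(2) by (simp add: r)
    have "d \<noteq> 1"
    proof
      assume "d = 1"
      then have "of_int 4 * (r * cnj r) = of_int (2 * int p ^ s)" using e by simp
      then have "4 dvd 2 * int p ^ s" using int_dvd_of_R_dvd[of "r * cnj r" 4] r R_closed by simp
      then have "2 * 2 dvd 2 * int p ^ s" by simp
      then have "even (int p ^ s)" by (subst (asm) dvd_times_left_cancel_iff) auto
      then show False using p_odd by simp
    qed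
    then have d: "d = (d - 2) + 2" "odd (d - 2)" using less.prems(3) by (auto elim!: oddE)
    have "(2::complex) ^ d = 4 * 2 ^ (d - 2)" by (subst d(1)) (simp add: power_add)
    then have "4 * (r * cnj r) = 4 * (2 ^ (d - 2) * of_nat p ^ s)" using e by simp
    then have "r * cnj r = 2 ^ (d - 2) * of_nat p ^ s" by (simp only: mult_cancel_left) simp
    then have "\<exists>d'>0. odd_rep p d' \<and> d' \<le> d - 2 \<and> ((\<exists>r'\<in>R. r = 2 * r') \<longrightarrow> d' < d - 2)"
      using less.IH[of "d - 2" r] d r(1) d0 by simp
    then obtain d' where "0 < d'" "odd_rep p d'" "d' \<le> d - 2" by blast
    then show ?thesis using d0 by (intro exI[of _ d']) auto
  next
    case False
    obtain M where M: "is_prime_ideal R M" "2 \<in> M" by (rule ex_prime_ideal_above_2)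
    have "X \<notin> M \<or> cnj X \<notin> M" using M_inter_cnj[OF M] False by blast
    then obtain W where W: "W \<in> R" "W * cnj W = 2 ^ d * of_nat p ^ s" "sg 2 W = W"
    proof
      assume "cnj X \<notin> M"
      then show ?thesis using ex_sg_2_fixed[OF M less.prems(1) _ less.prems(2) d0] that by blast
    next
      assume "X \<notin> M"
      then have "cnj (cnj X) \<notin> M" by simp
      moreover have "cnj X * cnj (cnj X) = 2 ^ d * of_nat p ^ s" using less.prems(2) by (simp add: mult.commute)
      ultimately show ?thesis using ex_sg_2_fixed[OF M R_cnj[OF less.prems(1)] _ _ d0] that by blast
    qed
    have "W * cnj W = of_int (2 ^ d * int p ^ s)" using W(2) by simp
    then obtain a b where "b\<^sup>2 + int p * a\<^sup>2 = 4 * (2 ^ d * int p ^ s)"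
      using form_value_of_sg_2_fixed[OF W(1,3)] by blast
    then have "b\<^sup>2 + int p * a\<^sup>2 = 2 ^ (d + 2) * int p ^ s" by simp
    then obtain x y where "x\<^sup>2 + int p * y\<^sup>2 = 2 ^ (d + 2)" using remove_prime_from_form_value[OF prime_p] by blast
    moreover have "2 < p" using p_mod_8 by (cases "p < 7") auto
    ultimately show ?thesis using odd_rep_of_odd_exponent[OF p_odd _ less.prems(3)] False by blast
  qed
qed

text \<open>With \<open>X = V * Y\<close> the congruence makes \<open>cnj V\<close> equal to 1
  modulo \<open>M\<close>, and multiplication by its inverse \<open>V\<close> does the same for
  \<open>V\<close>. So \<open>V\<close> is 1 modulo 2, and Kronecker's argument applies.\<close>

theorem eq_or_eq_neg_of_cong_mod_2:
  assumes "X \<in> R" "X * cnj X = 2 ^ t * of_nat p ^ s" "Y \<in> R" "Y * cnj Y = 2 ^ t * of_nat p ^ s"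
    and "r \<in> R" "X - Y = 2 * r" "odd t" and min: "\<And>d. 0 < d \<Longrightarrow> odd_rep p d \<Longrightarrow> t \<le> d"
  shows "X = Y \<or> X = - Y"
proof -
  have t0: "0 < t" using assms(7) by (auto intro: Nat.gr0I)
  have X2: "\<not> (\<exists>r\<in>R. X = 2 * r)" using odd_rep_of_norm_value[OF assms(1,2,7)] min by (metis leD)
  obtain M where M: "is_prime_ideal R M" "2 \<in> M" by (rule ex_prime_ideal_above_2)
  have main: "X = Y \<or> X = - Y"
    if X: "X \<in> R" "X * cnj X = 2 ^ t * of_nat p ^ s" and Y: "Y \<in> R" "Y * cnj Y = 2 ^ t * of_nat p ^ s"
      and r: "r \<in> R" "X - Y = 2 * r" and XM: "cnj X \<notin> M" for X Y r
  proof -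
    have "cnj X - cnj Y = 2 * cnj r" using r(2) by (metis complex_cnj_diff complex_cnj_mult complex_cnj_numeral)
    then have cXY: "cnj X = cnj Y + 2 * cnj r" by (simp add: algebra_simps)
    then have YM: "cnj Y \<notin> M" using XM M_add[OF M _ M_even[OF M R_cnj[OF r(1)]], of "cnj Y"] by auto
    obtain V where V: "V \<in> R" "V * cnj V = 1" "X = V * Y"
      using unimodular_quotient[OF M X(1) XM X(2) Y(1) YM Y(2) t0] by blast
    have "(cnj V - 1) * cnj Y = 2 * cnj r" using cXY by (simp add: V(3) algebra_simps)
    then have "(cnj V - 1) * cnj Y \<in> M" using M_even[OF M R_cnj[OF r(1)]] by simp
    then have 1: "cnj V - 1 \<in> M" using M_prime[OF M, of "cnj V - 1" "cnj Y"] YM V(1) Y(1) by (simp add: R_closed)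
    have "- V * (cnj V - 1) \<in> M" using M_mult[OF M _ 1, of "- V"] V(1) by (simp add: R_closed)
    then have 2: "V - 1 \<in> M" using V(2) by (simp add: algebra_simps)
    have "cnj (V - 1) \<in> M" using 1 by simp
    then obtain q where "q \<in> R" "V - 1 = 2 * q" using M_inter_cnj[OF M 2] by blast
    then have "V = 1 \<or> V = -1" using unimodular_cong_1_mod_2[OF V(1,2)] by blast
    then show ?thesis using V(3) by auto
  qed
  have "X \<notin> M \<or> cnj X \<notin> M" using M_inter_cnj[OF M] X2 by blast
  then show ?thesis
  proof
    assume "cnj X \<notin> M"
    then show ?thesis using main[OF assms(1-6)] by blast
  next
    assume "X \<notin> M"
    then have "cnj (cnj X) \<notin> M" by simp
    moreover have "cnj X * cnj (cnj X) = 2 ^ t * of_nat p ^ s" "cnj Y * cnj (cnj Y) = 2 ^ t * of_nat p ^ s"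
      using assms by (simp_all add: mult.commute)
    moreover have "cnj X - cnj Y = 2 * cnj r" using assms(6) by (metis complex_cnj_diff complex_cnj_mult complex_cnj_numeral)
    ultimately have "cnj X = cnj Y \<or> cnj X = - cnj Y"
      using main[of "cnj X" "cnj Y" "cnj r"] assms R_cnj by blast
    then show ?thesis by (metis complex_cnj_cnj complex_cnj_minus)
  qed
qed

end

section \<open>Generalized bent functions\<close>

text \<open>With natural exponents the inverse root of unity can be replaced by its conjugate, and
  every term stays in \<open>R\<close>.\<close>

definition dotn :: "nat \<Rightarrow> (nat \<Rightarrow> nat) \<Rightarrow> (nat \<Rightarrow> nat) \<Rightarrow> nat" where
  "dotn n x l = (\<Sum>i<n. x i * l i)"

lemma Zqn_0: "Zqn 0 q = {\<lambda>_. 0}"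
  by (auto simp: Zqn_def)

lemma Zqn_Suc: "Zqn (Suc n) q = (\<lambda>(l, k). l(n := k)) ` (Zqn n q \<times> {..<q})"
proof (intro equalityI subsetI)
  fix l assume l: "l \<in> Zqn (Suc n) q"
  have "l = (\<lambda>(l, k). l(n := k)) (l(n := 0), l n)" by auto
  moreover have "l(n := 0) \<in> Zqn n q" "l n \<in> {..<q}" using l by (auto simp: Zqn_def)
  ultimately show "l \<in> (\<lambda>(l, k). l(n := k)) ` (Zqn n q \<times> {..<q})" by blast
next
  fix l assume "l \<in> (\<lambda>(l, k). l(n := k)) ` (Zqn n q \<times> {..<q})"
  then show "l \<in> Zqn (Suc n) q" by (auto simp: Zqn_def)
qed

lemma inj_on_Zqn_Suc: "inj_on (\<lambda>(l, k). l(n := k)) (Zqn n q \<times> {..<q})"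
proof (rule inj_onI, clarify)
  fix l k l' k' assume *: "l \<in> Zqn n q" "l' \<in> Zqn n q" "l(n := k) = l'(n := k')"
  then have "l n = 0" "l' n = 0" by (auto simp: Zqn_def)
  then have "l = (l(n := k))(n := 0)" "l' = (l'(n := k'))(n := 0)" by auto
  then have "l = l'" using *(3) by metis
  moreover have "k = k'" using *(3) by (metis fun_upd_same)
  ultimately show "l = l' \<and> k = k'" by blast
qed

lemma finite_Zqn: "finite (Zqn n q)"
  by (induction n) (simp_all add: Zqn_0 Zqn_Suc)

text \<open>Splits a character sum over vectors into one-dimensional geometric sums.\<close>

lemma sum_Zqn_prod:
  "(\<Sum>l\<in>Zqn n q. \<Prod>i<n. h i (l i)) = (\<Prod>i<n. \<Sum>k<q. h i k :: 'a :: comm_semiring_1)"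
proof (induction n)
  case 0
  then show ?case by (simp add: Zqn_0)
next
  case (Suc n)
  have "(\<Sum>l\<in>Zqn (Suc n) q. \<Prod>i<Suc n. h i (l i)) =
      (\<Sum>(l, k)\<in>Zqn n q \<times> {..<q}. \<Prod>i<Suc n. h i ((l(n := k)) i))"
    unfolding Zqn_Suc by (subst sum.reindex[OF inj_on_Zqn_Suc]) (simp add: case_prod_beta comp_def)
  also have "\<dots> = (\<Sum>(l, k)\<in>Zqn n q \<times> {..<q}. (\<Prod>i<n. h i (l i)) * h n k)"
    by (intro sum.cong refl) (auto intro!: arg_cong2[where f = "(*)"] prod.cong)
  also have "\<dots> = (\<Sum>l\<in>Zqn n q. \<Prod>i<n. h i (l i)) * (\<Sum>k<q. h n k)"
    by (simp add: sum_product sum.cartesian_product)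
  finally show ?case by (simp add: Suc)
qed

lemma card_Zqn: "card (Zqn n q) = q ^ n"
  using sum_Zqn_prod[where h = "\<lambda>_ _. 1 :: nat" and n = n and q = q] by simp

lemma power_dotn: "(y :: complex) ^ dotn n x l = (\<Prod>i<n. (y ^ x i) ^ l i)"
  by (simp add: dotn_def power_sum power_mult)

lemma zeta_mult_cnj: "zeta q * cnj (zeta q) = 1"
  by (simp add: zeta_def exp_cnj exp_add[symmetric])

lemma walsh_altdef: "walsh n q f l = (\<Sum>x\<in>Zqn n q. zeta q ^ f x * cnj (zeta q) ^ dotn n x l)"
proof -
  have "inverse (zeta q) = cnj (zeta q)" using zeta_mult_cnj by (metis inverse_unique)
  moreover have "dotp n x l = int (dotn n x l)" for x by (simp add: dotp_def dotn_def)
  ultimately have "zeta q powi (- dotp n x l) = cnj (zeta q) ^ dotn n x l" for x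
    by (simp add: power_int_minus power_inverse[symmetric])
  then show ?thesis by (simp add: walsh_def)
qed

text \<open>The exponent of 2 in a square is even, so an odd exponent leaves room for one more
  factor.\<close>

lemma two_power_dvd_square:
  fixes k :: int assumes "odd n" "2 ^ n dvd k\<^sup>2"
  shows "2 ^ Suc n dvd k\<^sup>2"
proof -
  obtain j where j: "n = 2 * j + 1" using assms(1) by (rule oddE)
  have sq: "(2::int) ^ (2 * j) = (2 ^ j)\<^sup>2" by (simp add: power_mult[symmetric] mult.commute)
  have "(2 ^ j)\<^sup>2 dvd k\<^sup>2" using assms(2) unfolding sq[symmetric] j by (metis dvd_mult_left power_add)
  then have "2 ^ j dvd k" by (subst (asm) pow_divides_pow_iff) auto
  then obtain k' where k': "k = 2 ^ j * k'" by blast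
  have "2 ^ (2 * j) * 2 dvd 2 ^ (2 * j) * k'\<^sup>2" using assms(2) unfolding sq j k' by (simp add: power_mult_distrib sq)
  then have "even k'" by simp
  then obtain i where "k' = 2 * i" by blast
  then have "k\<^sup>2 = 2 ^ Suc n * i\<^sup>2" by (simp add: k' j power_mult_distrib sq)
  then show ?thesis by simp
qed

context two_half_order
begin

text \<open>Since \<open>N\<close> is odd, \<open>zeta (2 * N)\<close> is minus a power of
  \<open>z\<close>, and the values of the transform lie in \<open>R\<close>.\<close>

lemma zeta_double:
  shows zeta_double_square: "zeta (2 * N) ^ 2 = z"
    and zeta_double_power_N: "zeta (2 * N) ^ N = -1"
    and zeta_double_R: "zeta (2 * N) \<in> R"
proof -
  show sq: "zeta (2 * N) ^ 2 = z"
    unfolding z_def zeta_def using N_pos by (simp add: mult.assoc flip: exp_of_nat_mult)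
  have "(zeta (2 * N) ^ N) ^ 2 = 1" using zeta_power_eq_1_iff[of "2 * N" "N * 2"] N_pos by (simp add: power_mult[symmetric] mult.commute)
  moreover have "zeta (2 * N) ^ N \<noteq> 1" using zeta_power_eq_1_iff[of "2 * N" N] N_pos by (auto dest: dvd_imp_le)
  ultimately show m1: "zeta (2 * N) ^ N = -1" by (simp add: power2_eq_1_iff)
  obtain h where h: "N = 2 * h + 1" using N_odd by (rule oddE)
  have "z ^ Suc h = zeta (2 * N) ^ (N + 1)" unfolding sq[symmetric] power_mult[symmetric] by (simp add: h)
  then have "zeta (2 * N) = - (z ^ Suc h)" using m1 by simp
  then show "zeta (2 * N) \<in> R" by (simp add: R_closed del: power_Suc)
qed

lemma sum_z_power_dotn:
  "(\<Sum>l\<in>Zqn n N. cnj z ^ dotn n x l * z ^ dotn n y l) = (if \<forall>i<n. x i mod N = y i mod N then of_nat N ^ n else 0)"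
proof -
  have "(\<Sum>l\<in>Zqn n N. cnj z ^ dotn n x l * z ^ dotn n y l) = (\<Sum>l\<in>Zqn n N. \<Prod>i<n. (cnj z ^ x i * z ^ y i) ^ l i)"
    by (simp add: power_dotn power_mult_distrib prod.distrib)
  also have "\<dots> = (\<Prod>i<n. \<Sum>k<N. (cnj z ^ x i * z ^ y i) ^ k)" by (rule sum_Zqn_prod)
  also have "\<dots> = (\<Prod>i<n. if x i mod N = y i mod N then of_nat N else 0)"
  proof (rule prod.cong[OF refl])
    fix i
    have "(cnj z ^ x i * z ^ y i) ^ N = cnj (z ^ N) ^ x i * (z ^ N) ^ y i"
      by (simp add: power_mult_distrib power_mult[symmetric] mult.commute)
    then have 1: "(cnj z ^ x i * z ^ y i) ^ N = 1" by (simp add: z_power_N)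
    have zx: "z ^ x i * cnj z ^ x i = 1" using z_mult_cnj by (metis power_mult_distrib power_one)
    have "cnj z ^ x i * z ^ y i = 1 \<longleftrightarrow> z ^ x i = z ^ y i"
      using zx by (metis mult.assoc mult.commute mult.right_neutral)
    then show "(\<Sum>k<N. (cnj z ^ x i * z ^ y i) ^ k) = (if x i mod N = y i mod N then of_nat N else 0)"
      using sum_powers_root_unity[OF 1] z_power_eq_iff by auto
  qed
  also have "\<dots> = (if \<forall>i<n. x i mod N = y i mod N then of_nat N ^ n else 0)"
    using N_pos by (auto simp: prod_zero_iff)
  finally show ?thesis .
qed

lemma sum_sign_dotn:
  "(\<Sum>l\<in>Zqn n 2. (-1) ^ dotn n x l) = (if \<forall>i<n. even (x i) then 2 ^ n else 0 :: complex)"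
proof -
  have "(\<Sum>l\<in>Zqn n 2. (-1) ^ dotn n x l) = (\<Prod>i<n. \<Sum>k<2. ((-1 :: complex) ^ x i) ^ k)"
    unfolding power_dotn by (rule sum_Zqn_prod)
  also have "\<dots> = (\<Prod>i<n. if even (x i) then 2 else 0)"
    by (rule prod.cong) (auto simp: numeral_2_eq_2)
  also have "\<dots> = (if \<forall>i<n. even (x i) then 2 ^ n else 0)" by (auto simp: prod_zero_iff)
  finally show ?thesis .
qed

theorem no_GBF:
  assumes "odd n" and min: "\<And>d. 0 < d \<Longrightarrow> odd_rep p d \<Longrightarrow> n \<le> d"
  shows "\<not> is_GBF n (2 * N) f"
proof
  assume gbf: "is_GBF n (2 * N) f"
  define F where "F = walsh n (2 * N) f"
  define v where "v = zeta (2 * N)"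
  \<comment> \<open>The exponent of 2 equals the dimension \<open>n\<close>; this is where the
    minimality of \<open>n\<close> gets its grip.\<close>
  have FF: "F l * cnj (F l) = 2 ^ n * of_nat p ^ (e * n)" if "l \<in> Zqn n (2 * N)" for l
    using gbf that by (simp add: is_GBF_def F_def N_def power_mult_distrib power_mult)
  have F: "F l = (\<Sum>x\<in>Zqn n (2 * N). v ^ f x * cnj v ^ dotn n x l)" for l
    by (simp add: F_def v_def walsh_altdef)
  have vR: "v \<in> R" by (simp add: v_def zeta_double_R)
  have FR: "F l \<in> R" for l unfolding F by (intro R_closed vR)
  have vN: "cnj v ^ N = -1" using zeta_double_power_N unfolding v_def by (metis complex_cnj_minus complex_cnj_one complex_cnj_power)
  have v2: "cnj v ^ 2 = cnj z" using zeta_double_square unfolding v_def by (metis complex_cnj_power)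
  \<comment> \<open>As \<open>cnj v ^ N = -1\<close>, this shift changes each term of the transform
    by a sign only and thus preserves its class modulo 2.\<close>
  define sh where "sh = (\<lambda>(l :: nat \<Rightarrow> nat) u i. l i + N * u i)"
  have sh: "sh l u \<in> Zqn n (2 * N)" if "l \<in> Zqn n N" "u \<in> Zqn n 2" for l u
  proof -
    have "l i + N * u i < 2 * N" if "i < n" for i
    proof -
      have "l i < N" "u i < 2" using \<open>l \<in> Zqn n N\<close> \<open>u \<in> Zqn n 2\<close> that by (auto simp: Zqn_def)
      then have "u i = 0 \<or> u i = 1" by auto
      then show ?thesis using \<open>l i < N\<close> by auto
    qed
    then show ?thesis using that by (auto simp: Zqn_def sh_def)
  qed
  have Fsh: "F (sh l u) = (\<Sum>x\<in>Zqn n (2 * N). v ^ f x * cnj v ^ dotn n x l * (-1) ^ dotn n x u)" for l u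
  proof -
    have "dotn n x (sh l u) = dotn n x l + N * dotn n x u" for x
      by (simp add: dotn_def sh_def algebra_simps sum.distrib sum_distrib_left)
    then show ?thesis unfolding F by (simp add: power_add power_mult vN mult.assoc)
  qed
  have sign: "\<exists>b::int. F (sh l u) = of_int b * F l" if l: "l \<in> Zqn n N" "u \<in> Zqn n 2" for l u
  proof -
    \<comment> \<open>\<open>dotn n x u mod 2\<close> is half of
      \<open>1 - (-1) ^ dotn n x u\<close>.\<close>
    define r where "r = (\<Sum>x\<in>Zqn n (2 * N). v ^ f x * cnj v ^ dotn n x l * of_nat (dotn n x u mod 2))"
    have rR: "r \<in> R" unfolding r_def by (intro R_closed vR)
    have "F l - F (sh l u) = (\<Sum>x\<in>Zqn n (2 * N). v ^ f x * cnj v ^ dotn n x l * (1 - (-1) ^ dotn n x u))"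
      unfolding Fsh unfolding F by (simp add: sum_subtractf[symmetric] algebra_simps)
    also have "\<dots> = (\<Sum>x\<in>Zqn n (2 * N). 2 * (v ^ f x * cnj v ^ dotn n x l * of_nat (dotn n x u mod 2)))"
    proof (rule sum.cong[OF refl])
      fix x
      show "v ^ f x * cnj v ^ dotn n x l * (1 - (-1) ^ dotn n x u) = 2 * (v ^ f x * cnj v ^ dotn n x l * of_nat (dotn n x u mod 2))"
        by (cases "even (dotn n x u)") (simp_all add: odd_iff_mod_2_eq_one)
    qed
    also have "\<dots> = 2 * r" by (simp add: r_def sum_distrib_left)
    finally have "F l - F (sh l u) = 2 * r" .
    moreover have "l \<in> Zqn n (2 * N)" using l(1) by (auto simp: Zqn_def)
    ultimately have "F l = F (sh l u) \<or> F l = - F (sh l u)"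
      using eq_or_eq_neg_of_cong_mod_2[OF FR FF FR FF rR _ assms(1) min] sh[OF l] by blast
    then show ?thesis
    proof
      assume "F l = F (sh l u)"
      then show ?thesis by (intro exI[of _ 1]) simp
    next
      assume "F l = - F (sh l u)"
      then show ?thesis by (intro exI[of _ "-1"]) simp
    qed
  qed
  define G where "G = (\<lambda>l. \<Sum>y\<in>Zqn n N. v ^ f (\<lambda>i. 2 * y i) * cnj z ^ dotn n y l)"
  have GR: "G l \<in> R" for l unfolding G_def by (intro R_closed vR)
  \<comment> \<open>Orthogonality of signs discards every \<open>x\<close> with an odd coordinate;
    on the rest, \<open>cnj v ^ 2 = cnj z\<close> lowers the level from \<open>2 * N\<close> to
    \<open>N\<close>.\<close>
  have sumF: "(\<Sum>u\<in>Zqn n 2. F (sh l u)) = 2 ^ n * G l" for l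
  proof -
    define E where "E = {x \<in> Zqn n (2 * N). \<forall>i<n. even (x i)}"
    have E: "E = (\<lambda>y i. 2 * y i) ` Zqn n N"
    proof (intro equalityI subsetI)
      fix x assume x: "x \<in> E"
      have "x i = 2 * (x i div 2)" for i using x by (cases "i < n") (auto simp: E_def Zqn_def)
      then have "x = (\<lambda>y i. 2 * y i) (\<lambda>i. x i div 2)" by auto
      moreover have "(\<lambda>i. x i div 2) \<in> Zqn n N" using x by (auto simp: E_def Zqn_def)
      ultimately show "x \<in> (\<lambda>y i. 2 * y i) ` Zqn n N" by (rule image_eqI)
    qed (auto simp: E_def Zqn_def)
    have inj: "inj_on (\<lambda>y i. 2 * y i :: nat) (Zqn n N)"
      by (rule inj_onI) (auto simp: fun_eq_iff)
    have "(\<Sum>u\<in>Zqn n 2. F (sh l u)) =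
        (\<Sum>x\<in>Zqn n (2 * N). v ^ f x * cnj v ^ dotn n x l * (\<Sum>u\<in>Zqn n 2. (-1) ^ dotn n x u))"
      unfolding Fsh by (subst sum.swap) (simp add: sum_distrib_left)
    also have "\<dots> = (\<Sum>x\<in>Zqn n (2 * N). if \<forall>i<n. even (x i) then v ^ f x * cnj v ^ dotn n x l * 2 ^ n else 0)"
      unfolding sum_sign_dotn by (intro sum.cong refl) auto
    also have "\<dots> = (\<Sum>x\<in>E. v ^ f x * cnj v ^ dotn n x l * 2 ^ n)"
      unfolding E_def by (rule sum.inter_filter[symmetric, OF finite_Zqn])
    also have "\<dots> = (\<Sum>y\<in>Zqn n N. v ^ f (\<lambda>i. 2 * y i) * cnj v ^ dotn n (\<lambda>i. 2 * y i) l * 2 ^ n)"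
      unfolding E by (subst sum.reindex[OF inj]) simp
    also have "\<dots> = 2 ^ n * G l"
    proof -
      have "cnj v ^ dotn n (\<lambda>i. 2 * y i) l = cnj z ^ dotn n y l" for y
      proof -
        have "dotn n (\<lambda>i. 2 * y i) l = 2 * dotn n y l" by (simp add: dotn_def sum_distrib_left mult.assoc)
        then show ?thesis by (simp add: power_mult v2)
      qed
      then show ?thesis by (simp add: G_def sum_distrib_left mult.commute)
    qed
    finally show ?thesis .
  qed
  have "\<exists>b::int. G l * cnj (G l) = of_int (2 * b)" if l: "l \<in> Zqn n N" for l
  proof -
    have "\<forall>u\<in>Zqn n 2. \<exists>b::int. F (sh l u) = of_int b * F l" using sign l by blast
    then obtain b :: "(nat \<Rightarrow> nat) \<Rightarrow> int" where b: "\<And>u. u \<in> Zqn n 2 \<Longrightarrow> F (sh l u) = of_int (b u) * F l" by metis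
    define k where "k = (\<Sum>u\<in>Zqn n 2. b u)"
    have "2 ^ n * G l = (\<Sum>u\<in>Zqn n 2. of_int (b u) * F l)" unfolding sumF[symmetric] using b by (intro sum.cong) auto
    also have "\<dots> = of_int k * F l" by (simp add: k_def sum_distrib_right)
    finally have kF: "2 ^ n * G l = of_int k * F l" .
    have lq: "l \<in> Zqn n (2 * N)" using l by (auto simp: Zqn_def)
    have "2 ^ n * 2 ^ n * (G l * cnj (G l)) = (2 ^ n * G l) * cnj (2 ^ n * G l)" by simp
    also have "\<dots> = of_int (k\<^sup>2) * (F l * cnj (F l))" unfolding kF by (simp add: power2_eq_square)
    also have "\<dots> = 2 ^ n * of_int (k\<^sup>2 * int N ^ n)" unfolding FF[OF lq] by (simp add: N_def power_mult)
    finally have "2 ^ n * (2 ^ n * (G l * cnj (G l))) = 2 ^ n * of_int (k\<^sup>2 * int N ^ n)" by (simp only: mult.assoc)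
    then have "2 ^ n * (G l * cnj (G l)) = of_int (k\<^sup>2 * int N ^ n)" by (simp only: mult_cancel_left) simp
    then have GG: "of_int (2 ^ n) * (G l * cnj (G l)) = of_int (k\<^sup>2 * int N ^ n)" by simp
    have "G l * cnj (G l) \<in> R" using GR by (intro R_closed)
    then have "2 ^ n dvd k\<^sup>2 * int N ^ n" using int_dvd_of_R_dvd[OF _ GG] by simp
    moreover have "coprime (2 ^ n) (int N ^ n)" using N_odd by simp
    ultimately have "2 ^ n dvd k\<^sup>2" by (metis coprime_dvd_mult_left_iff)
    \<comment> \<open>The extra factor gained from odd \<open>n\<close> is what makes the squared
      modulus of \<open>G l\<close> even.\<close>
    then have "2 ^ Suc n dvd k\<^sup>2" by (rule two_power_dvd_square[OF assms(1)])
    then obtain a where "k\<^sup>2 = 2 ^ Suc n * a" by blast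
    then have "2 ^ n * (G l * cnj (G l)) = 2 ^ n * of_int (2 * (a * int N ^ n))" using GG by simp
    then have "G l * cnj (G l) = of_int (2 * (a * int N ^ n))" by (simp only: mult_cancel_left) simp
    then show ?thesis by blast
  qed
  then obtain b :: "(nat \<Rightarrow> nat) \<Rightarrow> int" where b: "\<And>l. l \<in> Zqn n N \<Longrightarrow> G l * cnj (G l) = of_int (2 * b l)" by metis
  have vf: "v ^ k * cnj v ^ k = 1" for k using zeta_mult_cnj unfolding v_def by (metis power_mult_distrib power_one)
  have "(\<Sum>l\<in>Zqn n N. G l * cnj (G l)) =
      (\<Sum>l\<in>Zqn n N. \<Sum>x\<in>Zqn n N. \<Sum>y\<in>Zqn n N. (v ^ f (\<lambda>i. 2 * x i) * cnj v ^ f (\<lambda>i. 2 * y i)) * (cnj z ^ dotn n x l * z ^ dotn n y l))"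
    unfolding G_def cnj_sum sum_product by (intro sum.cong refl) simp
  also have "\<dots> = (\<Sum>x\<in>Zqn n N. \<Sum>l\<in>Zqn n N. \<Sum>y\<in>Zqn n N. (v ^ f (\<lambda>i. 2 * x i) * cnj v ^ f (\<lambda>i. 2 * y i)) * (cnj z ^ dotn n x l * z ^ dotn n y l))"
    by (rule sum.swap)
  also have "\<dots> = (\<Sum>x\<in>Zqn n N. \<Sum>y\<in>Zqn n N. \<Sum>l\<in>Zqn n N. (v ^ f (\<lambda>i. 2 * x i) * cnj v ^ f (\<lambda>i. 2 * y i)) * (cnj z ^ dotn n x l * z ^ dotn n y l))"
    by (rule sum.cong[OF refl]) (rule sum.swap)
  also have "\<dots> = (\<Sum>x\<in>Zqn n N. \<Sum>y\<in>Zqn n N. if x = y then of_nat N ^ n else 0)"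
  proof (intro sum.cong refl)
    fix x y assume xy: "x \<in> Zqn n N" "y \<in> Zqn n N"
    have "(\<forall>i<n. x i mod N = y i mod N) \<longleftrightarrow> x = y"
    proof
      assume *: "\<forall>i<n. x i mod N = y i mod N"
      show "x = y"
      proof
        fix i
        show "x i = y i" using * xy by (cases "i < n") (auto simp: Zqn_def)
      qed
    qed simp
    then show "(\<Sum>l\<in>Zqn n N. (v ^ f (\<lambda>i. 2 * x i) * cnj v ^ f (\<lambda>i. 2 * y i)) * (cnj z ^ dotn n x l * z ^ dotn n y l)) =
        (if x = y then of_nat N ^ n else 0)"
      unfolding sum_distrib_left[symmetric] sum_z_power_dotn using vf by auto
  qed
  also have "\<dots> = of_int (int N ^ n * int N ^ n)" using finite_Zqn by (simp add: card_Zqn)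
  finally have "of_int (int N ^ n * int N ^ n) = (\<Sum>l\<in>Zqn n N. G l * cnj (G l))" ..
  also have "\<dots> = (\<Sum>l\<in>Zqn n N. of_int (2 * b l))" using b by (intro sum.cong) auto
  also have "\<dots> = of_int (2 * (\<Sum>l\<in>Zqn n N. b l))" by (simp add: sum_distrib_left)
  finally have "int N ^ n * int N ^ n = 2 * (\<Sum>l\<in>Zqn n N. b l)" by (simp only: of_int_eq_iff)
  then have "even (int N ^ n * int N ^ n)" by simp
  then show False using N_odd by simp
qed

end

section \<open>The order of 2 modulo powers of p\<close>

text \<open>Exactly one factor \<open>p\<close> is gained, because \<open>(\<Sum>i<p. A ^ i)\<close>
  is \<open>p\<close> modulo the square of \<open>p\<close>: its linear part is
  \<open>p * h * x\<close> with \<open>h = (p - 1) / 2\<close> and \<open>p\<close> dividing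
  \<open>x\<close>.\<close>

lemma lift_exponent_step:
  fixes A u :: int
  assumes "prime p" "odd p" "0 < k" "A = 1 + int p ^ k * u" "\<not> int p dvd u"
  shows "\<exists>u'. A ^ p = 1 + int p ^ Suc k * u' \<and> \<not> int p dvd u'"
proof -
  define x where "x = int p ^ k * u"
  have "int p ^ k = int p * int p ^ (k - 1)" using assms(3) by (metis Suc_diff_1 power_Suc)
  then obtain y where y: "x = int p * y" unfolding x_def by (metis mult.assoc)
  have pw: "\<exists>v. A ^ i = 1 + int i * x + (int p)\<^sup>2 * v" for i
  proof (induction i)
    case 0
    then show ?case by (intro exI[of _ 0]) simp
  next
    case (Suc i)
    then obtain v where v: "A ^ i = 1 + int i * x + (int p)\<^sup>2 * v" by blast
    have "A = 1 + x" by (simp add: assms(4) x_def)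
    then have "A ^ Suc i = (1 + x) * (1 + int i * x + (int p)\<^sup>2 * v)" using v by (metis power_Suc)
    also have "\<dots> = 1 + int (Suc i) * x + (int i * (x * x) + (int p)\<^sup>2 * (v + x * v))" by (simp add: algebra_simps)
    also have "x * x = (int p)\<^sup>2 * (y * y)" by (simp add: y power2_eq_square)
    finally have "A ^ Suc i = 1 + int (Suc i) * x + (int p)\<^sup>2 * (int i * (y * y) + v + x * v)" by (simp add: algebra_simps)
    then show ?case by blast
  qed
  then obtain v where v: "\<And>i. A ^ i = 1 + int i * x + (int p)\<^sup>2 * v i" by metis
  obtain h where h: "p = 2 * h + 1" using assms(2) by (rule oddE)
  have tri: "(\<Sum>i<2 * h + 1. int i) = int ((2 * h + 1) * h)" by (induction h) (simp_all add: algebra_simps)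
  have "(\<Sum>i<p. A ^ i) = (\<Sum>i<p. 1 + int i * x + (int p)\<^sup>2 * v i)" by (simp only: v)
  also have "\<dots> = int p + (\<Sum>i<p. int i) * x + (int p)\<^sup>2 * (\<Sum>i<p. v i)"
    by (simp add: sum.distrib sum_distrib_left sum_distrib_right)
  also have "(\<Sum>i<p. int i) = int p * int h" unfolding h tri by (simp add: algebra_simps)
  also have "int p + int p * int h * x + (int p)\<^sup>2 * (\<Sum>i<p. v i) = int p * (1 + int p * (int h * y + (\<Sum>i<p. v i)))"
    unfolding y by (simp add: power2_eq_square algebra_simps)
  finally obtain s where s: "(\<Sum>i<p. A ^ i) = int p * (1 + int p * s)" by blast
  have "A ^ p - 1 = (A - 1) * (\<Sum>i<p. A ^ i)" by (rule power_diff_1_eq)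
  also have "\<dots> = int p ^ Suc k * (u * (1 + int p * s))" unfolding s by (simp add: assms(4))
  finally have "A ^ p = 1 + int p ^ Suc k * (u * (1 + int p * s))" by simp
  moreover have "\<not> int p dvd u * (1 + int p * s)"
  proof
    assume "int p dvd u * (1 + int p * s)"
    then have "int p dvd 1 + int p * s" using assms(1,5) prime_dvd_mult_iff[of "int p"] by auto
    then have "int p dvd 1" by (simp add: dvd_add_left_iff)
    then show False using assms(1) by auto
  qed
  ultimately show ?thesis by blast
qed

text \<open>For \<open>A = 2 ^ h\<close>, \<open>p\<close> divides \<open>A - 1\<close> exactly
  once, because the square of \<open>A\<close> is \<open>2 ^ (p - 1)\<close>. Hence
  \<open>A ^ (p ^ j) - 1\<close> contains \<open>p\<close> exactly \<open>j + 1\<close> times, and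
  the order, \<open>h\<close> times a power of \<open>p\<close>, is determined.\<close>

lemma ord_two_prime_power:
  assumes p: "prime p" "odd p" and nw: "[2 ^ (p - 1) \<noteq> 1] (mod p\<^sup>2)" and ordp: "2 * ord p 2 = p - 1" and "0 < e"
  shows "ord (p ^ e) 2 = p ^ (e - 1) * ord p 2"
proof -
  define h where "h = ord p 2"
  define A where "A = (2::int) ^ h"
  have "[(2::nat) ^ h = 1] (mod p)" unfolding h_def by (rule ord)
  then have "[int (2 ^ h) = int 1] (mod int p)" by (simp only: cong_int_iff)
  then have "int p dvd A - 1" by (simp add: A_def cong_iff_dvd_diff)
  then obtain u where "A - 1 = int p * u" by blast
  then have u: "A = 1 + int p ^ 1 * u" by simp
  have un: "\<not> int p dvd u"
  proof
    assume "int p dvd u"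
    then have "(int p)\<^sup>2 dvd A - 1" using u by (simp add: power2_eq_square)
    then have "[int (2 ^ h) = int 1] (mod int (p\<^sup>2))" by (simp add: A_def cong_iff_dvd_diff)
    then have "[(2::nat) ^ h = 1] (mod p\<^sup>2)" by (simp only: cong_int_iff)
    then have "[((2::nat) ^ h) ^ 2 = 1 ^ 2] (mod p\<^sup>2)" by (rule cong_pow)
    then have "[(2::nat) ^ (p - 1) = 1] (mod p\<^sup>2)" using ordp by (simp add: h_def power_mult[symmetric] mult.commute)
    then show False using nw by simp
  qed
  have lte: "\<exists>u. A ^ (p ^ j) = 1 + int p ^ Suc j * u \<and> \<not> int p dvd u" for j
  proof (induction j)
    case 0
    then show ?case using u un by auto
  next
    case (Suc j)
    then obtain u where "A ^ (p ^ j) = 1 + int p ^ Suc j * u" "\<not> int p dvd u" by blast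
    then have "\<exists>u'. (A ^ (p ^ j)) ^ p = 1 + int p ^ Suc (Suc j) * u' \<and> \<not> int p dvd u'"
      using lift_exponent_step[OF p] by blast
    then show ?case by (simp add: power_mult[symmetric] mult.commute)
  qed
  have conv: "[(2::nat) ^ (h * k) = 1] (mod p ^ i) \<longleftrightarrow> int p ^ i dvd A ^ k - 1" for k i
  proof -
    have "[(2::nat) ^ (h * k) = 1] (mod p ^ i) \<longleftrightarrow> [int (2 ^ (h * k)) = int 1] (mod int (p ^ i))" by (simp only: cong_int_iff)
    then show ?thesis by (simp add: cong_iff_dvd_diff A_def power_mult)
  qed
  define d where "d = ord (p ^ e) 2"
  obtain u1 where "A ^ (p ^ (e - 1)) = 1 + int p ^ Suc (e - 1) * u1" using lte by blast
  then have "int p ^ e dvd A ^ (p ^ (e - 1)) - 1" using \<open>0 < e\<close> by simp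
  then have d1: "d dvd h * p ^ (e - 1)" unfolding conv[symmetric] d_def ord_divides .
  have "[(2::nat) ^ d = 1] (mod p ^ e)" unfolding d_def by (rule ord)
  then have "[(2::nat) ^ d = 1] (mod p)" using \<open>0 < e\<close> by (metis cong_dvd_modulus_nat dvd_power)
  then have "h dvd d" unfolding h_def ord_divides .
  then obtain d' where d': "d = h * d'" by blast
  have h0: "h \<noteq> 0" using ordp p prime_gt_1_nat[OF p(1)] by (auto simp: h_def)
  then have "d' dvd p ^ (e - 1)" using d1 by (simp add: d')
  then obtain j where j: "j \<le> e - 1" "d' = p ^ j" using divides_primepow_nat[OF p(1)] by blast
  have "j = e - 1"
  proof (rule ccontr)
    assume "j \<noteq> e - 1"
    then have je: "Suc (Suc j) \<le> e" using j by simp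
    obtain u where u: "A ^ (p ^ j) = 1 + int p ^ Suc j * u" "\<not> int p dvd u" using lte by blast
    have "int p ^ e dvd A ^ (p ^ j) - 1" unfolding conv[symmetric] using \<open>[(2::nat) ^ d = 1] (mod p ^ e)\<close> by (simp add: d' j)
    then have "int p ^ Suc (Suc j) dvd int p ^ Suc j * u" using le_imp_power_dvd[OF je, of "int p"] u by (metis add_diff_cancel_left' dvd_trans)
    then have "int p ^ Suc j * int p dvd int p ^ Suc j * u" by (simp add: mult.commute)
    then show False using u(2) p by (subst (asm) dvd_times_left_cancel_iff) auto
  qed
  then show ?thesis using d' j by (simp add: d_def h_def mult.commute)
qed

theorem theorem1:
  fixes p :: nat and P :: "complex set"
  assumes "prime p" and "p mod 8 = 7"
    and "ord p 2 = (p - 1) div 2"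
    and "is_prime_ideal (OK p) P" and "2 \<in> P"
  shows "(\<nexists>f. is_GBF (class_order (OK p) P) (2 * p) f) \<and>
         ([2 ^ (p - 1) \<noteq> 1] (mod p ^ 2) \<longrightarrow>
            (\<forall>e::nat. e \<ge> 1 \<longrightarrow> (\<nexists>f. is_GBF (class_order (OK p) P) (2 * p ^ e) f)))"
proof -
  interpret prime_7_mod_8 p by unfold_locales (use assms in auto)
  define t where "t = class_order (OK p) P"
  have t: "odd t" "\<And>d. 0 < d \<Longrightarrow> odd_rep p d \<Longrightarrow> t \<le> d"
    unfolding t_def using class_order_odd class_order_le assms(4,5) by blast+
  have ordp: "2 * ord p 2 = p - 1" using assms(2,3) by presburger
  have main: "\<nexists>f. is_GBF t (2 * p ^ e) f" if e: "0 < e" and o: "ord (p ^ e) 2 = p ^ (e - 1) * ord p 2" for e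
  proof -
    interpret prime_power_cyclotomic p e by unfold_locales (use assms e in auto)
    \<comment> \<open>The order and the totient both gain the factor \<open>p ^ (e - 1)\<close>, so
      the index two persists modulo \<open>N\<close>.\<close>
    have "2 * ord N 2 = totient N"
      unfolding N_def o totient_prime_power[OF assms(1) e] ordp[symmetric] by simp
    then interpret two_half_order p e by unfold_locales (use assms ordp in auto)
    show ?thesis using no_GBF[OF t] by (simp add: N_def)
  qed
  \<comment> \<open>For \<open>e = 1\<close> the required order formula is trivial.\<close>
  have "\<nexists>f. is_GBF t (2 * p) f" using main[of 1] by simp
  moreover have "\<nexists>f. is_GBF t (2 * p ^ e) f" if "[2 ^ (p - 1) \<noteq> 1] (mod p ^ 2)" "e \<ge> 1" for e
    using main[of e] ord_two_prime_power[OF assms(1) p_odd that(1) ordp] that(2) by simp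
  ultimately show ?thesis unfolding t_def by blast
qed

end
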